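(* Let $N\in\mathbb{N}$, $\mathbf{y}\in\mathbb{R}^{2^N\times2^N}$, $\theta\in\,]0,1]$, $\lambda>0$, and let $$\mathcal{V}=\underset{f\in\mathcal{M}^+_{\mathrm{D}\otimes\mathrm{D},0}(\mathrm{K})}{\operatorname{argmin}}\big(\|\mathbf{y}-\boldsymbol{\nu}\{f\}\|_2^2+\lambda\|f\|_\theta\big),\qquad \mathcal{V}_n=\underset{f\in\mathcal{M}^+_{\mathrm{D}\otimes\mathrm{D},0}(\mathcal{X}_n)}{\operatorname{argmin}}\big(\|\mathbf{y}-\boldsymbol{\nu}\{f\}\|_2^2+\lambda\|f\|_\theta\big),$$ where $[\boldsymbol{\nu}\{f\}]_{\mathbf{n}}=\int_{E^N_{\mathbf{n}}}f(\mathbf{x})\,\mathrm{d}\mathbf{x}$ for all $\mathbf{n}\in\{1,\dots,2^N\}^2$. Then, for all $N_2\ge N_1\ge N$, the inclusions $$\mathcal{V}_{N_1}\subset\mathcal{V}_{N_2}\subset\mathcal{V}$$ hold true.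
   Context: $\mathrm{K}=[0,1]^2$ and $\mathrm{K}^c=\mathbb{R}^2\setminus\mathrm{K}$. Derivatives are in the sense of distributions: for $f\in\mathcal{D}'(\mathbb{R}^2)$, $[\mathrm{D}\otimes\mathrm{I}]\{f\}=\partial_{x_1}f$, $[\mathrm{I}\otimes\mathrm{D}]\{f\}=\partial_{x_2}f$, $[\mathrm{D}\otimes\mathrm{D}]\{f\}=\partial_{x_1}\partial_{x_2}f$. $\mathcal{M}(\mathrm{K})$ is the space of bounded (finite signed) Borel measures on $\mathbb{R}^2$ supported in $\mathrm{K}$, with total variation norm $\|\cdot\|_{\mathcal{M}}$. Define $$\mathcal{M}_{\mathrm{D}\otimes\mathrm{D},0}(\mathrm{K})=\{f\in\mathcal{D}'(\mathbb{R}^2):\ [\mathrm{D}\otimes\mathrm{D}]\{f\}\in\mathcal{M}(\mathrm{K})\ \text{and}\ \langle f,\phi\rangle=0\ \ \forall\phi\in\mathcal{C}_c^\infty(\mathrm{K}^c)\},$$ $$\|\nabla\{f\}\|_{\mathcal{M}^2}=\|[\mathrm{I}\otimes\mathrm{D}]\{f\}\|_{\mathcal{M}}+\|[\mathrm{D}\otimes\mathrm{I}]\{f\}\|_{\mathcal{M}},$$ $$\|f\|_\theta=\theta\,\|[\mathrm{D}\otimes\mathrm{D}]\{f\}\|_{\mathcal{M}}+(1-\theta)\,\|\nabla\{f\}\|_{\mathcal{M}^2}.$$ (Elements of $\mathcal{M}_{\mathrm{D}\otimes\mathrm{D},0}(\mathrm{K})$ are bounded measurable functions supported in $\mathrm{K}$,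 so their integrals over pixels make sense.) The convex cone of positive functions is $\mathcal{M}^+_{\mathrm{D}\otimes\mathrm{D},0}(\mathrm{K})=\{f\in\mathcal{M}_{\mathrm{D}\otimes\mathrm{D},0}(\mathrm{K}):\forall\phi\in\mathcal{C}_c^\infty(\mathbb{R}^2),\ \phi\ge0\Rightarrow\langle f,\phi\rangle\ge0\}$. The pixels at resolution $N$ are $E^N_{n_1,n_2}=\big[\tfrac{n_1-1}{2^N},\tfrac{n_1}{2^N}\big]\times\big[\tfrac{n_2-1}{2^N},\tfrac{n_2}{2^N}\big]$, $1\le n_1,n_2\le2^N$. The grid is $\mathcal{X}_n=2^{-n}\{0,\dots,2^n\}\times2^{-n}\{0,\dots,2^n\}$ (with $(2^n+1)^2$ knots), and $\mathcal{M}^+_{\mathrm{D}\otimes\mathrm{D},0}(\mathcal{X}_n)=\{f\in\mathcal{M}^+_{\mathrm{D}\otimes\mathrm{D},0}(\mathrm{K}):[\mathrm{D}\otimes\mathrm{D}]\{f\}\in\mathcal{M}(\mathcal{X}_n)\}$, where $\mathcal{M}(\mathcal{X}_n)$ is the set of measures supported on $\mathcal{X}_n$. $\|\cdot\|_2$ is the Euclidean (Frobenius) norm on $\mathbb{R}^{2^N\times2^N}$. *)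

theory Defs
  imports "HOL-Analysis.Analysis"
begin

type_synonym plane = "real \<times> real"

definition partial1 :: "(plane \<Rightarrow> real) \<Rightarrow> plane \<Rightarrow> real" where
  "partial1 \<phi> x = frechet_derivative \<phi> (at x) (1, 0)"

definition partial2 :: "(plane \<Rightarrow> real) \<Rightarrow> plane \<Rightarrow> real" where
  "partial2 \<phi> x = frechet_derivative \<phi> (at x) (0, 1)"

primrec C_k :: "nat \<Rightarrow> (plane \<Rightarrow> real) \<Rightarrow> bool" where
  "C_k 0 \<phi> \<longleftrightarrow> continuous_on UNIV \<phi>"
| "C_k (Suc k) \<phi> \<longleftrightarrow>
     \<phi> differentiable_on UNIV \<and> C_k k (partial1 \<phi>) \<and> C_k k (partial2 \<phi>)"

definition fun_support :: "(plane \<Rightarrow> real) \<Rightarrow> plane set" where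
  "fun_support \<phi> = closure {x. \<phi> x \<noteq> 0}"

definition test_functions :: "plane set \<Rightarrow> (plane \<Rightarrow> real) set" where
  "test_functions U =
     {\<phi>. (\<forall>k. C_k k \<phi>) \<and> compact (fun_support \<phi>) \<and> fun_support \<phi> \<subseteq> U}"

text \<open>
  A distribution is a functional on test functions. It is made \<open>undefined\<close> elsewhere
  (\<open>extensional\<close>), so that distributions are equal iff they agree on test functions.
  Continuity is expressed by the usual seminorm estimates on compact sets.
\<close>

type_synonym functional = "(plane \<Rightarrow> real) \<Rightarrow> real"

definition distributions :: "functional set" where
  "distributions =
     {T \<in> extensional (test_functions UNIV).
        (\<forall>\<phi>\<in>test_functions UNIV. \<forall>\<psi>\<in>test_functions UNIV.
           T (\<lambda>x. \<phi> x + \<psi> x) = T \<phi> + T \<psi>) \<and>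
        (\<forall>c. \<forall>\<phi>\<in>test_functions UNIV. T (\<lambda>x. c * \<phi> x) = c * T \<phi>) \<and>
        (\<forall>C. compact C \<longrightarrow>
           (\<exists>b m. \<forall>\<phi>\<in>test_functions UNIV. fun_support \<phi> \<subseteq> C \<longrightarrow>
              \<bar>T \<phi>\<bar> \<le> b * (\<Sum>i\<le>m. \<Sum>j\<le>m. SUP x. \<bar>(partial1 ^^ i) ((partial2 ^^ j) \<phi>) x\<bar>)))}"

definition D_I :: "functional \<Rightarrow> functional" where
  "D_I T = (\<lambda>\<phi>\<in>test_functions UNIV. - T (partial1 \<phi>))"

definition I_D :: "functional \<Rightarrow> functional" where
  "I_D T = (\<lambda>\<phi>\<in>test_functions UNIV. - T (partial2 \<phi>))"

definition D_D :: "functional \<Rightarrow> functional" where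
  "D_D T = D_I (I_D T)"

definition dist_of_fun :: "(plane \<Rightarrow> real) \<Rightarrow> functional" where
  "dist_of_fun g = (\<lambda>\<phi>\<in>test_functions UNIV. \<integral>x. g x * \<phi> x \<partial>lborel)"

definition locally_integrable :: "(plane \<Rightarrow> real) \<Rightarrow> bool" where
  "locally_integrable g \<longleftrightarrow>
     g \<in> borel_measurable borel \<and> (\<forall>C. compact C \<longrightarrow> set_integrable lborel C g)"

text \<open>A representing function is unique almost everywhere; only its integrals are used below.\<close>

definition fun_of_dist :: "functional \<Rightarrow> plane \<Rightarrow> real" where
  "fun_of_dist T = (SOME g. locally_integrable g \<and> T = dist_of_fun g)"

text \<open>A finite signed measure is a real-valued set function, \<open>undefined\<close> on non-Borel sets.\<close>

definition signed_measures :: "(plane set \<Rightarrow> real) set" where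
  "signed_measures =
     {\<mu> \<in> extensional (sets borel).
        \<forall>A::nat \<Rightarrow> plane set. range A \<subseteq> sets borel \<longrightarrow> disjoint_family A \<longrightarrow>
          (\<lambda>i. \<mu> (A i)) sums \<mu> (\<Union>i. A i)}"

text \<open>
  Jordan decomposition: the positive variation of a Borel set is the supremum of \<open>\<mu>\<close> over
  its Borel subsets. The embedding \<open>ennreal\<close> truncates negative values to 0, which does
  not affect the supremum, since the empty set is among the subsets.
\<close>

definition pos_variation :: "(plane set \<Rightarrow> real) \<Rightarrow> plane measure" where
  "pos_variation \<mu> =
     measure_of UNIV (sets borel) (\<lambda>A. SUP B\<in>{B \<in> sets borel. B \<subseteq> A}. ennreal (\<mu> B))"

definition neg_variation :: "(plane set \<Rightarrow> real) \<Rightarrow> plane measure" where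
  "neg_variation \<mu> = pos_variation (\<lambda>A. - \<mu> A)"

definition signed_integral :: "(plane set \<Rightarrow> real) \<Rightarrow> (plane \<Rightarrow> real) \<Rightarrow> real" where
  "signed_integral \<mu> \<phi> =
     (\<integral>x. \<phi> x \<partial>pos_variation \<mu>) - (\<integral>x. \<phi> x \<partial>neg_variation \<mu>)"

definition total_variation :: "(plane set \<Rightarrow> real) \<Rightarrow> real" where
  "total_variation \<mu> = measure (pos_variation \<mu>) UNIV + measure (neg_variation \<mu>) UNIV"

definition dist_of_measure :: "(plane set \<Rightarrow> real) \<Rightarrow> functional" where
  "dist_of_measure \<mu> = (\<lambda>\<phi>\<in>test_functions UNIV. signed_integral \<mu> \<phi>)"

text \<open>
  \<open>M_space S\<close>, meant for closed \<open>S\<close>: the distributions that are finite signed Borel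
  measures supported in \<open>S\<close>.
\<close>

definition M_space :: "plane set \<Rightarrow> functional set" where
  "M_space S =
     {dist_of_measure \<mu> | \<mu>. \<mu> \<in> signed_measures \<and> (\<forall>A\<in>sets borel. A \<inter> S = {} \<longrightarrow> \<mu> A = 0)}"

text \<open>A signed measure is determined by its values on test functions; \<open>M_norm\<close> is junk on
  distributions that are not finite signed measures.\<close>

definition M_norm :: "functional \<Rightarrow> real" where
  "M_norm T = total_variation (THE \<mu>. \<mu> \<in> signed_measures \<and> T = dist_of_measure \<mu>)"

definition K :: "plane set" where
  "K = {0..1} \<times> {0..1}"

definition grid :: "nat \<Rightarrow> plane set" where
  "grid n = (\<lambda>k. real k / 2 ^ n) ` {0..2 ^ n} \<times> (\<lambda>k. real k / 2 ^ n) ` {0..2 ^ n}"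

definition M_DD0 :: "functional set" where
  "M_DD0 = {f \<in> distributions. D_D f \<in> M_space K \<and> (\<forall>\<phi>\<in>test_functions (- K). f \<phi> = 0)}"

definition M_DD0_pos :: "functional set" where
  "M_DD0_pos = {f \<in> M_DD0. \<forall>\<phi>\<in>test_functions UNIV. (\<forall>x. \<phi> x \<ge> 0) \<longrightarrow> f \<phi> \<ge> 0}"

definition M_DD0_pos_grid :: "nat \<Rightarrow> functional set" where
  "M_DD0_pos_grid n = {f \<in> M_DD0_pos. D_D f \<in> M_space (grid n)}"

definition grad_norm :: "functional \<Rightarrow> real" where
  "grad_norm f = M_norm (I_D f) + M_norm (D_I f)"

definition theta_norm :: "real \<Rightarrow> functional \<Rightarrow> real" where
  "theta_norm \<theta> f = \<theta> * M_norm (D_D f) + (1 - \<theta>) * grad_norm f"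

definition pixel :: "nat \<Rightarrow> nat \<times> nat \<Rightarrow> plane set" where
  "pixel N = (\<lambda>(n1, n2).
     {(real n1 - 1) / 2 ^ N .. real n1 / 2 ^ N} \<times> {(real n2 - 1) / 2 ^ N .. real n2 / 2 ^ N})"

definition \<nu> :: "nat \<Rightarrow> functional \<Rightarrow> nat \<times> nat \<Rightarrow> real" where
  "\<nu> N f n = set_lebesgue_integral lborel (pixel N n) (fun_of_dist f)"

text \<open>
  An image in \<open>\<real>\<^bsup>2^N \<times> 2^N\<^esup>\<close> is a function on index pairs, of which only the entries
  with indices in \<open>{1..2^N}\<close> are used.
\<close>

definition objective :: "nat \<Rightarrow> (nat \<times> nat \<Rightarrow> real) \<Rightarrow> real \<Rightarrow> real \<Rightarrow> functional \<Rightarrow> real" where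
  "objective N y \<theta> lam f =
     (L2_set (\<lambda>n. y n - \<nu> N f n) ({1..2 ^ N} \<times> {1..2 ^ N}))\<^sup>2 + lam * theta_norm \<theta> f"

definition argmin_on :: "functional set \<Rightarrow> (functional \<Rightarrow> real) \<Rightarrow> functional set" where
  "argmin_on S J = {f. is_arg_min J (\<lambda>g. g \<in> S) f}"

definition V_cont :: "nat \<Rightarrow> (nat \<times> nat \<Rightarrow> real) \<Rightarrow> real \<Rightarrow> real \<Rightarrow> functional set" where
  "V_cont N y \<theta> lam = argmin_on M_DD0_pos (objective N y \<theta> lam)"

definition V_grid :: "nat \<Rightarrow> (nat \<times> nat \<Rightarrow> real) \<Rightarrow> real \<Rightarrow> real \<Rightarrow> nat \<Rightarrow> functional set" where
  "V_grid N y \<theta> lam n = argmin_on (M_DD0_pos_grid n) (objective N y \<theta> lam)"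

end

theory Submission
  imports Defs "HOL-Probability.Giry_Monad"
begin

text \<open>
  Fix \<open>n \<ge> N\<close> and replace an admissible f by its pixel averages at level n, that is, by its
  conditional expectation on the dyadic grid. The average is again positive and vanishes off K,
  its mixed derivative sits on the grid points, and its integrals over the coarser pixels of level
  N are those of f, so the data term is unchanged. The point is that averaging does not increase
  any of the three total variations in the regulariser. Hence minimising over a finer grid, or over
  all functions, cannot give a smaller value than minimising over the grid of level n
  (\<open>discretization_exists\<close>), and both inclusions follow, since the admissible sets increase with
  the level.

  Why the norms contract: if f has the mixed derivative \<mu> and vanishes off K, then
  \<open>f x = \<mu> {t. t \<le> x}\<close> (\<open>M_DD0_cdf2\<close>). Averaging the step function \<open>x \<mapsto> 1\<close> if \<open>t \<le> x\<close> over dyadic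
  cells gives, in one variable, a convex combination of the steps at the two endpoints of the cell
  that contains t, the weights being the piecewise linear hat functions at t. So the mixed
  derivative of the average is \<open>\<Sum> (\<integral> w\<^sub>j d\<mu>) \<lambda>\<^sub>j\<close>, with nonnegative weights \<open>w\<^sub>j\<close> of sum at most 1
  (products of two hats) and probability measures \<open>\<lambda>\<^sub>j\<close> (Dirac masses at grid points). The two first
  derivatives have the same form: the hat is kept in the direction of the derivative, while in the
  other direction the weight is the indicator of a cell and \<open>\<lambda>\<^sub>j\<close> is uniform on a grid segment. Any
  such map sends \<open>\<alpha> - \<beta>\<close> with \<open>\<alpha>, \<beta>\<close> positive to a difference of positive measures of no larger
  mass; taking the Jordan decomposition for \<open>\<alpha>, \<beta>\<close> shows that the total variation does not
  increase (\<open>averaging_contraction\<close>).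

  The norm of a distribution is handled through \<open>M_norm_le\<close> and \<open>M_norm_attained\<close>: it is the least
  total mass of two positive measures \<open>\<alpha>, \<beta>\<close> with \<open>T \<phi> = \<integral>\<phi> d\<alpha> - \<integral>\<phi> d\<beta>\<close>. This
  rests on the Jordan decomposition and on the fact that test functions determine a signed measure.
\<close>

section \<open>Signed measures and their Jordan decomposition\<close>

definition fin_borel :: "plane measure \<Rightarrow> bool" where
  "fin_borel \<alpha> \<longleftrightarrow> finite_measure \<alpha> \<and> sets \<alpha> = sets borel"

lemma fin_borelD:
  assumes "fin_borel \<alpha>"
  shows "finite_measure \<alpha>" "sets \<alpha> = sets borel" "space \<alpha> = UNIV"
  using assms sets_eq_imp_space_eq[of \<alpha> borel] by (auto simp: fin_borel_def)

text \<open>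
  Restricted to Borel sets, so that it meets the extensionality requirement of
  \<open>signed_measures\<close> and the Jordan decomposition is an equality of functions.
\<close>

definition measure_diff :: "plane measure \<Rightarrow> plane measure \<Rightarrow> plane set \<Rightarrow> real" where
  "measure_diff \<alpha> \<beta> = (\<lambda>A\<in>sets borel. measure \<alpha> A - measure \<beta> A)"

lemma measure_diff_signed:
  assumes "fin_borel \<alpha>" "fin_borel \<beta>"
  shows "measure_diff \<alpha> \<beta> \<in> signed_measures"
proof -
  have "(\<lambda>i. measure_diff \<alpha> \<beta> (A i)) sums measure_diff \<alpha> \<beta> (\<Union>i. A i)"
    if A: "range A \<subseteq> sets borel" "disjoint_family A" for A :: "nat \<Rightarrow> plane set"
  proof -
    have s: "(\<lambda>i. measure \<gamma> (A i)) sums measure \<gamma> (\<Union>i. A i)" if "fin_borel \<gamma>" for \<gamma>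
      using finite_measure.finite_measure_UNION[of \<gamma> A] A fin_borelD[OF that] by auto
    have "A i \<in> sets borel" for i using A(1) by auto
    then show ?thesis
      using sums_diff[OF s[OF assms(1)] s[OF assms(2)]] by (simp add: measure_diff_def sets.countable_UN)
  qed
  then show ?thesis by (auto simp: signed_measures_def measure_diff_def)
qed

lemma signed_measure_sums:
  assumes "\<mu> \<in> signed_measures" "\<And>i::nat. A i \<in> sets borel" "disjoint_family A"
  shows "(\<lambda>i. \<mu> (A i)) sums \<mu> (\<Union>i. A i)"
proof -
  have "range A \<subseteq> sets borel" using assms(2) by blast
  then show ?thesis using assms(1,3) unfolding signed_measures_def by blast
qed

lemma signed_measure_empty:
  assumes "\<mu> \<in> signed_measures" shows "\<mu> {} = 0"
proof -
  have "(\<lambda>i::nat. \<mu> {}) sums \<mu> (\<Union>i::nat. {})"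
    by (rule signed_measure_sums[OF assms]) (auto simp: disjoint_family_on_def)
  then show ?thesis using sums_summable summable_const_iff by blast
qed

lemma signed_measure_Un:
  assumes "\<mu> \<in> signed_measures" "A \<in> sets borel" "B \<in> sets borel" "A \<inter> B = {}"
  shows "\<mu> (A \<union> B) = \<mu> A + \<mu> B"
proof -
  have "(\<lambda>i. \<mu> (binaryset A B i)) sums \<mu> (\<Union>i. binaryset A B i)"
    using assms by (intro signed_measure_sums) (auto simp: disjoint_family_on_def binaryset_def)
  moreover have "(\<lambda>i. \<mu> (binaryset A B i)) sums (\<mu> A + \<mu> B)"
    by (rule binaryset_sums) (rule signed_measure_empty[OF assms(1)])
  ultimately show ?thesis using sums_unique2 UN_binaryset_eq by metis
qed

lemma signed_measure_Diff:
  assumes "\<mu> \<in> signed_measures" "A \<in> sets borel" "B \<in> sets borel" "B \<subseteq> A"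
  shows "\<mu> (A - B) = \<mu> A - \<mu> B"
proof -
  have "\<mu> (B \<union> (A - B)) = \<mu> B + \<mu> (A - B)" using assms by (intro signed_measure_Un) auto
  moreover have "B \<union> (A - B) = A" using assms by auto
  ultimately show ?thesis by simp
qed

lemma signed_measure_uminus:
  assumes "\<mu> \<in> signed_measures"
  shows "(\<lambda>A\<in>sets borel. - \<mu> A) \<in> signed_measures"
  using assms unfolding signed_measures_def
  by (auto intro!: sums_minus simp: sets.countable_UN subset_eq)

text \<open>
  The set function from which \<open>pos_variation\<close> is built; that it is countably additive is what makes
  \<open>measure_of\<close> return it unchanged.
\<close>

definition upper_variation :: "(plane set \<Rightarrow> real) \<Rightarrow> plane set \<Rightarrow> ennreal" where
  "upper_variation \<mu> A = (SUP B\<in>{B \<in> sets borel. B \<subseteq> A}. ennreal (\<mu> B))"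

lemma upper_variation_upper:
  "B \<in> sets borel \<Longrightarrow> B \<subseteq> A \<Longrightarrow> ennreal (\<mu> B) \<le> upper_variation \<mu> A"
  unfolding upper_variation_def by (rule SUP_upper) auto

lemma upper_variation_empty:
  assumes "\<mu> \<in> signed_measures" shows "upper_variation \<mu> {} = 0"
proof -
  have "{B \<in> sets borel. B \<subseteq> {}} = {{} :: plane set}" by auto
  then show ?thesis by (simp add: upper_variation_def signed_measure_empty[OF assms])
qed

lemma upper_variation_mono: "A \<subseteq> A' \<Longrightarrow> upper_variation \<mu> A \<le> upper_variation \<mu> A'"
  unfolding upper_variation_def by (rule SUP_subset_mono) auto

text \<open>
  Subsets of A and of B that nearly attain the two suprema combine to a subset of the union. A
  subset of negative measure contributes 0 because of the truncation by \<open>ennreal\<close>, and is dropped.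
\<close>

lemma upper_variation_superadditive:
  assumes \<mu>: "\<mu> \<in> signed_measures" and AB: "A \<inter> B = {}"
  shows "upper_variation \<mu> A + upper_variation \<mu> B \<le> upper_variation \<mu> (A \<union> B)"
proof -
  have 1: "ennreal (\<mu> C) + ennreal (\<mu> D) \<le> upper_variation \<mu> (A \<union> B)"
    if "C \<in> sets borel" "C \<subseteq> A" "D \<in> sets borel" "D \<subseteq> B" for C D
  proof (cases "\<mu> C \<le> 0 \<or> \<mu> D \<le> 0")
    case True
    then show ?thesis
    proof
      assume "\<mu> C \<le> 0"
      then have "ennreal (\<mu> C) + ennreal (\<mu> D) = ennreal (\<mu> D)" by (simp add: ennreal_neg)
      then show ?thesis using upper_variation_upper[of D "A \<union> B" \<mu>] that by auto
    next
      assume "\<mu> D \<le> 0"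
      then have "ennreal (\<mu> C) + ennreal (\<mu> D) = ennreal (\<mu> C)" by (simp add: ennreal_neg)
      then show ?thesis using upper_variation_upper[of C "A \<union> B" \<mu>] that by auto
    qed
  next
    case False
    then have "ennreal (\<mu> C) + ennreal (\<mu> D) = ennreal (\<mu> C + \<mu> D)"
      by (simp add: ennreal_plus)
    also have "\<mu> C + \<mu> D = \<mu> (C \<union> D)"
      by (rule signed_measure_Un[symmetric]) (use that \<mu> AB in auto)
    finally show ?thesis using upper_variation_upper[of "C \<union> D" "A \<union> B" \<mu>] that by auto
  qed
  have ne: "{B \<in> sets borel. B \<subseteq> X} \<noteq> {}" for X :: "plane set" by auto
  have "upper_variation \<mu> A + ennreal (\<mu> D) \<le> upper_variation \<mu> (A \<union> B)"
    if "D \<in> sets borel" "D \<subseteq> B" for D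
    unfolding upper_variation_def[of \<mu> A]
    by (subst ennreal_SUP_add_left[OF ne, symmetric]) (auto intro!: SUP_least 1 that)
  then show ?thesis
    unfolding upper_variation_def[of \<mu> B]
    using SUP_least[of "{D \<in> sets borel. D \<subseteq> B}" "\<lambda>D. upper_variation \<mu> A + ennreal (\<mu> D)"]
    by (simp add: ennreal_SUP_add_right[OF ne])
qed

text \<open>
  One inequality is superadditivity on finite unions. The other cuts a subset B of the union into
  the pieces \<open>B \<inter> A i\<close> and uses countable additivity of \<mu> on them.
\<close>

lemma upper_variation_countably_additive:
  assumes \<mu>: "\<mu> \<in> signed_measures"
  shows "countably_additive (sets borel) (upper_variation \<mu>)"
  unfolding countably_additive_def
proof (intro allI impI)
  fix A :: "nat \<Rightarrow> plane set"
  assume A: "range A \<subseteq> sets borel" "disjoint_family A"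
  have e0: "upper_variation \<mu> {} = 0"
    by (rule upper_variation_empty[OF \<mu>])
  have fin: "(\<Sum>i<n. upper_variation \<mu> (A i)) \<le> upper_variation \<mu> (\<Union>i<n. A i)" for n
  proof (induction n)
    case (Suc n)
    have dj: "(\<Union>i<n. A i) \<inter> A n = {}"
    proof -
      have "A i \<inter> A n = {}" if "i < n" for i
        using disjoint_family_onD[OF A(2)] that by simp
      then show ?thesis by auto
    qed
    have "(\<Sum>i<Suc n. upper_variation \<mu> (A i)) \<le> upper_variation \<mu> (\<Union>i<n. A i) + upper_variation \<mu> (A n)"
      using Suc by (simp add: add_right_mono)
    also have "\<dots> \<le> upper_variation \<mu> ((\<Union>i<n. A i) \<union> A n)"
      by (rule upper_variation_superadditive[OF \<mu> dj])
    also have "(\<Union>i<n. A i) \<union> A n = (\<Union>i<Suc n. A i)" by (auto simp: less_Suc_eq)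
    finally show ?case .
  qed (simp add: e0)
  show "(\<Sum>i. upper_variation \<mu> (A i)) = upper_variation \<mu> (\<Union>i. A i)"
  proof (rule antisym)
    show "(\<Sum>i. upper_variation \<mu> (A i)) \<le> upper_variation \<mu> (\<Union>i. A i)"
      unfolding suminf_eq_SUP
      by (intro SUP_least order_trans[OF fin] upper_variation_mono) auto
    show "upper_variation \<mu> (\<Union>i. A i) \<le> (\<Sum>i. upper_variation \<mu> (A i))"
      unfolding upper_variation_def[of \<mu> "\<Union>i. A i"]
    proof (rule SUP_least)
      fix B :: "plane set" assume "B \<in> {B \<in> sets borel. B \<subseteq> (\<Union>i. A i)}"
      then have B: "B \<in> sets borel" "B \<subseteq> (\<Union>i. A i)" by auto
      have "(\<lambda>i. \<mu> (B \<inter> A i)) sums \<mu> (\<Union>i. B \<inter> A i)"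
        using A B by (intro signed_measure_sums[OF \<mu>]) (auto simp: disjoint_family_on_def)
      moreover have "(\<Union>i. B \<inter> A i) = B" using B by auto
      ultimately have "(\<lambda>n. \<Sum>i<n. \<mu> (B \<inter> A i)) \<longlonglongrightarrow> \<mu> B" by (simp add: sums_def)
      then have lim: "(\<lambda>n. ennreal (\<Sum>i<n. \<mu> (B \<inter> A i))) \<longlonglongrightarrow> ennreal (\<mu> B)"
        by (rule tendsto_ennrealI)
      have "ennreal (\<Sum>i<n. \<mu> (B \<inter> A i)) \<le> (\<Sum>i. upper_variation \<mu> (A i))" for n
      proof -
        have "ennreal (\<Sum>i<n. \<mu> (B \<inter> A i)) \<le> ennreal (\<Sum>i<n. max 0 (\<mu> (B \<inter> A i)))"
          by (intro ennreal_leI sum_mono) auto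
        also have "\<dots> = (\<Sum>i<n. ennreal (max 0 (\<mu> (B \<inter> A i))))"
          by (rule sum_ennreal[symmetric]) auto
        also have "\<dots> = (\<Sum>i<n. ennreal (\<mu> (B \<inter> A i)))" by (simp add: ennreal_max_0)
        also have "\<dots> \<le> (\<Sum>i<n. upper_variation \<mu> (A i))"
          using A B by (intro sum_mono upper_variation_upper) auto
        also have "\<dots> \<le> (\<Sum>i. upper_variation \<mu> (A i))" by (rule sum_le_suminf) auto
        finally show ?thesis .
      qed
      then show "ennreal (\<mu> B) \<le> (\<Sum>i. upper_variation \<mu> (A i))"
        by (intro LIMSEQ_le_const2[OF lim]) auto
    qed
  qed
qed

lemma sets_pos_variation: "sets (pos_variation \<mu>) = sets borel"
  unfolding pos_variation_def
  using sets.sigma_sets_eq[of "borel :: plane measure"] by simp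

lemma emeasure_pos_variation:
  assumes "\<mu> \<in> signed_measures" "A \<in> sets borel"
  shows "emeasure (pos_variation \<mu>) A = upper_variation \<mu> A"
  unfolding pos_variation_def upper_variation_def[symmetric]
proof (rule emeasure_measure_of_sigma)
  show "sigma_algebra UNIV (sets (borel :: plane measure))"
    using sets.sigma_algebra_axioms[of borel] by simp
  show "positive (sets borel) (upper_variation \<mu>)"
    by (simp add: positive_def upper_variation_empty[OF assms(1)])
qed (use assms upper_variation_countably_additive in auto)

lemma upper_variation_split:
  assumes "\<mu> \<in> signed_measures" "A \<in> sets borel" "B \<in> sets borel" "B \<subseteq> A"
  shows "upper_variation \<mu> A = upper_variation \<mu> B + upper_variation \<mu> (A - B)"
proof -
  have "emeasure (pos_variation \<mu>) (B \<union> (A - B))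
      = emeasure (pos_variation \<mu>) B + emeasure (pos_variation \<mu>) (A - B)"
    by (rule plus_emeasure[symmetric]) (use assms in \<open>auto simp: sets_pos_variation\<close>)
  moreover have "B \<union> (A - B) = A" using assms by auto
  ultimately show ?thesis using assms by (simp add: emeasure_pos_variation)
qed

text \<open>
  If the variation were infinite, one could split off sets of measure at least 1 in absolute
  value again and again, keeping a remainder of infinite variation; the measures of these disjoint
  sets would have to form a convergent series, but do not tend to 0.
\<close>

lemma upper_variation_finite:
  assumes \<mu>: "\<mu> \<in> signed_measures"
  shows "upper_variation \<mu> UNIV < \<infinity>"
proof (rule ccontr)
  assume "\<not> ?thesis"
  then have top: "upper_variation \<mu> UNIV = \<infinity>" by (metis infinity_ennreal_def top.not_eq_extremum)
  let ?P = "\<lambda>E. E \<in> sets borel \<and> upper_variation \<mu> E = \<infinity>"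
  have "\<exists>E. \<forall>n. ?P (E n) \<and> (E (Suc n) \<subseteq> E n \<and> 1 \<le> \<bar>\<mu> (E n - E (Suc n))\<bar>)"
  proof (rule dependent_nat_choice)
    show "\<exists>E. ?P E" using top by auto
  next
    fix E and n :: nat assume E: "?P E"
    \<comment> \<open>The margin \<open>\<bar>\<mu> E\<bar> + 1\<close> makes both \<open>B\<close> and \<open>E - B\<close> of measure at least \<open>1\<close> in absolute value,
      so either part may be kept as the remainder.\<close>
    have "ennreal (\<bar>\<mu> E\<bar> + 1) < upper_variation \<mu> E" using E by simp
    then obtain B where B: "B \<in> sets borel" "B \<subseteq> E" "ennreal (\<bar>\<mu> E\<bar> + 1) < ennreal (\<mu> B)"
      unfolding upper_variation_def less_SUP_iff by auto
    then have b: "\<bar>\<mu> E\<bar> + 1 < \<mu> B" by (subst (asm) ennreal_less_iff) simp_all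
    have d: "\<mu> (E - B) = \<mu> E - \<mu> B" using E B by (intro signed_measure_Diff[OF \<mu>]) auto
    have "upper_variation \<mu> B + upper_variation \<mu> (E - B) = \<infinity>"
      using upper_variation_split[OF \<mu>, of E B] E B by auto
    then consider "upper_variation \<mu> B = \<infinity>" | "upper_variation \<mu> (E - B) = \<infinity>"
      by (auto simp: infinity_ennreal_def)
    then show "\<exists>F. ?P F \<and> (F \<subseteq> E \<and> 1 \<le> \<bar>\<mu> (E - F)\<bar>)"
    proof cases
      case 1
      then show ?thesis using B b d by (intro exI[of _ B]) auto
    next
      case 2
      moreover have "E - (E - B) = B" using B by auto
      ultimately show ?thesis using E B b by (intro exI[of _ "E - B"]) auto
    qed
  qed
  then obtain E where E: "\<And>n. ?P (E n)" "\<And>n. E (Suc n) \<subseteq> E n"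
    "\<And>n. 1 \<le> \<bar>\<mu> (E n - E (Suc n))\<bar>" by blast
  have dec: "m \<le> n \<Longrightarrow> E n \<subseteq> E m" for m n using E(2) by (rule lift_Suc_antimono_le)
  have "disjoint_family (\<lambda>n. E n - E (Suc n))"
    unfolding disjoint_family_on_def
  proof (intro ballI impI)
    fix m n :: nat assume "m \<noteq> n"
    then consider "Suc m \<le> n" | "Suc n \<le> m" by linarith
    then show "(E m - E (Suc m)) \<inter> (E n - E (Suc n)) = {}" using dec by cases blast+
  qed
  then have "(\<lambda>n. \<mu> (E n - E (Suc n))) sums \<mu> (\<Union>n. E n - E (Suc n))"
    using E(1) by (intro signed_measure_sums[OF \<mu>]) auto
  then have "(\<lambda>n. \<mu> (E n - E (Suc n))) \<longlonglongrightarrow> 0"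
    by (intro summable_LIMSEQ_zero sums_summable)
  then have "eventually (\<lambda>n. \<bar>\<mu> (E n - E (Suc n))\<bar> < 1) sequentially"
    using order_tendstoD(2)[OF tendsto_rabs_zero, of _ sequentially 1] by auto
  then show False using E(3) by (auto simp: eventually_sequentially not_less[symmetric])
qed

lemma fin_borel_pos_variation:
  assumes "\<mu> \<in> signed_measures" shows "fin_borel (pos_variation \<mu>)"
proof -
  have "space (pos_variation \<mu>) = UNIV" using sets_eq_imp_space_eq[OF sets_pos_variation] by simp
  then show ?thesis
    unfolding fin_borel_def using upper_variation_finite[OF assms] emeasure_pos_variation[OF assms, of UNIV]
    by (auto intro!: finite_measureI simp: sets_pos_variation)
qed

lemma neg_variation_eq: "neg_variation \<mu> = pos_variation (\<lambda>A\<in>sets borel. - \<mu> A)"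
  unfolding neg_variation_def pos_variation_def
  by (intro arg_cong[of _ _ "measure_of UNIV (sets borel)"] ext SUP_cong) auto

lemma fin_borel_neg_variation:
  "\<mu> \<in> signed_measures \<Longrightarrow> fin_borel (neg_variation \<mu>)"
  unfolding neg_variation_eq by (intro fin_borel_pos_variation signed_measure_uminus)

lemma emeasure_neg_variation:
  assumes "\<mu> \<in> signed_measures" "A \<in> sets borel"
  shows "emeasure (neg_variation \<mu>) A = (SUP B\<in>{B \<in> sets borel. B \<subseteq> A}. ennreal (- \<mu> B))"
  unfolding neg_variation_eq emeasure_pos_variation[OF signed_measure_uminus[OF assms(1)] assms(2)]
  unfolding upper_variation_def by (intro SUP_cong) auto

lemma measure_pos_variation_le:
  assumes "\<mu> \<in> signed_measures" "A \<in> sets borel" "0 \<le> c"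
    and "\<And>B. B \<in> sets borel \<Longrightarrow> B \<subseteq> A \<Longrightarrow> \<mu> B \<le> c"
  shows "measure (pos_variation \<mu>) A \<le> c"
proof -
  have "emeasure (pos_variation \<mu>) A \<le> ennreal c"
    unfolding emeasure_pos_variation[OF assms(1,2)] upper_variation_def
    by (intro SUP_least ennreal_leI) (use assms(4) in auto)
  then show ?thesis using assms(3) by (simp add: measure_def enn2real_leI)
qed

lemma measure_pos_variation_ge:
  assumes "\<mu> \<in> signed_measures" "A \<in> sets borel" "B \<in> sets borel" "B \<subseteq> A"
  shows "\<mu> B \<le> measure (pos_variation \<mu>) A"
proof -
  interpret finite_measure "pos_variation \<mu>"
    using fin_borel_pos_variation[OF assms(1)] by (simp add: fin_borel_def)
  have "ennreal (\<mu> B) \<le> ennreal (measure (pos_variation \<mu>) A)"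
    using upper_variation_upper[OF assms(3,4), of \<mu>]
    by (simp add: emeasure_eq_measure[symmetric] emeasure_pos_variation[OF assms(1,2)])
  then show ?thesis by (cases "0 \<le> \<mu> B") (auto simp: ennreal_le_iff intro: order_trans[OF _ measure_nonneg])
qed

text \<open>
  The supremum of \<open>- \<mu> B\<close> over \<open>B \<subseteq> A\<close> is the supremum of \<open>\<mu> (A - B) - \<mu> A\<close>, and \<open>A - B\<close> again runs
  through all Borel subsets of A.
\<close>

lemma measure_neg_variation:
  assumes \<mu>: "\<mu> \<in> signed_measures" and A: "A \<in> sets borel"
  shows "measure (neg_variation \<mu>) A = measure (pos_variation \<mu>) A - \<mu> A"
proof (rule antisym)
  note \<mu>' = signed_measure_uminus[OF \<mu>]
  show "measure (neg_variation \<mu>) A \<le> measure (pos_variation \<mu>) A - \<mu> A"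
    unfolding neg_variation_eq
  proof (rule measure_pos_variation_le[OF \<mu>' A])
    show "0 \<le> measure (pos_variation \<mu>) A - \<mu> A" using measure_pos_variation_ge[OF \<mu> A A] by simp
    fix B :: "plane set" assume B: "B \<in> sets borel" "B \<subseteq> A"
    have "\<mu> (A - B) \<le> measure (pos_variation \<mu>) A"
      using B A by (intro measure_pos_variation_ge[OF \<mu> A]) auto
    then show "(\<lambda>A\<in>sets borel. - \<mu> A) B \<le> measure (pos_variation \<mu>) A - \<mu> A"
      using signed_measure_Diff[OF \<mu> A B] B by simp
  qed
  have "measure (pos_variation \<mu>) A \<le> measure (neg_variation \<mu>) A + \<mu> A"
  proof (rule measure_pos_variation_le[OF \<mu> A])
    show "0 \<le> measure (neg_variation \<mu>) A + \<mu> A"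
      using measure_pos_variation_ge[OF \<mu>' A A] A by (simp add: neg_variation_eq)
    fix B :: "plane set" assume B: "B \<in> sets borel" "B \<subseteq> A"
    have "- \<mu> (A - B) \<le> measure (neg_variation \<mu>) A"
      using measure_pos_variation_ge[OF \<mu>' A, of "A - B"] A B by (simp add: neg_variation_eq)
    then show "\<mu> B \<le> measure (neg_variation \<mu>) A + \<mu> A"
      using signed_measure_Diff[OF \<mu> A B] B by simp
  qed
  then show "measure (pos_variation \<mu>) A - \<mu> A \<le> measure (neg_variation \<mu>) A" by simp
qed

lemma jordan_decomposition:
  assumes \<mu>: "\<mu> \<in> signed_measures"
  shows "\<mu> = measure_diff (pos_variation \<mu>) (neg_variation \<mu>)"
proof
  fix A show "\<mu> A = measure_diff (pos_variation \<mu>) (neg_variation \<mu>) A"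
    using assms measure_neg_variation[OF \<mu>]
    by (cases "A \<in> sets borel") (auto simp: measure_diff_def signed_measures_def extensional_def)
qed

text \<open>
  Minimality of the Jordan decomposition: \<open>\<alpha> B - \<beta> B\<close> is at most \<open>\<alpha> UNIV\<close> on every Borel set B.
\<close>

lemma total_variation_measure_diff_le:
  assumes "fin_borel \<alpha>" "fin_borel \<beta>"
  shows "total_variation (measure_diff \<alpha> \<beta>) \<le> measure \<alpha> UNIV + measure \<beta> UNIV"
proof -
  let ?\<mu> = "measure_diff \<alpha> \<beta>"
  have \<mu>: "?\<mu> \<in> signed_measures" by (rule measure_diff_signed[OF assms])
  have le: "measure \<gamma> B - measure \<gamma>' B \<le> measure \<gamma> UNIV" if "fin_borel \<gamma>" "B \<in> sets borel" for \<gamma> \<gamma>' B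
    using that finite_measure.finite_measure_mono[of \<gamma> B UNIV] fin_borelD[OF that(1)]
      measure_nonneg[of \<gamma>' B] by (metis diff_left_mono diff_zero order_trans subset_UNIV sets.top space_borel)
  have "measure (pos_variation ?\<mu>) UNIV \<le> measure \<alpha> UNIV"
    using le[OF assms(1)] by (intro measure_pos_variation_le[OF \<mu>])
      (auto simp: measure_diff_def)
  moreover have "measure (neg_variation ?\<mu>) UNIV \<le> measure \<beta> UNIV"
    unfolding neg_variation_eq
    using le[OF assms(2)] by (intro measure_pos_variation_le[OF signed_measure_uminus[OF \<mu>]])
      (auto simp: measure_diff_def)
  ultimately show ?thesis by (simp add: total_variation_def)
qed

section \<open>Finite mixtures of measures\<close>

text \<open>
  The measure \<open>\<Sum>\<^sub>j c\<^sub>j L\<^sub>j\<close>. It serves twice: with two unit weights it is the sum of two measures, by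
  which identities between differences become identities between positive measures, and with
  general weights it is the result of averaging a measure.
\<close>

definition mixture :: "'j set \<Rightarrow> ('j \<Rightarrow> real) \<Rightarrow> ('j \<Rightarrow> plane measure) \<Rightarrow> plane measure" where
  "mixture J c L = measure_of UNIV (sets borel) (\<lambda>A. \<Sum>j\<in>J. ennreal (c j) * emeasure (L j) A)"

lemma sets_mixture: "sets (mixture J c L) = sets borel"
  unfolding mixture_def using sets.sigma_sets_eq[of "borel :: plane measure"] by simp

lemma emeasure_mixture:
  assumes L: "\<And>j. j \<in> J \<Longrightarrow> sets (L j) = sets borel" and A: "A \<in> sets borel"
  shows "emeasure (mixture J c L) A = (\<Sum>j\<in>J. ennreal (c j) * emeasure (L j) A)"
  unfolding mixture_def
proof (rule emeasure_measure_of_sigma[OF _ _ _ A])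
  show "sigma_algebra UNIV (sets (borel :: plane measure))"
    using sets.sigma_algebra_axioms[of borel] by simp
  show "countably_additive (sets borel) (\<lambda>A. \<Sum>j\<in>J. ennreal (c j) * emeasure (L j) A)"
    unfolding countably_additive_def
  proof (intro allI impI)
    fix A :: "nat \<Rightarrow> plane set"
    assume A: "range A \<subseteq> sets borel" "disjoint_family A"
    have "(\<Sum>i. \<Sum>j\<in>J. ennreal (c j) * emeasure (L j) (A i)) = (\<Sum>j\<in>J. \<Sum>i. ennreal (c j) * emeasure (L j) (A i))"
      by (rule suminf_sum) simp
    also have "\<dots> = (\<Sum>j\<in>J. ennreal (c j) * emeasure (L j) (\<Union>i. A i))"
      using A L by (intro sum.cong refl) (simp add: suminf_emeasure)
    finally show "(\<Sum>i. \<Sum>j\<in>J. ennreal (c j) * emeasure (L j) (A i)) = (\<Sum>j\<in>J. ennreal (c j) * emeasure (L j) (\<Union>i. A i))" .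
  qed
qed (simp add: positive_def)

lemma nn_integral_mixture:
  assumes J: "finite J" and L: "\<And>j. j \<in> J \<Longrightarrow> sets (L j) = sets borel" and f: "f \<in> borel_measurable borel"
  shows "(\<integral>\<^sup>+x. f x \<partial>mixture J c L) = (\<Sum>j\<in>J. ennreal (c j) * (\<integral>\<^sup>+x. f x \<partial>L j))"
proof -
  have meas: "u \<in> borel_measurable M" if "sets M = sets borel" "u \<in> borel_measurable borel"
    for u :: "plane \<Rightarrow> ennreal" and M
    using that measurable_cong_sets[OF that(1) refl] by blast
  have sp: "space (mixture J c L) = UNIV" "j \<in> J \<Longrightarrow> space (L j) = UNIV" for j
    using sets_eq_imp_space_eq[OF sets_mixture] sets_eq_imp_space_eq[OF L] by simp_all
  show ?thesis
    using f
  proof (induction rule: borel_measurable_induct)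
    case (cong f g)
    then have "f = g" by auto
    then show ?case using cong by simp
  next
    case (set A)
    then show ?case by (simp add: sets_mixture emeasure_mixture[OF L] L)
  next
    case (mult u a)
    then show ?case
      by (simp add: nn_integral_cmult meas sets_mixture L sum_distrib_left mult.left_commute)
  next
    case (add u v)
    then show ?case
      by (simp add: nn_integral_add meas sets_mixture L sum.distrib distrib_left)
  next
    case (seq U)
    have *: "(\<integral>\<^sup>+x. (SUP f\<in>range U. f x) \<partial>M) = (SUP i. \<integral>\<^sup>+x. U i x \<partial>M)"
      "incseq (\<lambda>i. \<integral>\<^sup>+x. U i x \<partial>M)" if "sets M = sets borel" for M
      using nn_integral_monotone_convergence_SUP[OF seq(3) meas[OF that seq(1)]] seq(3)
      by (auto simp: image_image incseq_def le_fun_def intro!: nn_integral_mono)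
    have "(SUP i. \<Sum>j\<in>J. ennreal (c j) * (\<integral>\<^sup>+x. U i x \<partial>L j)) = (\<Sum>j\<in>J. SUP i. ennreal (c j) * (\<integral>\<^sup>+x. U i x \<partial>L j))"
      using *(2) L by (intro ennreal_SUP_sum) (auto simp: incseq_def intro!: mult_left_mono)
    then show ?case
      using seq by (simp add: * sets_mixture L SUP_mult_left_ennreal)
  qed
qed

lemma fin_borel_mixture:
  assumes J: "finite J" and L: "\<And>j. j \<in> J \<Longrightarrow> fin_borel (L j)"
  shows "fin_borel (mixture J c L)"
proof -
  have s: "space (mixture J c L) = UNIV" using sets_eq_imp_space_eq[OF sets_mixture] by simp
  have "emeasure (mixture J c L) UNIV = (\<Sum>j\<in>J. ennreal (c j) * emeasure (L j) UNIV)"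
    using fin_borelD(2)[OF L] by (intro emeasure_mixture) auto
  also have "\<dots> = (\<Sum>j\<in>J. ennreal (c j) * ennreal (measure (L j) UNIV))"
    using fin_borelD(1)[OF L] by (intro sum.cong) (auto simp: finite_measure.emeasure_eq_measure)
  also have "\<dots> < \<infinity>" using J by (simp add: ennreal_mult_less_top)
  finally show ?thesis
    unfolding fin_borel_def by (auto intro!: finite_measureI simp: sets_mixture s)
qed

text \<open>
  Adding the bound B to f makes it nonnegative, which moves identities between Lebesgue integrals
  in \<open>ennreal\<close> to integrals of bounded real functions.
\<close>

lemma fin_borel_integral:
  assumes \<alpha>: "fin_borel \<alpha>" and f: "f \<in> borel_measurable borel" "\<And>x. \<bar>f x\<bar> \<le> (B::real)"
  shows "integrable \<alpha> f"
    and "(\<integral>\<^sup>+x. ennreal (f x + B) \<partial>\<alpha>) = ennreal (integral\<^sup>L \<alpha> f + B * measure \<alpha> UNIV)"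
    and "0 \<le> integral\<^sup>L \<alpha> f + B * measure \<alpha> UNIV"
proof -
  interpret finite_measure \<alpha> using fin_borelD(1)[OF \<alpha>] .
  have m: "f \<in> borel_measurable \<alpha>"
    using f(1) measurable_cong_sets[OF fin_borelD(2)[OF \<alpha>] refl] by blast
  show int: "integrable \<alpha> f" using integrable_const_bound[of f B] f(2) m by auto
  have f0: "0 \<le> f x + B" for x using f(2)[of x] by linarith
  have "(\<integral>\<^sup>+x. ennreal (f x + B) \<partial>\<alpha>) = ennreal (\<integral>x. f x + B \<partial>\<alpha>)"
    using f0 int by (intro nn_integral_eq_integral) simp_all
  then show "(\<integral>\<^sup>+x. ennreal (f x + B) \<partial>\<alpha>) = ennreal (integral\<^sup>L \<alpha> f + B * measure \<alpha> UNIV)"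
    using int fin_borelD[OF \<alpha>] by (simp add: mult.commute)
  have "0 \<le> (\<integral>x. f x + B \<partial>\<alpha>)"
    using f0 by (intro integral_nonneg_AE) simp
  then show "0 \<le> integral\<^sup>L \<alpha> f + B * measure \<alpha> UNIV" using int fin_borelD[OF \<alpha>] by (simp add: mult.commute)
qed

lemma measure_mixture:
  assumes J: "finite J" and c: "\<And>j. j \<in> J \<Longrightarrow> 0 \<le> c j" and L: "\<And>j. j \<in> J \<Longrightarrow> fin_borel (L j)"
    and A: "A \<in> sets borel"
  shows "measure (mixture J c L) A = (\<Sum>j\<in>J. c j * measure (L j) A)"
proof -
  have "emeasure (mixture J c L) A = (\<Sum>j\<in>J. ennreal (c j) * emeasure (L j) A)"
    using fin_borelD(2)[OF L] A by (intro emeasure_mixture) auto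
  also have "\<dots> = (\<Sum>j\<in>J. ennreal (c j * measure (L j) A))"
    using fin_borelD(1)[OF L] c
    by (intro sum.cong) (auto simp: finite_measure.emeasure_eq_measure ennreal_mult)
  also have "\<dots> = ennreal (\<Sum>j\<in>J. c j * measure (L j) A)"
    using c by (intro sum_ennreal) auto
  finally show ?thesis
    using c by (simp add: measure_def[of "mixture J c L"] sum_nonneg)
qed

lemma integral_mixture:
  assumes J: "finite J" and c: "\<And>j. j \<in> J \<Longrightarrow> 0 \<le> c j" and L: "\<And>j. j \<in> J \<Longrightarrow> fin_borel (L j)"
    and f: "f \<in> borel_measurable borel" "\<And>x. \<bar>f x\<bar> \<le> (B::real)"
  shows "(\<integral>x. f x \<partial>mixture J c L) = (\<Sum>j\<in>J. c j * (\<integral>x. f x \<partial>L j))"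
proof -
  let ?M = "mixture J c L"
  note M = fin_borel_mixture[OF J L, where c=c]
  have "ennreal (integral\<^sup>L ?M f + B * measure ?M UNIV) = (\<integral>\<^sup>+x. ennreal (f x + B) \<partial>?M)"
    using fin_borel_integral(2)[OF M f] by simp
  also have "\<dots> = (\<Sum>j\<in>J. ennreal (c j) * (\<integral>\<^sup>+x. ennreal (f x + B) \<partial>L j))"
    using f(1) L by (intro nn_integral_mixture J) (auto simp: fin_borelD)
  also have "\<dots> = (\<Sum>j\<in>J. ennreal (c j * (integral\<^sup>L (L j) f + B * measure (L j) UNIV)))"
    using fin_borel_integral[OF L f] c by (intro sum.cong) (auto simp: ennreal_mult)
  also have "\<dots> = ennreal (\<Sum>j\<in>J. c j * (integral\<^sup>L (L j) f + B * measure (L j) UNIV))"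
    using fin_borel_integral(3)[OF L f] c by (intro sum_ennreal) auto
  finally have "integral\<^sup>L ?M f + B * measure ?M UNIV = (\<Sum>j\<in>J. c j * (integral\<^sup>L (L j) f + B * measure (L j) UNIV))"
    using fin_borel_integral(3)[OF M f] fin_borel_integral(3)[OF L f] c
    by (subst (asm) ennreal_inj) (auto intro!: sum_nonneg)
  also have "\<dots> = (\<Sum>j\<in>J. c j * integral\<^sup>L (L j) f) + B * measure ?M UNIV"
    by (simp add: measure_mixture[OF J c L] distrib_left sum.distrib sum_distrib_left mult.left_commute)
  finally show ?thesis by simp
qed

text \<open>
  Only the difference of two measures matters for the difference of the integrals: from
  \<open>\<alpha> - \<beta> = \<gamma> - \<delta>\<close> the sums \<open>\<alpha> + \<delta>\<close> and \<open>\<gamma> + \<beta>\<close> are the same positive measure.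
\<close>

lemma integral_eq_of_measure_diff_eq:
  assumes fin: "fin_borel \<alpha>" "fin_borel \<beta>" "fin_borel \<gamma>" "fin_borel \<delta>"
    and eq: "measure_diff \<alpha> \<beta> = measure_diff \<gamma> \<delta>"
    and f: "f \<in> borel_measurable borel" "\<And>x. \<bar>f x\<bar> \<le> (B::real)"
  shows "(\<integral>x. f x \<partial>\<alpha>) - (\<integral>x. f x \<partial>\<beta>) = (\<integral>x. f x \<partial>\<gamma>) - (\<integral>x. f x \<partial>\<delta>)"
proof -
  let ?P = "\<lambda>m m'. mixture UNIV (\<lambda>_. 1) (\<lambda>b. if b then m else m')"
  have M: "fin_borel (?P m m')" "A \<in> sets borel \<Longrightarrow> measure (?P m m') A = measure m A + measure m' A"
    "(\<integral>x. f x \<partial>?P m m') = (\<integral>x. f x \<partial>m) + (\<integral>x. f x \<partial>m')"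
    if "fin_borel m" "fin_borel m'" for m m' A
  proof -
    have L: "fin_borel (if b then m else m')" for b using that by simp
    show "fin_borel (?P m m')" by (rule fin_borel_mixture[OF _ L]) simp
    show "A \<in> sets borel \<Longrightarrow> measure (?P m m') A = measure m A + measure m' A"
      by (subst measure_mixture[OF _ _ L]) (auto simp: UNIV_bool)
    show "(\<integral>x. f x \<partial>?P m m') = (\<integral>x. f x \<partial>m) + (\<integral>x. f x \<partial>m')"
      by (subst integral_mixture[OF _ _ L f]) (auto simp: UNIV_bool)
  qed
  have "?P \<alpha> \<delta> = ?P \<gamma> \<beta>"
  proof (rule measure_eqI)
    fix A assume "A \<in> sets (?P \<alpha> \<delta>)"
    then have A: "A \<in> sets borel" by (simp add: sets_mixture)
    have "measure \<alpha> A + measure \<delta> A = measure \<gamma> A + measure \<beta> A"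
      using fun_cong[OF eq, of A] A by (simp add: measure_diff_def)
    then show "emeasure (?P \<alpha> \<delta>) A = emeasure (?P \<gamma> \<beta>) A"
      using M A fin by (simp add: finite_measure.emeasure_eq_measure fin_borelD)
  qed (simp add: sets_mixture)
  then show ?thesis using M(3)[OF fin(1,4)] M(3)[OF fin(3,2)] by simp
qed

lemma signed_integral_measure_diff:
  assumes "fin_borel \<alpha>" "fin_borel \<beta>"
    and "f \<in> borel_measurable borel" "\<And>x. \<bar>f x\<bar> \<le> (B::real)"
  shows "signed_integral (measure_diff \<alpha> \<beta>) f = (\<integral>x. f x \<partial>\<alpha>) - (\<integral>x. f x \<partial>\<beta>)"
proof -
  note \<mu> = measure_diff_signed[OF assms(1,2)]
  show ?thesis
    unfolding signed_integral_def
    using fin_borel_pos_variation[OF \<mu>] fin_borel_neg_variation[OF \<mu>] assms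
    by (intro integral_eq_of_measure_diff_eq[where B=B]) (auto simp: jordan_decomposition[OF \<mu>, symmetric])
qed

section \<open>Smooth functions on the plane\<close>

definition smooth :: "(plane \<Rightarrow> real) \<Rightarrow> bool" where "smooth \<phi> \<longleftrightarrow> (\<forall>k. C_k k \<phi>)"

lemma partial_eqI:
  assumes "(\<phi> has_derivative D) (at x)"
  shows "partial1 \<phi> x = D (1, 0)" "partial2 \<phi> x = D (0, 1)"
  using frechet_derivative_at[OF assms] by (simp_all add: partial1_def partial2_def)

lemma has_derivative_partials:
  assumes "\<phi> differentiable_on UNIV"
  shows "(\<phi> has_derivative (\<lambda>h. fst h * partial1 \<phi> x + snd h * partial2 \<phi> x)) (at x)"
proof -
  have "\<phi> differentiable (at x)" using assms unfolding differentiable_on_def by blast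
  then have D: "(\<phi> has_derivative frechet_derivative \<phi> (at x)) (at x)"
    by (simp add: frechet_derivative_works)
  then interpret bounded_linear "frechet_derivative \<phi> (at x)" by (rule has_derivative_bounded_linear)
  have "frechet_derivative \<phi> (at x) = (\<lambda>h. fst h * partial1 \<phi> x + snd h * partial2 \<phi> x)"
  proof (rule ext)
    fix h
    have "frechet_derivative \<phi> (at x) (fst h *\<^sub>R (1, 0) + snd h *\<^sub>R (0, 1))
        = fst h * partial1 \<phi> x + snd h * partial2 \<phi> x"
      unfolding add scaleR by (simp add: partial1_def partial2_def)
    moreover have "fst h *\<^sub>R (1, 0) + snd h *\<^sub>R (0, 1) = h" by (simp add: prod_eq_iff)
    ultimately show "frechet_derivative \<phi> (at x) h = fst h * partial1 \<phi> x + snd h * partial2 \<phi> x" by simp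
  qed
  with D show ?thesis by simp
qed

lemma C_k_Suc_imp: "C_k (Suc k) \<phi> \<Longrightarrow> C_k k \<phi>"
proof (induction k arbitrary: \<phi>)
  case 0
  then show ?case using differentiable_imp_continuous_on by (simp only: C_k.simps) blast
next
  case (Suc k)
  have "C_k (Suc k) (partial1 \<phi>)" "C_k (Suc k) (partial2 \<phi>)" "\<phi> differentiable_on UNIV"
    using Suc.prems by (simp_all only: C_k.simps(2)[of "Suc k" \<phi>])
  then show ?case using Suc.IH C_k.simps(2)[of k \<phi>] by blast
qed

lemma differentiable_on_UNIVI:
  assumes "\<And>x. (\<phi> has_derivative D x) (at x)"
  shows "\<phi> differentiable_on UNIV"
  using assms by (auto simp: differentiable_on_def differentiable_def)

lemma C_k_add: "C_k k \<phi> \<Longrightarrow> C_k k \<psi> \<Longrightarrow> C_k k (\<lambda>x. \<phi> x + \<psi> x)"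
proof (induction k arbitrary: \<phi> \<psi>)
  case (Suc k)
  have D: "((\<lambda>x. \<phi> x + \<psi> x) has_derivative (\<lambda>h. (fst h * partial1 \<phi> x + snd h * partial2 \<phi> x)
      + (fst h * partial1 \<psi> x + snd h * partial2 \<psi> x))) (at x)" for x
    using Suc.prems by (intro has_derivative_add has_derivative_partials) auto
  have "partial1 (\<lambda>x. \<phi> x + \<psi> x) = (\<lambda>x. partial1 \<phi> x + partial1 \<psi> x)"
    "partial2 (\<lambda>x. \<phi> x + \<psi> x) = (\<lambda>x. partial2 \<phi> x + partial2 \<psi> x)"
    using partial_eqI[OF D] by auto
  then show ?case using Suc differentiable_on_UNIVI[OF D] by simp
qed (auto intro: continuous_intros)

lemma C_k_mult: "C_k k \<phi> \<Longrightarrow> C_k k \<psi> \<Longrightarrow> C_k k (\<lambda>x. \<phi> x * \<psi> x)"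
proof (induction k arbitrary: \<phi> \<psi>)
  case (Suc k)
  have D: "((\<lambda>x. \<phi> x * \<psi> x) has_derivative (\<lambda>h. \<phi> x * (fst h * partial1 \<psi> x + snd h * partial2 \<psi> x)
      + (fst h * partial1 \<phi> x + snd h * partial2 \<phi> x) * \<psi> x)) (at x)" for x
    using Suc.prems by (intro has_derivative_mult has_derivative_partials) auto
  have "partial1 (\<lambda>x. \<phi> x * \<psi> x) = (\<lambda>x. \<phi> x * partial1 \<psi> x + partial1 \<phi> x * \<psi> x)"
    "partial2 (\<lambda>x. \<phi> x * \<psi> x) = (\<lambda>x. \<phi> x * partial2 \<psi> x + partial2 \<phi> x * \<psi> x)"
    using partial_eqI[OF D] by auto
  then show ?case using Suc C_k_Suc_imp[OF Suc.prems(1)] C_k_Suc_imp[OF Suc.prems(2)]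
      differentiable_on_UNIVI[OF D] by (auto intro!: C_k_add)
qed (auto intro: continuous_intros)

lemma C_k_const: "C_k k (\<lambda>x. c)"
proof (induction k arbitrary: c)
  case (Suc k)
  have D: "((\<lambda>x::plane. c) has_derivative (\<lambda>h. 0)) (at x)" for x by simp
  have "partial1 (\<lambda>x. c) = (\<lambda>x. 0)" "partial2 (\<lambda>x. c) = (\<lambda>x. 0)"
    using partial_eqI[OF D] by auto
  then show ?case using Suc differentiable_on_UNIVI[OF D] by simp
qed auto

lemma C_k_cmult: "C_k k \<phi> \<Longrightarrow> C_k k (\<lambda>x. c * \<phi> x)"
  by (rule C_k_mult[OF C_k_const])

lemma C_k_translate: "C_k k \<phi> \<Longrightarrow> C_k k (\<lambda>x. \<phi> (x + v))"
proof (induction k arbitrary: \<phi>)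
  case 0
  have "continuous_on UNIV (\<lambda>x. \<phi> (x + v))"
    by (rule continuous_on_compose2[of UNIV \<phi> UNIV "\<lambda>x. x + v"])
      (use 0 in \<open>auto intro!: continuous_on_add continuous_on_id continuous_on_const\<close>)
  then show ?case by simp
next
  case (Suc k)
  have D: "((\<lambda>x. \<phi> (x + v)) has_derivative
      (\<lambda>h. fst h * partial1 \<phi> (x + v) + snd h * partial2 \<phi> (x + v))) (at x)" for x
  proof -
    have i: "((\<lambda>x. x + v) has_derivative (\<lambda>h. h)) (at x)"
      by (auto intro!: derivative_eq_intros)
    show ?thesis
      using has_derivative_compose[OF i has_derivative_partials[of \<phi> "x + v"]] Suc.prems by simp
  qed
  have "partial1 (\<lambda>x. \<phi> (x + v)) = (\<lambda>x. partial1 \<phi> (x + v))"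
    "partial2 (\<lambda>x. \<phi> (x + v)) = (\<lambda>x. partial2 \<phi> (x + v))"
    using partial_eqI[OF D] by auto
  then show ?case using Suc differentiable_on_UNIVI[OF D] by simp
qed

text \<open>
  The functions \<open>p(1/u) e\<^bsup>-1/u\<^esup>\<close> on \<open>u > 0\<close>, continued by 0. Letting p range over all polynomials gives
  a family that is closed under differentiation, so smoothness follows by a plain induction.
\<close>

definition flat :: "real poly \<Rightarrow> real \<Rightarrow> real" where
  "flat p u = (if 0 < u then poly p (1 / u) * exp (- (1 / u)) else 0)"

lemma poly_times_exp_tendsto_0: "((\<lambda>w. poly p w * exp (- w)) \<longlongrightarrow> (0::real)) at_top"
proof -
  have "((\<lambda>w. w ^ n * exp (- w)) \<longlongrightarrow> (0::real)) at_top" for n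
    using tendsto_power_div_exp_0[of n] by (simp add: exp_minus divide_inverse)
  then have "((\<lambda>w. \<Sum>i\<le>degree p. coeff p i * (w ^ i * exp (- w))) \<longlongrightarrow> (\<Sum>i\<le>degree p. coeff p i * 0)) at_top"
    by (intro tendsto_sum tendsto_mult tendsto_const)
  then show ?thesis by (simp add: poly_altdef sum_distrib_right mult.assoc)
qed

text \<open>
  Away from 0 this is the chain rule. At 0 the difference quotient is \<open>w p(w) e\<^bsup>-w\<^esup>\<close> with \<open>w = 1/h\<close>,
  which tends to 0.
\<close>

lemma flat_derivative:
  "(flat p has_real_derivative flat ([:0, 0, 1:] * (p - pderiv p)) u) (at u)"
proof -
  consider "0 < u" | "u < 0" | "u = 0" by linarith
  then show ?thesis
  proof cases
    case 1
    have "((\<lambda>u. poly p (1 / u) * exp (- (1 / u))) has_real_derivative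
        flat ([:0, 0, 1:] * (p - pderiv p)) u) (at u)"
      using 1 by (auto intro!: derivative_eq_intros DERIV_chain2[OF poly_DERIV]
          simp: flat_def power2_eq_square field_simps)
    then show ?thesis
      by (rule has_field_derivative_transform_within_open[where S="{0<..}"])
        (use 1 in \<open>auto simp: flat_def\<close>)
  next
    case 2
    have "((\<lambda>u. 0) has_real_derivative flat ([:0, 0, 1:] * (p - pderiv p)) u) (at u)"
      using 2 by (simp add: flat_def)
    then show ?thesis
      by (rule has_field_derivative_transform_within_open[where S="{..<0}"])
        (use 2 in \<open>auto simp: flat_def\<close>)
  next
    case 3
    have r: "((\<lambda>h. flat p h / h) \<longlongrightarrow> 0) (at_right 0)"
    proof -
      have "((\<lambda>h. poly (pCons 0 p) (inverse h) * exp (- inverse h)) \<longlongrightarrow> 0) (at_right 0)"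
        by (rule filterlim_compose[OF poly_times_exp_tendsto_0 filterlim_inverse_at_top_right])
      then show ?thesis
        by (rule Lim_transform_eventually)
          (auto simp: eventually_at_right_field flat_def field_simps intro!: exI[of _ 1])
    qed
    have l: "((\<lambda>h. flat p h / h) \<longlongrightarrow> 0) (at_left 0)"
      by (rule Lim_transform_eventually[OF tendsto_const])
        (auto simp: eventually_at_left_field flat_def intro!: exI[of _ "-1"])
    show ?thesis
      using filterlim_split_at[OF l r] 3 by (simp add: DERIV_def flat_def)
  qed
qed

lemma C_k_flat: "C_k k (\<lambda>x. flat p (a * fst x + b * snd x + c))"
proof (induction k arbitrary: p)
  case 0
  have "continuous_on UNIV (flat p)"
    using flat_derivative by (meson DERIV_isCont continuous_at_imp_continuous_on)
  then have "continuous_on UNIV (\<lambda>x::plane. flat p (a * fst x + b * snd x + c))"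
    by (rule continuous_on_compose2) (auto intro!: continuous_intros)
  then show ?case by simp
next
  case (Suc k)
  let ?q = "[:0, 0, 1:] * (p - pderiv p)" and ?l = "\<lambda>x::plane. a * fst x + b * snd x + c"
  have D: "((\<lambda>x. flat p (?l x)) has_derivative (\<lambda>h. (a * fst h + b * snd h) * flat ?q (?l x))) (at x)" for x
  proof -
    have i: "(?l has_derivative (\<lambda>h. a * fst h + b * snd h)) (at x)"
      by (auto intro!: derivative_eq_intros)
    show ?thesis
      using has_derivative_compose[OF i flat_derivative[unfolded has_field_derivative_def]]
      by (simp add: mult.commute)
  qed
  have "partial1 (\<lambda>x. flat p (?l x)) = (\<lambda>x. a * flat ?q (?l x))"
    "partial2 (\<lambda>x. flat p (?l x)) = (\<lambda>x. b * flat ?q (?l x))"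
    using partial_eqI[OF D] by auto
  then show ?case using Suc[of ?q] C_k_cmult differentiable_on_UNIVI[OF D] by simp
qed

section \<open>Test functions\<close>

lemma test_functionsI:
  assumes "smooth \<phi>" "compact C" "C \<subseteq> U" "\<And>x. x \<notin> C \<Longrightarrow> \<phi> x = 0"
  shows "\<phi> \<in> test_functions U"
proof -
  have "{x. \<phi> x \<noteq> 0} \<subseteq> C" using assms(4) by blast
  then have "fun_support \<phi> \<subseteq> C"
    unfolding fun_support_def using compact_imp_closed[OF assms(2)] by (rule closure_minimal)
  moreover have "compact (fun_support \<phi>)"
    using calculation assms(2)
    by (metis bounded_subset closed_closure compact_eq_bounded_closed fun_support_def)
  ultimately show ?thesis using assms by (auto simp: test_functions_def smooth_def)
qed

lemma test_functionsD:
  assumes "\<phi> \<in> test_functions U"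
  shows "smooth \<phi>" "compact (fun_support \<phi>)" "fun_support \<phi> \<subseteq> U" "x \<notin> fun_support \<phi> \<Longrightarrow> \<phi> x = 0"
  using assms closure_subset[of "{x. \<phi> x \<noteq> 0}"] by (auto simp: test_functions_def smooth_def fun_support_def)

lemma test_functions_UNIV: "\<phi> \<in> test_functions U \<Longrightarrow> \<phi> \<in> test_functions UNIV"
  by (auto simp: test_functions_def)

lemma smooth_differentiable: "smooth \<phi> \<Longrightarrow> \<phi> differentiable_on UNIV"
  unfolding smooth_def by (metis C_k.simps(2))

lemma smooth_continuous: "smooth \<phi> \<Longrightarrow> continuous_on A \<phi>"
  unfolding smooth_def by (metis C_k.simps(1) continuous_on_subset subset_UNIV)

lemma smooth_measurable: "smooth \<phi> \<Longrightarrow> \<phi> \<in> borel_measurable borel"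
  by (intro borel_measurable_continuous_onI smooth_continuous)

lemma smooth_partial: "smooth \<phi> \<Longrightarrow> smooth (partial1 \<phi>)" "smooth \<phi> \<Longrightarrow> smooth (partial2 \<phi>)"
  unfolding smooth_def by (metis C_k.simps(2))+

lemma test_function_partial:
  assumes "\<phi> \<in> test_functions U"
  shows "partial1 \<phi> \<in> test_functions U" "partial2 \<phi> \<in> test_functions U"
proof -
  note D = test_functionsD[OF assms]
  have "partial1 \<phi> x = 0 \<and> partial2 \<phi> x = 0" if "x \<notin> fun_support \<phi>" for x
  proof -
    have d: "((\<lambda>x. 0) has_derivative (\<lambda>h. 0)) (at x)" by simp
    have o: "open (- fun_support \<phi>)" by (simp add: fun_support_def open_Compl)
    have "(\<phi> has_derivative (\<lambda>h. 0)) (at x)"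
      by (rule has_derivative_transform_within_open[OF d o]) (use that D(4) in simp_all)
    from partial_eqI[OF this] show ?thesis by simp
  qed
  then show "partial1 \<phi> \<in> test_functions U" "partial2 \<phi> \<in> test_functions U"
    using D by (auto intro!: test_functionsI[where C="fun_support \<phi>"] smooth_partial)
qed

lemma test_function_bounded:
  assumes "\<phi> \<in> test_functions U"
  obtains B where "0 \<le> B" "\<And>x. \<bar>\<phi> x\<bar> \<le> B"
proof -
  note D = test_functionsD[OF assms]
  have "bounded (\<phi> ` fun_support \<phi>)"
    using D by (intro compact_imp_bounded compact_continuous_image smooth_continuous)
  then obtain B where B: "\<And>x. x \<in> fun_support \<phi> \<Longrightarrow> \<bar>\<phi> x\<bar> \<le> B" "0 < B"
    unfolding bounded_pos by auto
  show ?thesis by (rule that[of B]) (use B D(4) in \<open>force+\<close>)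
qed

lemma test_function_add:
  assumes "\<phi> \<in> test_functions U" "\<psi> \<in> test_functions U"
  shows "(\<lambda>x. \<phi> x + \<psi> x) \<in> test_functions U"
  using test_functionsD[OF assms(1)] test_functionsD[OF assms(2)]
  by (intro test_functionsI[where C="fun_support \<phi> \<union> fun_support \<psi>"])
    (auto simp: smooth_def intro!: C_k_add)

lemma test_function_cmult:
  assumes "\<phi> \<in> test_functions U"
  shows "(\<lambda>x. c * \<phi> x) \<in> test_functions U"
  using test_functionsD[OF assms]
  by (intro test_functionsI[where C="fun_support \<phi>"]) (auto simp: smooth_def intro!: C_k_cmult)

lemma test_function_translate:
  assumes "\<phi> \<in> test_functions UNIV" and "\<And>x. x \<notin> U \<Longrightarrow> x + v \<notin> fun_support \<phi>"
  shows "(\<lambda>x. \<phi> (x + v)) \<in> test_functions U"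
proof (rule test_functionsI)
  note D = test_functionsD[OF assms(1)]
  show "smooth (\<lambda>x. \<phi> (x + v))" using D by (auto simp: smooth_def intro: C_k_translate)
  show "compact ((\<lambda>y. y - v) ` fun_support \<phi>)"
    using D by (intro compact_continuous_image continuous_intros)
  show "(\<lambda>y. y - v) ` fun_support \<phi> \<subseteq> U"
  proof (rule image_subsetI, rule ccontr)
    fix y assume "y \<in> fun_support \<phi>" "y - v \<notin> U"
    then show False using assms(2)[of "y - v"] by simp
  qed
  show "\<phi> (x + v) = 0" if "x \<notin> (\<lambda>y. y - v) ` fun_support \<phi>" for x
    using that by (intro D(4)) force
qed

text \<open>
  The mean over the segment from x to \<open>x + v\<close>. It maps test functions to test functions and inverts
  the derivative in direction v up to a translate (\<open>seg_avg_directional\<close>); unlike a primitive, it has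
  compact support.
\<close>

definition seg_avg :: "plane \<Rightarrow> (plane \<Rightarrow> real) \<Rightarrow> plane \<Rightarrow> real" where
  "seg_avg v \<phi> x = integral {0..1} (\<lambda>s. \<phi> (x + s *\<^sub>R v))"

text \<open>
  Differentiation under the integral sign. The derivative is written with the segment means of the
  partial derivatives, which gives smoothness by induction.
\<close>

lemma seg_avg_derivative:
  assumes \<phi>: "smooth \<phi>"
  shows "(seg_avg v \<phi> has_derivative
      (\<lambda>h. fst h * seg_avg v (partial1 \<phi>) x + snd h * seg_avg v (partial2 \<phi>) x)) (at x)"
proof -
  define F :: "plane \<Rightarrow>\<^sub>L real" where "F = Blinfun fst"
  define G :: "plane \<Rightarrow>\<^sub>L real" where "G = Blinfun snd"
  have F: "blinfun_apply F = fst" and G: "blinfun_apply G = snd"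
    unfolding F_def G_def by (simp_all add: bounded_linear_Blinfun_apply bounded_linear_fst bounded_linear_snd)
  define fx where "fx = (\<lambda>x s. partial1 \<phi> (x + s *\<^sub>R v) *\<^sub>R F + partial2 \<phi> (x + s *\<^sub>R v) *\<^sub>R G)"
  have c: "continuous_on UNIV \<psi> \<Longrightarrow> continuous_on A (\<lambda>s. \<psi> (x + s *\<^sub>R v))" for A x and \<psi> :: "plane \<Rightarrow> real"
    by (rule continuous_on_compose2[of UNIV]) (auto intro!: continuous_intros)
  have c2: "continuous_on UNIV \<psi> \<Longrightarrow> continuous_on A (\<lambda>z. \<psi> (fst z + snd z *\<^sub>R v))" for A and \<psi> :: "plane \<Rightarrow> real"
    by (rule continuous_on_compose2[of UNIV]) (auto intro!: continuous_intros)
  have cp: "continuous_on UNIV \<phi>" "continuous_on UNIV (partial1 \<phi>)" "continuous_on UNIV (partial2 \<phi>)"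
    using \<phi> smooth_partial smooth_continuous by blast+
  have "((\<lambda>x. integral (cbox 0 1) (\<lambda>s. \<phi> (x + s *\<^sub>R v))) has_derivative integral (cbox 0 1) (fx x)) (at x within UNIV)"
  proof (rule leibniz_rule)
    fix y :: plane and t :: real
    have i: "((\<lambda>x. x + t *\<^sub>R v) has_derivative (\<lambda>h. h)) (at y)"
      by (auto intro!: derivative_eq_intros)
    show "((\<lambda>x. \<phi> (x + t *\<^sub>R v)) has_derivative blinfun_apply (fx y t)) (at y within UNIV)"
    proof -
      have "blinfun_apply (fx y t) = (\<lambda>h. fst h * partial1 \<phi> (y + t *\<^sub>R v) + snd h * partial2 \<phi> (y + t *\<^sub>R v))"
        by (rule ext) (simp add: fx_def blinfun.add_left blinfun.scaleR_left F G mult.commute)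
      then show ?thesis
        using has_derivative_compose[OF i has_derivative_partials[OF smooth_differentiable[OF \<phi>]]] by simp
    qed
  next
    show "(\<lambda>s. \<phi> (y + s *\<^sub>R v)) integrable_on cbox 0 1" for y
      by (intro integrable_continuous c cp)
    show "continuous_on (UNIV \<times> cbox 0 1) (\<lambda>(x, t). fx x t)"
      unfolding fx_def split_beta by (intro continuous_intros c2 cp)
  qed auto
  moreover have "blinfun_apply (integral (cbox 0 1) (fx x))
      = (\<lambda>h. fst h * seg_avg v (partial1 \<phi>) x + snd h * seg_avg v (partial2 \<phi>) x)"
  proof (rule ext)
    fix h
    have "blinfun_apply (integral (cbox 0 1) (fx x)) h = integral (cbox 0 1) (\<lambda>s. blinfun_apply (fx x s) h)"
      unfolding fx_def
      by (rule blinfun_apply_integral) (intro integrable_continuous continuous_intros c cp)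
    also have "\<dots> = integral (cbox 0 1) (\<lambda>s. fst h * partial1 \<phi> (x + s *\<^sub>R v) + snd h * partial2 \<phi> (x + s *\<^sub>R v))"
      by (simp add: fx_def blinfun.add_left blinfun.scaleR_left F G mult.commute)
    also have "\<dots> = fst h * seg_avg v (partial1 \<phi>) x + snd h * seg_avg v (partial2 \<phi>) x"
      by (subst Henstock_Kurzweil_Integration.integral_add)
        (auto simp: seg_avg_def intro!: integrable_continuous_real continuous_intros c cp)
    finally show "blinfun_apply (integral (cbox 0 1) (fx x)) h
      = fst h * seg_avg v (partial1 \<phi>) x + snd h * seg_avg v (partial2 \<phi>) x" .
  qed
  ultimately show ?thesis
    by (simp add: seg_avg_def[abs_def])
qed

lemma partial_seg_avg:
  assumes "smooth \<phi>"
  shows "partial1 (seg_avg v \<phi>) = seg_avg v (partial1 \<phi>)" "partial2 (seg_avg v \<phi>) = seg_avg v (partial2 \<phi>)"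
  by (rule ext, simp add: partial_eqI[OF seg_avg_derivative[OF assms]])+

lemma smooth_seg_avg: "smooth \<phi> \<Longrightarrow> smooth (seg_avg v \<phi>)"
proof -
  have "C_k k (seg_avg v \<phi>)" if "smooth \<phi>" for k
    using that
  proof (induction k arbitrary: \<phi>)
    case 0
    then show ?case
      using differentiable_imp_continuous_on[OF differentiable_on_UNIVI[OF seg_avg_derivative[OF 0]]] by simp
  next
    case (Suc k)
    then show ?case
      using differentiable_on_UNIVI[OF seg_avg_derivative[OF Suc.prems]]
      by (simp add: partial_seg_avg smooth_partial)
  qed
  then show "smooth \<phi> \<Longrightarrow> smooth (seg_avg v \<phi>)" by (simp add: smooth_def)
qed

lemma seg_avg_directional:
  assumes \<phi>: "smooth \<phi>"
  shows "fst v * partial1 (seg_avg v \<phi>) x + snd v * partial2 (seg_avg v \<phi>) x = \<phi> (x + v) - \<phi> x"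
proof -
  have c: "continuous_on UNIV \<psi> \<Longrightarrow> continuous_on A (\<lambda>s. \<psi> (x + s *\<^sub>R v))" for A and \<psi> :: "plane \<Rightarrow> real"
    by (rule continuous_on_compose2[of UNIV]) (auto intro!: continuous_intros)
  have cp: "continuous_on UNIV \<phi>" "continuous_on UNIV (partial1 \<phi>)" "continuous_on UNIV (partial2 \<phi>)"
    using \<phi> smooth_partial smooth_continuous by blast+
  have "((\<lambda>s. fst v * partial1 \<phi> (x + s *\<^sub>R v) + snd v * partial2 \<phi> (x + s *\<^sub>R v)) has_integral
      \<phi> (x + 1 *\<^sub>R v) - \<phi> (x + 0 *\<^sub>R v)) {0..1}"
  proof (rule fundamental_theorem_of_calculus)
    fix s :: real
    have i: "((\<lambda>s. x + s *\<^sub>R v) has_derivative (\<lambda>h. h *\<^sub>R v)) (at s within {0..1})"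
      by (auto intro!: derivative_eq_intros)
    show "((\<lambda>s. \<phi> (x + s *\<^sub>R v)) has_vector_derivative
        fst v * partial1 \<phi> (x + s *\<^sub>R v) + snd v * partial2 \<phi> (x + s *\<^sub>R v)) (at s within {0..1})"
      using has_derivative_compose[OF i has_derivative_partials[OF smooth_differentiable[OF \<phi>]]]
      by (simp add: has_vector_derivative_def distrib_left mult.assoc)
  qed simp
  then have "integral {0..1} (\<lambda>s. fst v * partial1 \<phi> (x + s *\<^sub>R v) + snd v * partial2 \<phi> (x + s *\<^sub>R v))
      = \<phi> (x + v) - \<phi> x" by (simp add: integral_unique)
  then show ?thesis
    unfolding partial_seg_avg[OF \<phi>] seg_avg_def
    by (subst (asm) Henstock_Kurzweil_Integration.integral_add)
      (auto intro!: integrable_continuous_real continuous_intros c cp)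
qed

lemma test_function_seg_avg:
  assumes "\<phi> \<in> test_functions UNIV"
  shows "seg_avg v \<phi> \<in> test_functions UNIV"
proof (rule test_functionsI)
  note D = test_functionsD[OF assms(1)]
  show "smooth (seg_avg v \<phi>)" using D by (intro smooth_seg_avg)
  let ?C = "(\<lambda>z. fst z - snd z *\<^sub>R v) ` (fun_support \<phi> \<times> {0..1::real})"
  show "compact ?C"
    using D by (intro compact_continuous_image continuous_intros compact_Times) auto
  show "seg_avg v \<phi> x = 0" if "x \<notin> ?C" for x
  proof -
    have z: "\<phi> (x + s *\<^sub>R v) = 0" if "s \<in> {0..1}" for s
      using that \<open>x \<notin> ?C\<close> by (intro D(4)) force
    have "seg_avg v \<phi> x = integral {0..1::real} (\<lambda>s. 0)"
      unfolding seg_avg_def by (rule Henstock_Kurzweil_Integration.integral_cong) (rule z)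
    then show ?thesis by simp
  qed
qed simp

text \<open>
  Smooth functions that increase to the indicator of an open box: \<open>e\<^bsup>-1/(j u)\<^esup>\<close> tends to 1 for every
  \<open>u > 0\<close>.
\<close>

definition bump :: "plane \<Rightarrow> plane \<Rightarrow> nat \<Rightarrow> plane \<Rightarrow> real" where
  "bump a b j x = (flat 1 (real (Suc j) * (fst x - fst a)) * flat 1 (real (Suc j) * (fst b - fst x)))
     * (flat 1 (real (Suc j) * (snd x - snd a)) * flat 1 (real (Suc j) * (snd b - snd x)))"

lemma flat_1: "0 \<le> flat 1 u" "flat 1 u \<le> 1" "u \<le> 0 \<Longrightarrow> flat 1 u = 0"
  by (auto simp: flat_def)

lemma in_box_plane:
  fixes x :: plane
  shows "x \<in> box a b \<longleftrightarrow> fst a < fst x \<and> fst x < fst b \<and> snd a < snd x \<and> snd x < snd b"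
  by (auto simp: box_prod mem_Times_iff)

lemma in_cbox_plane:
  fixes x :: plane
  shows "x \<in> cbox a b \<longleftrightarrow> fst a \<le> fst x \<and> fst x \<le> fst b \<and> snd a \<le> snd x \<and> snd x \<le> snd b"
  using cbox_Pair_iff[of "fst x" "snd x" "fst a" "snd a" "fst b" "snd b"] by simp

lemma bump_bounds: "0 \<le> bump a b j x" "bump a b j x \<le> 1"
  unfolding bump_def by (auto intro!: mult_nonneg_nonneg mult_le_one simp: flat_1)

lemma bump_outside: "x \<notin> box a b \<Longrightarrow> bump a b j x = 0"
  by (auto simp: bump_def in_box_plane flat_1(3) mult_le_0_iff not_less)

lemma bump_test:
  assumes "cbox a b \<subseteq> U"
  shows "bump a b j \<in> test_functions U"
proof (rule test_functionsI)
  have *: "C_k k (\<lambda>x. flat 1 (real (Suc j) * (fst x - c)))" "C_k k (\<lambda>x. flat 1 (real (Suc j) * (c - fst x)))"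
    "C_k k (\<lambda>x. flat 1 (real (Suc j) * (snd x - c)))" "C_k k (\<lambda>x. flat 1 (real (Suc j) * (c - snd x)))" for c k
    using C_k_flat[of k 1 "real (Suc j)" 0 "- real (Suc j) * c"] C_k_flat[of k 1 "- real (Suc j)" 0 "real (Suc j) * c"]
      C_k_flat[of k 1 0 "real (Suc j)" "- real (Suc j) * c"] C_k_flat[of k 1 0 "- real (Suc j)" "real (Suc j) * c"]
    by (simp_all add: algebra_simps)
  show "smooth (bump a b j)" unfolding smooth_def bump_def by (intro allI C_k_mult *)
  show "bump a b j x = 0" if "x \<notin> cbox a b" for x
    using that box_subset_cbox by (intro bump_outside) blast
qed (use assms in auto)

lemma flat_1_tendsto: "0 < u \<Longrightarrow> (\<lambda>j. flat 1 (real (Suc j) * u)) \<longlonglongrightarrow> 1"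
proof -
  assume u: "0 < u"
  have "(\<lambda>j. exp (- (inverse (real (Suc j)) * (1 / u)))) \<longlonglongrightarrow> exp (- (0 * (1 / u)))"
    by (intro tendsto_intros LIMSEQ_inverse_real_of_nat)
  then have "(\<lambda>j. exp (- (1 / (real (Suc j) * u)))) \<longlonglongrightarrow> 1"
    by (simp add: divide_inverse)
  moreover have "flat 1 (real (Suc j) * u) = exp (- (1 / (real (Suc j) * u)))" for j
    using u by (simp add: flat_def zero_less_mult_iff del: of_nat_Suc)
  ultimately show ?thesis by presburger
qed

lemma bump_tendsto: "(\<lambda>j. bump a b j x) \<longlonglongrightarrow> indicator (box a b) x"
proof (cases "x \<in> box a b")
  case True
  then have "(\<lambda>j. bump a b j x) \<longlonglongrightarrow> (1 * 1) * (1 * 1)"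
    unfolding bump_def by (intro tendsto_mult flat_1_tendsto) (auto simp: in_box_plane)
  then show ?thesis using True by simp
qed (simp add: bump_outside)

lemma bump_measurable: "bump a b j \<in> borel_measurable borel"
  using test_functionsD(1)[OF bump_test[of a b UNIV]] smooth_measurable by blast

lemma bump_integral_tendsto:
  assumes "fin_borel \<alpha>"
  shows "(\<lambda>j. \<integral>x. bump a b j x \<partial>\<alpha>) \<longlonglongrightarrow> measure \<alpha> (box a b)"
proof -
  note D = fin_borelD[OF assms]
  interpret finite_measure \<alpha> by fact
  have "(\<lambda>j. \<integral>x. bump a b j x \<partial>\<alpha>) \<longlonglongrightarrow> (\<integral>x. indicator (box a b) x \<partial>\<alpha>)"
  proof (rule integral_dominated_convergence[where w="\<lambda>_. 1"])
    show "bump a b j \<in> borel_measurable \<alpha>" for j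
      using bump_measurable measurable_cong_sets[OF D(2) refl] by blast
    show "indicat_real (box a b) \<in> borel_measurable \<alpha>"
      using D by (intro borel_measurable_indicator) simp
  qed (auto simp: bump_tendsto bump_bounds abs_of_nonneg)
  then show ?thesis using D by simp
qed

section \<open>The norm of a measure as a minimum over representations\<close>

definition represented_by :: "functional \<Rightarrow> plane measure \<Rightarrow> plane measure \<Rightarrow> bool" where
  "represented_by T \<alpha> \<beta> \<longleftrightarrow> fin_borel \<alpha> \<and> fin_borel \<beta> \<and> T \<in> extensional (test_functions UNIV) \<and>
     (\<forall>\<phi>\<in>test_functions UNIV. T \<phi> = (\<integral>x. \<phi> x \<partial>\<alpha>) - (\<integral>x. \<phi> x \<partial>\<beta>))"

text \<open>
  The integrals with respect to the Jordan decomposition may be replaced by those with respect to any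
  other pair with the same difference.
\<close>

lemma represented_by_iff:
  "represented_by T \<alpha> \<beta> \<longleftrightarrow> fin_borel \<alpha> \<and> fin_borel \<beta> \<and> T = dist_of_measure (measure_diff \<alpha> \<beta>)"
proof -
  have *: "signed_integral (measure_diff \<alpha> \<beta>) \<phi> = (\<integral>x. \<phi> x \<partial>\<alpha>) - (\<integral>x. \<phi> x \<partial>\<beta>)"
    if f: "fin_borel \<alpha>" "fin_borel \<beta>" and \<phi>: "\<phi> \<in> test_functions UNIV" for \<phi>
  proof -
    obtain B where "\<And>x. \<bar>\<phi> x\<bar> \<le> B" using test_function_bounded[OF \<phi>] by blast
    then show ?thesis
      using signed_integral_measure_diff[OF f smooth_measurable[OF test_functionsD(1)[OF \<phi>]]] by blast
  qed
  show ?thesis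
    unfolding represented_by_def dist_of_measure_def
    using * by (auto simp: fun_eq_iff extensional_def)
qed

text \<open>
  Open boxes form an intersection-stable generator of the Borel sets, and the whole plane is an
  increasing union of boxes, so the sets on which two signed measures agree contain all Borel sets.
\<close>

lemma measure_diff_eqI:
  assumes fin: "fin_borel \<alpha>" "fin_borel \<beta>" "fin_borel \<gamma>" "fin_borel \<delta>"
    and box: "\<And>a b :: plane. measure \<alpha> (box a b) - measure \<beta> (box a b) = measure \<gamma> (box a b) - measure \<delta> (box a b)"
  shows "measure_diff \<alpha> \<beta> = measure_diff \<gamma> \<delta>"
proof -
  let ?E = "range (\<lambda>(a, b). box a b :: plane set)"
  have sb: "sets (borel :: plane measure) = sigma_sets UNIV ?E"
    unfolding borel_eq_box by (rule sets_measure_of) simp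
  note S = measure_diff_signed[OF fin(1,2)] measure_diff_signed[OF fin(3,4)]
  have U: "measure_diff \<alpha> \<beta> UNIV = measure_diff \<gamma> \<delta> UNIV"
  proof -
    let ?B = "\<lambda>n::nat. box (- real n, - real n) (real n, real n)"
    have lim: "(\<lambda>n. measure m (?B n)) \<longlonglongrightarrow> measure m UNIV" if "fin_borel m" for m
    proof -
      have "(\<Union>n. ?B n) = UNIV"
      proof -
        have "\<exists>n. x \<in> ?B n" for x
        proof -
          obtain n :: nat where "\<bar>fst x\<bar> + \<bar>snd x\<bar> < real n" using reals_Archimedean2 by blast
          then show ?thesis by (intro exI[of _ n]) (auto simp: in_box_plane)
        qed
        then show ?thesis by blast
      qed
      moreover have "(\<lambda>n. measure m (?B n)) \<longlonglongrightarrow> measure m (\<Union>n. ?B n)"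
        using that fin_borelD[OF that]
        by (intro finite_measure.finite_Lim_measure_incseq) (auto simp: incseq_def in_box_plane)
      ultimately show ?thesis by simp
    qed
    have "(\<lambda>n. measure \<alpha> (?B n) - measure \<beta> (?B n)) \<longlonglongrightarrow> measure \<alpha> UNIV - measure \<beta> UNIV"
      using fin by (intro tendsto_diff lim)
    moreover have "(\<lambda>n. measure \<alpha> (?B n) - measure \<beta> (?B n)) \<longlonglongrightarrow> measure \<gamma> UNIV - measure \<delta> UNIV"
      unfolding box using fin by (intro tendsto_diff lim)
    ultimately show ?thesis using LIMSEQ_unique by (auto simp: measure_diff_def)
  qed
  have st: "Int_stable ?E"
  proof (rule Int_stableI)
    fix A B :: "plane set" assume "A \<in> ?E" "B \<in> ?E"
    then obtain a b c d where "A = box a b" "B = box c d" by auto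
    then obtain e f where "A \<inter> B = box e f" using box_Int_box by blast
    then show "A \<inter> B \<in> ?E" by (intro range_eqI[of _ _ "(e, f)"]) simp
  qed
  have "measure_diff \<alpha> \<beta> A = measure_diff \<gamma> \<delta> A" if "A \<in> sigma_sets UNIV ?E" for A
    using that
  proof (induction rule: sigma_sets_induct_disjoint[OF st subset_UNIV[of "?E", folded Pow_UNIV], consumes 1, case_names basic empty compl union])
    case (basic A)
    then show ?case using box by (auto simp: measure_diff_def)
  next
    case empty
    then show ?case by (simp add: measure_diff_def)
  next
    case (compl A)
    then show ?case using U signed_measure_Diff[OF S(1), of UNIV A] signed_measure_Diff[OF S(2), of UNIV A]
      by (simp add: sb sigma_sets_top)
  next
    case (union A)
    then show ?case
      using signed_measure_sums[OF S(1), of A] signed_measure_sums[OF S(2), of A]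
      by (simp add: sb range_subsetD sums_unique2)
  qed
  then show ?thesis by (auto simp: fun_eq_iff measure_diff_def sb)
qed

text \<open>
  Test functions determine a signed measure: evaluate T on bumps that increase to the indicator of
  a box.
\<close>

lemma represented_by_unique:
  assumes "represented_by T \<alpha> \<beta>" "represented_by T \<gamma> \<delta>"
  shows "measure_diff \<alpha> \<beta> = measure_diff \<gamma> \<delta>"
proof (rule measure_diff_eqI)
  show fin: "fin_borel \<alpha>" "fin_borel \<beta>" "fin_borel \<gamma>" "fin_borel \<delta>"
    using assms by (auto simp: represented_by_def)
  fix a b :: plane
  have lim: "(\<lambda>j. T (bump a b j)) \<longlonglongrightarrow> measure m (box a b) - measure m' (box a b)"
    if "represented_by T m m'" for m m'
  proof -
    have "T (bump a b j) = (\<integral>x. bump a b j x \<partial>m) - (\<integral>x. bump a b j x \<partial>m')" for j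
      using that by (simp add: represented_by_def bump_test)
    then show ?thesis
      using that by (auto simp: represented_by_def intro!: tendsto_diff bump_integral_tendsto)
  qed
  from lim[OF assms(1)] lim[OF assms(2)] show "measure \<alpha> (box a b) - measure \<beta> (box a b) = measure \<gamma> (box a b) - measure \<delta> (box a b)"
    by (rule LIMSEQ_unique)
qed

lemma M_norm_represented:
  assumes "represented_by T \<alpha> \<beta>"
  shows "M_norm T = total_variation (measure_diff \<alpha> \<beta>)"
proof -
  have "(THE \<mu>. \<mu> \<in> signed_measures \<and> T = dist_of_measure \<mu>) = measure_diff \<alpha> \<beta>"
  proof (rule the_equality)
    show "measure_diff \<alpha> \<beta> \<in> signed_measures \<and> T = dist_of_measure (measure_diff \<alpha> \<beta>)"
      using assms by (auto simp: represented_by_iff intro: measure_diff_signed)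
    fix \<mu> assume "\<mu> \<in> signed_measures \<and> T = dist_of_measure \<mu>"
    then have "represented_by T (pos_variation \<mu>) (neg_variation \<mu>)"
      by (simp add: represented_by_iff fin_borel_pos_variation fin_borel_neg_variation
          jordan_decomposition[symmetric])
    then show "\<mu> = measure_diff \<alpha> \<beta>"
      using represented_by_unique[OF assms] jordan_decomposition \<open>\<mu> \<in> _ \<and> _\<close> by metis
  qed
  then show ?thesis by (simp add: M_norm_def)
qed

text \<open>
  Together with \<open>M_norm_attained\<close>, the norm is the least mass \<open>\<alpha> UNIV + \<beta> UNIV\<close> among all
  representations.
\<close>

lemma M_norm_le:
  assumes "represented_by T \<alpha> \<beta>"
  shows "M_norm T \<le> measure \<alpha> UNIV + measure \<beta> UNIV"
  using M_norm_represented[OF assms] total_variation_measure_diff_le assms by (simp add: represented_by_def)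

lemma M_norm_attained:
  assumes "represented_by T \<alpha> \<beta>"
  obtains \<alpha>' \<beta>' where "represented_by T \<alpha>' \<beta>'" "M_norm T = measure \<alpha>' UNIV + measure \<beta>' UNIV"
proof
  let ?\<mu> = "measure_diff \<alpha> \<beta>"
  have \<mu>: "?\<mu> \<in> signed_measures" using assms by (auto simp: represented_by_def intro: measure_diff_signed)
  show "represented_by T (pos_variation ?\<mu>) (neg_variation ?\<mu>)"
    using assms \<mu> by (simp add: represented_by_iff fin_borel_pos_variation fin_borel_neg_variation
          jordan_decomposition[symmetric])
  show "M_norm T = measure (pos_variation ?\<mu>) UNIV + measure (neg_variation ?\<mu>) UNIV"
    using M_norm_represented[OF assms] by (simp add: total_variation_def)
qed

section \<open>Integration on the plane\<close>

lemma plane_fst_measurable [measurable (raw)]: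
  "f \<in> measurable N (borel :: plane measure) \<Longrightarrow> (\<lambda>x. fst (f x)) \<in> borel_measurable N"
  by (rule measurable_compose[where N=borel]) (auto intro!: borel_measurable_continuous_onI continuous_intros)

lemma plane_snd_measurable [measurable (raw)]:
  "f \<in> measurable N (borel :: plane measure) \<Longrightarrow> (\<lambda>x. snd (f x)) \<in> borel_measurable N"
  by (rule measurable_compose[where N=borel]) (auto intro!: borel_measurable_continuous_onI continuous_intros)

lemma plane_fubini:
  fixes f :: "plane \<Rightarrow> real"
  assumes "integrable lborel f"
  shows "(\<integral>x. f x \<partial>lborel) = (\<integral>s. (\<integral>u. f (s, u) \<partial>lborel) \<partial>lborel)"
    and "(\<integral>x. f x \<partial>lborel) = (\<integral>u. (\<integral>s. f (s, u) \<partial>lborel) \<partial>lborel)"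
proof -
  have i: "integrable (lborel \<Otimes>\<^sub>M lborel) f" using assms by (simp add: lborel_prod)
  show "(\<integral>x. f x \<partial>lborel) = (\<integral>s. (\<integral>u. f (s, u) \<partial>lborel) \<partial>lborel)"
    using lborel_pair.integral_fst'[OF i] by (simp add: lborel_prod)
  then show "(\<integral>x. f x \<partial>lborel) = (\<integral>u. (\<integral>s. f (s, u) \<partial>lborel) \<partial>lborel)"
    using lborel_pair.Fubini_integral[of "\<lambda>s u. f (s, u)"] i by simp
qed

lemma bounded_support_integrable:
  fixes f :: "plane \<Rightarrow> real"
  assumes "f \<in> borel_measurable borel" "\<And>x. \<bar>f x\<bar> \<le> B" "\<And>x. x \<notin> cbox a b \<Longrightarrow> f x = 0"
  shows "integrable lborel f"
proof (rule Bochner_Integration.integrable_bound)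
  show "integrable lborel (\<lambda>x. B * indicator (cbox a b) x :: real)"
    by (intro integrable_mult_right integrable_real_indicator) (use emeasure_lborel_cbox_finite in auto)
  show "AE x in lborel. norm (f x) \<le> norm (B * indicator (cbox a b) x :: real)"
    using assms(2,3) by (intro AE_I2) (auto simp: indicator_def intro: order_trans[OF _ abs_ge_self])
qed (use assms in auto)

lemma test_function_radius:
  assumes "\<phi> \<in> test_functions U"
  obtains R where "0 < R" "\<And>x. x \<in> fun_support \<phi> \<Longrightarrow> \<bar>fst x\<bar> \<le> R \<and> \<bar>snd x\<bar> \<le> R"
proof -
  have "bounded (fun_support \<phi>)" using test_functionsD(2)[OF assms] by (rule compact_imp_bounded)
  then obtain R where R: "0 < R" "\<And>x. x \<in> fun_support \<phi> \<Longrightarrow> norm x \<le> R" unfolding bounded_pos by blast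
  show ?thesis
  proof (rule that[OF R(1)])
    fix x assume "x \<in> fun_support \<phi>"
    then show "\<bar>fst x\<bar> \<le> R \<and> \<bar>snd x\<bar> \<le> R"
      using R(2)[of x] norm_fst_le[of "fst x" "snd x"] norm_snd_le[of "snd x" "fst x"] by auto
  qed
qed

lemma test_function_integrable:
  assumes "\<phi> \<in> test_functions U"
  shows "integrable lborel \<phi>"
proof -
  obtain R where R: "\<And>x. x \<in> fun_support \<phi> \<Longrightarrow> \<bar>fst x\<bar> \<le> R \<and> \<bar>snd x\<bar> \<le> R"
    using test_function_radius[OF assms] by blast
  obtain B where B: "\<And>x. \<bar>\<phi> x\<bar> \<le> B" using test_function_bounded[OF assms] by blast
  show ?thesis
  proof (rule bounded_support_integrable[OF _ B])
    show "\<phi> \<in> borel_measurable borel" using smooth_measurable test_functionsD(1)[OF assms] by blast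
    fix x :: plane assume "x \<notin> cbox (-R, -R) (R, R)"
    then have "x \<notin> fun_support \<phi>" using R[of x] by (auto simp: in_cbox_plane abs_le_iff)
    then show "\<phi> x = 0" using test_functionsD(4)[OF assms] by blast
  qed
qed

lemma integrable_mult_bounded:
  fixes f g :: "'a \<Rightarrow> real"
  assumes "integrable M f" "g \<in> borel_measurable M" "\<And>x. \<bar>g x\<bar> \<le> B"
  shows "integrable M (\<lambda>x. g x * f x)"
proof (rule Bochner_Integration.integrable_bound)
  show "integrable M (\<lambda>x. B * f x)" using assms by simp
  show "AE x in M. norm (g x * f x) \<le> norm (B * f x)"
  proof (rule AE_I2)
    fix x
    have "\<bar>g x\<bar> \<le> \<bar>B\<bar>" using assms(3)[of x] by linarith
    then show "norm (g x * f x) \<le> norm (B * f x)" by (simp add: abs_mult mult_right_mono)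
  qed
qed (use assms in measurable)

lemma ftc_interval:
  fixes g :: "real \<Rightarrow> real"
  assumes "\<And>s. (g has_real_derivative g' s) (at s)" "continuous_on UNIV g'" "a \<le> b"
  shows "(\<integral>s. indicator {a..b} s * g' s \<partial>lborel) = g b - g a"
proof -
  have "(\<integral>s. indicator {a..b} s *\<^sub>R g' s \<partial>lborel) = g b - g a"
    using assms
    by (intro integral_FTC_atLeastAtMost)
      (auto simp: has_real_derivative_iff_has_vector_derivative[symmetric]
        intro: has_field_derivative_at_within continuous_on_subset)
  then show ?thesis by simp
qed

text \<open>
  For large arguments g vanishes, hence so does its derivative, and the integral is one over a
  bounded interval.
\<close>

lemma ftc_tail:
  fixes g :: "real \<Rightarrow> real"
  assumes g: "\<And>s. (g has_real_derivative g' s) (at s)" "continuous_on UNIV g'" and R: "\<And>s. R < s \<Longrightarrow> g s = 0"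
  shows "(\<integral>s. (if a \<le> s then g' s else 0) \<partial>lborel) = - g a"
proof -
  have z: "g' s = 0" if "R < s" for s
  proof -
    have d: "((\<lambda>_. 0) has_real_derivative 0) (at s)" by simp
    have "(g has_real_derivative 0) (at s)"
      by (rule has_field_derivative_transform_within_open[OF d, of "{R<..}"]) (use that R in auto)
    then show ?thesis using g(1)[of s] DERIV_unique by blast
  qed
  let ?b = "max a R + 1"
  have "(\<integral>s. (if a \<le> s then g' s else 0) \<partial>lborel) = (\<integral>s. indicator {a..?b} s * g' s \<partial>lborel)"
    by (intro Bochner_Integration.integral_cong) (auto simp: indicator_def z)
  also have "\<dots> = g ?b - g a" by (rule ftc_interval[OF g]) auto
  finally show ?thesis using R[of ?b] by simp
qed

lemma partial_lines:
  assumes "smooth \<phi>"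
  shows "((\<lambda>s. \<phi> (s, y)) has_real_derivative partial1 \<phi> (s, y)) (at s)"
    and "((\<lambda>s. \<phi> (y, s)) has_real_derivative partial2 \<phi> (y, s)) (at s)"
proof -
  note D = has_derivative_partials[OF smooth_differentiable[OF assms]]
  have 1: "((\<lambda>s. (s, y)) has_derivative (\<lambda>h. (h, 0))) (at s)" "((\<lambda>s. (y, s)) has_derivative (\<lambda>h. (0, h))) (at s)"
    by (auto intro!: derivative_eq_intros)
  show "((\<lambda>s. \<phi> (s, y)) has_real_derivative partial1 \<phi> (s, y)) (at s)"
    using has_derivative_compose[OF 1(1) D] by (simp add: has_field_derivative_def mult.commute[of _ "partial1 _ _"])
  show "((\<lambda>s. \<phi> (y, s)) has_real_derivative partial2 \<phi> (y, s)) (at s)"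
    using has_derivative_compose[OF 1(2) D] by (simp add: has_field_derivative_def mult.commute[of _ "partial2 _ _"])
qed

lemma smooth_continuous_lines:
  assumes "smooth \<phi>"
  shows "continuous_on A (\<lambda>s. \<phi> (s, y))" "continuous_on A (\<lambda>s. \<phi> (y, s))"
  by (auto intro!: continuous_on_compose2[OF smooth_continuous[OF assms, of UNIV]] continuous_intros)

lemma ftc_lines:
  assumes \<phi>: "\<phi> \<in> test_functions UNIV"
  shows "(\<integral>s. (if a \<le> s then partial1 \<phi> (s, y) else 0) \<partial>lborel) = - \<phi> (a, y)"
    and "(\<integral>s. (if a \<le> s then partial2 \<phi> (y, s) else 0) \<partial>lborel) = - \<phi> (y, a)"
proof -
  obtain R where R: "\<And>x. x \<in> fun_support \<phi> \<Longrightarrow> \<bar>fst x\<bar> \<le> R \<and> \<bar>snd x\<bar> \<le> R"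
    using test_function_radius[OF \<phi>] by blast
  have z: "\<phi> x = 0" if "R < fst x \<or> R < snd x" for x
    using R[of x] that by (intro test_functionsD(4)[OF \<phi>]) auto
  note s = test_functionsD(1)[OF \<phi>]
  show "(\<integral>s. (if a \<le> s then partial1 \<phi> (s, y) else 0) \<partial>lborel) = - \<phi> (a, y)"
    by (rule ftc_tail[where R=R]) (auto intro!: partial_lines s smooth_continuous_lines smooth_partial z)
  show "(\<integral>s. (if a \<le> s then partial2 \<phi> (y, s) else 0) \<partial>lborel) = - \<phi> (y, a)"
    by (rule ftc_tail[where R=R]) (auto intro!: partial_lines s smooth_continuous_lines smooth_partial z)
qed

section \<open>Distribution functions of measures on the plane\<close>

definition up :: "plane \<Rightarrow> plane \<Rightarrow> real" where
  "up t x = (if fst t \<le> fst x \<and> snd t \<le> snd x then 1 else 0)"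

lemma up_measurable [measurable]:
  assumes [measurable]: "f \<in> measurable M borel" "g \<in> measurable M borel"
  shows "(\<lambda>z. up (f z) (g z)) \<in> borel_measurable M"
  unfolding up_def by measurable

lemma up_bound: "0 \<le> up t x" "up t x \<le> 1" "\<bar>up t x\<bar> \<le> 1" by (auto simp: up_def)

definition cdf2 :: "plane measure \<Rightarrow> plane \<Rightarrow> real" where
  "cdf2 \<alpha> x = (\<integral>t. up t x \<partial>\<alpha>)"

lemma cdf2_measurable [measurable]:
  assumes "fin_borel \<alpha>" shows "cdf2 \<alpha> \<in> borel_measurable borel"
proof -
  interpret finite_measure \<alpha> using fin_borelD(1)[OF assms] .
  note fin_borelD(2)[OF assms, measurable_cong]
  have "(\<lambda>x. \<integral>t. up t x \<partial>\<alpha>) \<in> borel_measurable borel" by measurable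
  then show ?thesis by (simp add: cdf2_def[abs_def])
qed

lemma cdf2_bound:
  assumes "fin_borel \<alpha>" shows "\<bar>cdf2 \<alpha> x\<bar> \<le> measure \<alpha> UNIV"
proof -
  interpret finite_measure \<alpha> using fin_borelD(1)[OF assms] .
  note fin_borelD(2)[OF assms, measurable_cong]
  have "\<bar>\<integral>t. up t x \<partial>\<alpha>\<bar> \<le> (\<integral>t. \<bar>up t x\<bar> \<partial>\<alpha>)" by (rule integral_abs_bound)
  also have "\<dots> \<le> (\<integral>t. 1 \<partial>\<alpha>)"
    by (rule integral_mono') (auto simp: up_bound)
  finally show ?thesis by (simp add: cdf2_def fin_borelD(3)[OF assms])
qed

lemma cdf2_fubini:
  assumes "fin_borel \<alpha>" and \<psi>: "integrable lborel \<psi>"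
  shows "(\<integral>x. cdf2 \<alpha> x * \<psi> x \<partial>lborel) = (\<integral>t. (\<integral>x. up t x * \<psi> x \<partial>lborel) \<partial>\<alpha>)"
proof -
  interpret finite_measure \<alpha> using fin_borelD(1)[OF assms(1)] .
  interpret pair_sigma_finite \<alpha> "lborel :: plane measure" ..
  note fin_borelD(2)[OF assms(1), measurable_cong]
  have [measurable]: "\<psi> \<in> borel_measurable borel" using \<psi> by auto
  have i: "integrable lborel (\<lambda>x. up t x * \<psi> x)" for t
    by (rule integrable_mult_bounded[OF \<psi>, of _ 1]) (auto simp: up_bound)
  have "integrable (\<alpha> \<Otimes>\<^sub>M lborel) (\<lambda>z. up (fst z) (snd z) * \<psi> (snd z))"
  proof (rule Fubini_integrable)
    show "integrable \<alpha> (\<lambda>t. \<integral>x. norm (up (fst (t, x)) (snd (t, x)) * \<psi> (snd (t, x))) \<partial>lborel)"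
    proof (rule integrable_const_bound[of _ "\<integral>x. \<bar>\<psi> x\<bar> \<partial>lborel"])
      have "norm (\<integral>x. norm (up t x * \<psi> x) \<partial>lborel) \<le> (\<integral>x. \<bar>\<psi> x\<bar> \<partial>lborel)" for t
      proof -
        have "(\<integral>x. norm (up t x * \<psi> x) \<partial>lborel) \<le> (\<integral>x. \<bar>\<psi> x\<bar> \<partial>lborel)"
          using i[of t] \<psi> by (intro integral_mono) (auto simp: up_def)
        then show ?thesis by (simp add: abs_of_nonneg integral_nonneg_AE)
      qed
      then show "AE t in \<alpha>. norm (\<integral>x. norm (up (fst (t, x)) (snd (t, x)) * \<psi> (snd (t, x))) \<partial>lborel) \<le> (\<integral>x. \<bar>\<psi> x\<bar> \<partial>lborel)"
        by simp
    qed measurable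
  qed (use i in \<open>auto\<close>)
  then have "(\<integral>x. (\<integral>t. up t x * \<psi> x \<partial>\<alpha>) \<partial>lborel) = (\<integral>t. (\<integral>x. up t x * \<psi> x \<partial>lborel) \<partial>\<alpha>)"
    by (intro Fubini_integral) (simp add: case_prod_beta')
  then show ?thesis by (simp add: cdf2_def)
qed

text \<open>
  The length of the part of \<open>[a, b]\<close> to the right of t, for \<open>a \<le> b\<close>: the integral over \<open>[a, b]\<close> of the unit step
  at t.
\<close>

definition ramp :: "real \<Rightarrow> real \<Rightarrow> real \<Rightarrow> real" where
  "ramp a b t = max 0 (b - max a t)"

lemma ramp_integral:
  assumes "a \<le> b"
  shows "(\<integral>s. (if t \<le> s then indicator {a..b} s else 0) \<partial>lborel) = ramp a b t"
    "integrable lborel (\<lambda>s. if t \<le> s then indicator {a..b} s else (0::real))"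
proof -
  have *: "(\<lambda>s. if t \<le> s then indicator {a..b} s else 0) = (indicator {max a t..b} :: real \<Rightarrow> real)"
    by (auto simp: indicator_def)
  show "(\<integral>s. (if t \<le> s then indicator {a..b} s else 0) \<partial>lborel) = ramp a b t"
    unfolding * by (cases "max a t \<le> b") (auto simp: ramp_def)
  show "integrable lborel (\<lambda>s. if t \<le> s then indicator {a..b} s else (0::real))"
    unfolding * by (intro integrable_real_indicator) (use emeasure_lborel_cbox_finite[of "max a t" b] in auto)
qed

text \<open>
  The quadrant above t meets the box in a rectangle, and the ramps are the lengths of its sides.
\<close>

lemma cdf2_box:
  assumes "fin_borel \<alpha>" "a \<le> b" "c \<le> d"
  shows "(\<integral>x. cdf2 \<alpha> x * indicator (cbox (a, c) (b, d)) x \<partial>lborel)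
      = (\<integral>t. ramp a b (fst t) * ramp c d (snd t) \<partial>\<alpha>)"
proof -
  have i: "integrable lborel (indicator (cbox (a, c) (b, d)) :: plane \<Rightarrow> real)"
    by (intro integrable_real_indicator) (use emeasure_lborel_cbox_finite in auto)
  have "(\<integral>x. up t x * indicator (cbox (a, c) (b, d)) x \<partial>lborel) = ramp a b (fst t) * ramp c d (snd t)" for t
  proof -
    have "integrable lborel (\<lambda>x. up t x * indicator (cbox (a, c) (b, d)) x)"
      by (rule integrable_mult_bounded[OF i, of _ 1]) (auto simp: up_bound)
    moreover have "up t (s, u) * indicator (cbox (a, c) (b, d)) (s, u)
        = (if fst t \<le> s then indicator {a..b} s else 0) * (if snd t \<le> u then indicator {c..d} u else 0)" for s u
      by (simp add: up_def indicator_def)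
    ultimately have "(\<integral>x. up t x * indicator (cbox (a, c) (b, d)) x \<partial>lborel)
        = (\<integral>s. (\<integral>u. (if fst t \<le> s then indicator {a..b} s else 0) * (if snd t \<le> u then indicator {c..d} u else 0) \<partial>lborel) \<partial>lborel)"
      using plane_fubini(1)[of "\<lambda>x. up t x * indicator (cbox (a, c) (b, d)) x"] by simp
    then show ?thesis by (simp add: ramp_integral assms)
  qed
  then show ?thesis by (simp add: cdf2_fubini[OF assms(1) i])
qed

section \<open>Functions whose mixed derivative is a measure\<close>

lemma distributions_linear:
  assumes "f \<in> distributions" "\<phi> \<in> test_functions UNIV" "\<psi> \<in> test_functions UNIV"
  shows "f (\<lambda>x. \<phi> x + \<psi> x) = f \<phi> + f \<psi>" "f (\<lambda>x. c * \<phi> x) = c * f \<phi>"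
  using assms unfolding distributions_def by blast+

lemma D_D_apply:
  assumes "\<phi> \<in> test_functions UNIV"
  shows "D_D f \<phi> = f (partial2 (partial1 \<phi>))"
  using assms test_function_partial(1)[OF assms] by (simp add: D_D_def D_I_def I_D_def)

lemma test_function_D_D_integral:
  assumes \<Phi>: "\<Phi> \<in> test_functions UNIV"
  shows "(\<integral>x. up t x * partial2 (partial1 \<Phi>) x \<partial>lborel) = \<Phi> t"
proof -
  note p = test_function_partial(1)[OF \<Phi>]
  note pp = test_function_partial(2)[OF p]
  have "integrable lborel (\<lambda>x. up t x * partial2 (partial1 \<Phi>) x)"
    by (rule integrable_mult_bounded[OF test_function_integrable[OF pp], of _ 1]) (auto simp: up_bound)
  from plane_fubini(1)[OF this]
  have "(\<integral>x. up t x * partial2 (partial1 \<Phi>) x \<partial>lborel)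
     = (\<integral>s. (\<integral>u. (if fst t \<le> s then 1 else 0) * (if snd t \<le> u then partial2 (partial1 \<Phi>) (s, u) else 0) \<partial>lborel) \<partial>lborel)"
    by (auto simp: up_def intro!: Bochner_Integration.integral_cong)
  also have "\<dots> = (\<integral>s. (if fst t \<le> s then 1 else 0) * (- partial1 \<Phi> (s, snd t)) \<partial>lborel)"
    by (simp add: ftc_lines(2)[OF p])
  also have "\<dots> = - (\<integral>s. (if fst t \<le> s then partial1 \<Phi> (s, snd t) else 0) \<partial>lborel)"
    by (subst Bochner_Integration.integral_minus[symmetric])
      (auto intro!: Bochner_Integration.integral_cong)
  also have "\<dots> = \<Phi> t" by (simp add: ftc_lines(1)[OF \<Phi>])
  finally show ?thesis .
qed

text \<open>
  A test function with mixed derivative \<phi> need not exist, because the integrals of \<phi> may be nonzero.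
  Segment means of length M in both directions produce instead a mixed derivative that differs from
  \<phi> by three translates of \<phi>. For large M the translates are supported to the left of K or below
  K, where they do not affect a distribution that vanishes off K.
\<close>

lemma potential_exists:
  assumes \<phi>: "\<phi> \<in> test_functions UNIV"
  obtains \<Phi> \<rho> where "\<Phi> \<in> test_functions UNIV" "\<rho> \<in> test_functions (- K)"
    "\<And>x. partial2 (partial1 \<Phi>) x = \<phi> x + \<rho> x" "\<And>x. 0 \<le> fst x \<Longrightarrow> 0 \<le> snd x \<Longrightarrow> \<rho> x = 0"
proof -
  obtain R where R: "0 < R" "\<And>x. x \<in> fun_support \<phi> \<Longrightarrow> \<bar>fst x\<bar> \<le> R \<and> \<bar>snd x\<bar> \<le> R"
    using test_function_radius[OF \<phi>] by blast
  \<comment> \<open>A translate by \<open>M > R\<close> to the left or down lies in a half plane with a negative coordinate.\<close>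
  define M where "M = R + 1"
  have M: "0 < M" using R by (simp add: M_def)
  define g where "g = seg_avg (0, M) (\<lambda>x. M * M * \<phi> x)"
  define \<Phi> where "\<Phi> = seg_avg (M, 0) g"
  let ?u = "\<lambda>x. \<phi> (x + (M, M))" and ?v = "\<lambda>x. \<phi> (x + (M, 0))" and ?w = "\<lambda>x. \<phi> (x + (0, M))"
  note g = test_function_seg_avg[OF test_function_cmult[OF \<phi>], of "(0, M)" "M * M", folded g_def]
  have "M * partial1 \<Phi> x = g (x + (M, 0)) - g x" for x
    using seg_avg_directional[OF test_functionsD(1)[OF g], of "(M, 0)"] by (simp add: \<Phi>_def)
  then have 1: "partial1 \<Phi> = (\<lambda>x. inverse M * (g (x + (M, 0)) - g x))"
    using M by (intro ext) (simp add: field_simps)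
  have "M * partial2 g x = M * (M * (\<phi> (x + (0, M)) - \<phi> x))" for x
    using seg_avg_directional[OF test_functionsD(1)[OF test_function_cmult[OF \<phi>]], of "(0, M)" "M * M" x]
    by (simp add: g_def algebra_simps)
  then have 2: "partial2 g x = M * (\<phi> (x + (0, M)) - \<phi> x)" for x using M by simp
  have 3: "partial2 (partial1 \<Phi>) x = inverse M * (partial2 g (x + (M, 0)) - partial2 g x)" for x
  proof -
    have D: "(g has_derivative (\<lambda>h. fst h * partial1 g x + snd h * partial2 g x)) (at x)" for x
      using g by (intro has_derivative_partials smooth_differentiable test_functionsD(1))
    have i: "((\<lambda>x. x + (M, 0)) has_derivative (\<lambda>h. h)) (at x)" for x :: plane
      by (auto intro!: derivative_eq_intros)
    have "((\<lambda>x. inverse M * (g (x + (M, 0)) - g x)) has_derivative (\<lambda>h. inverse M *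
       ((fst h * partial1 g (x + (M, 0)) + snd h * partial2 g (x + (M, 0)))
         - (fst h * partial1 g x + snd h * partial2 g x)))) (at x)"
      by (intro has_derivative_mult_right has_derivative_diff D has_derivative_compose[OF i D])
    from partial_eqI(2)[OF this] show ?thesis unfolding 1 by simp
  qed
  define \<rho> where "\<rho> = (\<lambda>x. ?u x + (-1) * ?v x + (-1) * ?w x)"
  show ?thesis
  proof
    show "\<Phi> \<in> test_functions UNIV" unfolding \<Phi>_def by (rule test_function_seg_avg[OF g])
    show "partial2 (partial1 \<Phi>) x = \<phi> x + \<rho> x" for x
      using M unfolding 3 2 \<rho>_def by (simp add: add.assoc field_simps)
    have out: "x + (M, M) \<notin> fun_support \<phi> \<and> x + (M, 0) \<notin> fun_support \<phi> \<and> x + (0, M) \<notin> fun_support \<phi>"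
      if "0 \<le> fst x" "0 \<le> snd x" for x
      using R(2)[of "x + (M, M)"] R(2)[of "x + (M, 0)"] R(2)[of "x + (0, M)"] that
      by (auto simp: M_def)
    show "\<rho> \<in> test_functions (- K)"
      unfolding \<rho>_def
      by (intro test_function_add test_function_cmult test_function_translate[OF \<phi>])
        (use out in \<open>auto simp: K_def\<close>)
    show "\<rho> x = 0" if "0 \<le> fst x" "0 \<le> snd x" for x
      using out[OF that] test_functionsD(4)[OF \<phi>] by (simp add: \<rho>_def)
  qed
qed

lemma K_borel [measurable]: "K \<in> sets borel"
proof -
  have "K = cbox (0, 0) (1, 1)" by (auto simp: K_def cbox_Pair_eq)
  then show ?thesis by (metis borel_closed closed_cbox)
qed

lemma M_DD0_represented:
  assumes "f \<in> M_DD0"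
  obtains \<alpha> \<beta> where "represented_by (D_D f) \<alpha> \<beta>" "AE t in \<alpha>. t \<in> K" "AE t in \<beta>. t \<in> K"
proof -
  obtain \<mu> where \<mu>: "D_D f = dist_of_measure \<mu>" "\<mu> \<in> signed_measures"
    "\<And>A. A \<in> sets borel \<Longrightarrow> A \<inter> K = {} \<Longrightarrow> \<mu> A = 0"
    using assms by (auto simp: M_DD0_def M_space_def)
  let ?a = "pos_variation \<mu>" and ?b = "neg_variation \<mu>"
  note fin = fin_borel_pos_variation[OF \<mu>(2)] fin_borel_neg_variation[OF \<mu>(2)]
  have rep: "represented_by (D_D f) ?a ?b"
    using fin \<mu> by (simp add: represented_by_iff jordan_decomposition[symmetric])
  have ne: "{B \<in> sets borel. B \<subseteq> - K} \<noteq> {}" by auto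
  have z: "emeasure ?a (- K) = 0" "emeasure ?b (- K) = 0"
  proof -
    have "\<mu> B = 0" if "B \<in> sets borel" "B \<subseteq> - K" for B using that by (intro \<mu>(3)) auto
    then have "(SUP B\<in>{B \<in> sets borel. B \<subseteq> - K}. ennreal (\<mu> B)) = (SUP B\<in>{B \<in> sets (borel :: plane measure). B \<subseteq> - K}. 0)"
      "(SUP B\<in>{B \<in> sets borel. B \<subseteq> - K}. ennreal (- \<mu> B)) = (SUP B\<in>{B \<in> sets (borel :: plane measure). B \<subseteq> - K}. 0)"
      by (intro SUP_cong; simp)+
    then show "emeasure ?a (- K) = 0" "emeasure ?b (- K) = 0"
      using ne by (simp_all add: emeasure_pos_variation[OF \<mu>(2)] emeasure_neg_variation[OF \<mu>(2)] upper_variation_def)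
  qed
  have AE: "AE t in m. t \<in> K" if "fin_borel m" "emeasure m (- K) = 0" for m
    using that fin_borelD[OF that(1)] by (intro AE_I[of _ _ "- K"]) auto
  show ?thesis by (rule that[OF rep AE[OF fin(1) z(1)] AE[OF fin(2) z(2)]])
qed

lemma test_mult_cdf2_integrable:
  assumes "fin_borel \<alpha>" "integrable lborel \<phi>"
  shows "integrable lborel (\<lambda>x. cdf2 \<alpha> x * \<phi> x)"
  by (rule integrable_mult_bounded[OF assms(2) _ cdf2_bound[OF assms(1)]]) (use cdf2_measurable[OF assms(1)] in simp)

text \<open>
  \<open>f \<phi>\<close> equals the value of the mixed derivative on the potential \<Phi> of \<phi>. For t in K, \<open>\<Phi> t\<close> is the integral
  of \<phi> over the quadrant above t, since the error term \<rho> vanishes there; Fubini then turns the integral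
  of \<Phi> against the measure into the integral of \<phi> against the distribution function.
\<close>

lemma M_DD0_cdf2:
  assumes f: "f \<in> M_DD0" and rep: "represented_by (D_D f) \<alpha> \<beta>" "AE t in \<alpha>. t \<in> K" "AE t in \<beta>. t \<in> K"
    and \<phi>: "\<phi> \<in> test_functions UNIV"
  shows "f \<phi> = (\<integral>x. (cdf2 \<alpha> x - cdf2 \<beta> x) * \<phi> x \<partial>lborel)"
proof -
  have fin: "fin_borel \<alpha>" "fin_borel \<beta>" using rep by (auto simp: represented_by_def)
  have fd: "f \<in> distributions" "\<And>\<phi>. \<phi> \<in> test_functions (- K) \<Longrightarrow> f \<phi> = 0" using f by (auto simp: M_DD0_def)
  obtain \<Phi> \<rho> where \<Phi>: "\<Phi> \<in> test_functions UNIV" "\<rho> \<in> test_functions (- K)"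
    "\<And>x. partial2 (partial1 \<Phi>) x = \<phi> x + \<rho> x" "\<And>x. 0 \<le> fst x \<Longrightarrow> 0 \<le> snd x \<Longrightarrow> \<rho> x = 0"
    using potential_exists[OF \<phi>] by blast
  have "partial2 (partial1 \<Phi>) = (\<lambda>x. \<phi> x + \<rho> x)" using \<Phi>(3) by blast
  then have "f \<phi> = D_D f \<Phi>"
    using distributions_linear(1)[OF fd(1) \<phi> test_functions_UNIV[OF \<Phi>(2)]] fd(2)[OF \<Phi>(2)]
    by (simp add: D_D_apply[OF \<Phi>(1)])
  also have "\<dots> = (\<integral>t. \<Phi> t \<partial>\<alpha>) - (\<integral>t. \<Phi> t \<partial>\<beta>)" using rep(1) \<Phi>(1) by (simp add: represented_by_def)
  finally have 1: "f \<phi> = (\<integral>t. \<Phi> t \<partial>\<alpha>) - (\<integral>t. \<Phi> t \<partial>\<beta>)" .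
  have 2: "(\<integral>t. \<Phi> t \<partial>m) = (\<integral>x. cdf2 m x * \<phi> x \<partial>lborel)" if m: "fin_borel m" "AE t in m. t \<in> K" for m
  proof -
    note fin_borelD(2)[OF m(1), measurable_cong]
    interpret finite_measure m using fin_borelD(1)[OF m(1)] .
    have [measurable]: "\<Phi> \<in> borel_measurable borel" "\<phi> \<in> borel_measurable borel"
      using \<Phi>(1) \<phi> test_functionsD(1) smooth_measurable by blast+
    have *: "(\<integral>x. up t x * \<phi> x \<partial>lborel) = \<Phi> t" if "t \<in> K" for t
    proof -
      have "(\<lambda>x. up t x * \<phi> x) = (\<lambda>x. up t x * partial2 (partial1 \<Phi>) x)"
      proof
        fix x show "up t x * \<phi> x = up t x * partial2 (partial1 \<Phi>) x"
          using that \<Phi>(4)[of x] by (auto simp: up_def \<Phi>(3) K_def mem_Times_iff)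
      qed
      then show ?thesis using test_function_D_D_integral[OF \<Phi>(1), of t] by simp
    qed
    have "(\<integral>t. \<Phi> t \<partial>m) = (\<integral>t. (\<integral>x. up t x * \<phi> x \<partial>lborel) \<partial>m)"
      using m(2) * by (intro integral_cong_AE) auto
    then show ?thesis using cdf2_fubini[OF m(1) test_function_integrable[OF \<phi>]] by simp
  qed
  show ?thesis
    unfolding 1 2[OF fin(1) rep(2)] 2[OF fin(2) rep(3)]
    using test_mult_cdf2_integrable[OF fin(1) test_function_integrable[OF \<phi>]]
      test_mult_cdf2_integrable[OF fin(2) test_function_integrable[OF \<phi>]]
    by (simp add: left_diff_distrib)
qed

lemma AE_box_cbox:
  "AE x in lborel. indicator (box a b) x = (indicator (cbox a b) x :: real)" for a b :: plane
proof (rule AE_I)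
  show "{x \<in> space lborel. indicator (box a b) x \<noteq> (indicator (cbox a b) x :: real)} \<subseteq> cbox a b - box a b"
    using box_subset_cbox[of a b] by (auto simp: indicator_def split: if_splits)
  show "emeasure lborel (cbox a b - box a b) = 0"
  proof (subst emeasure_Diff)
    show "emeasure lborel (cbox a b) - emeasure lborel (box a b) = 0"
      by (auto simp: emeasure_lborel_cbox_eq emeasure_lborel_box_eq)
  qed (use box_subset_cbox emeasure_lborel_box_finite[of a b] in auto)
qed simp

lemma bump_lborel_tendsto:
  assumes g: "g \<in> borel_measurable borel" and i: "integrable lborel (\<lambda>x. indicator (cbox a b) x * g x)"
  shows "(\<lambda>j. \<integral>x. g x * bump a b j x \<partial>lborel) \<longlonglongrightarrow> (\<integral>x. indicator (cbox a b) x * g x \<partial>lborel)"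
proof (rule integral_dominated_convergence[where w="\<lambda>x. \<bar>indicator (cbox a b) x * g x\<bar>"])
  show "AE x in lborel. (\<lambda>j. g x * bump a b j x) \<longlonglongrightarrow> indicator (cbox a b) x * g x"
    using AE_box_cbox[of a b]
  proof eventually_elim
    case (elim x)
    have "(\<lambda>j. g x * bump a b j x) \<longlonglongrightarrow> g x * indicator (box a b) x"
      by (intro tendsto_mult tendsto_const bump_tendsto)
    then show ?case using elim by (simp add: mult.commute)
  qed
  show "AE x in lborel. norm (g x * bump a b j x) \<le> \<bar>indicator (cbox a b) x * g x\<bar>" for j
  proof (rule AE_I2)
    fix x show "norm (g x * bump a b j x) \<le> \<bar>indicator (cbox a b) x * g x\<bar>"
    proof (cases "x \<in> box a b")
      case True
      then have "x \<in> cbox a b" using box_subset_cbox by blast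
      then show ?thesis using bump_bounds[of a b j x] by (simp add: abs_mult mult_left_le)
    qed (simp add: bump_outside)
  qed
  show "(\<lambda>x. g x * bump a b j x) \<in> borel_measurable lborel" for j
    using g bump_measurable[of a b j] by simp
  show "integrable lborel (\<lambda>x. \<bar>indicator (cbox a b) x * g x\<bar>)" using i by (rule integrable_abs)
qed (use g in simp)

lemma locally_integrable_box:
  assumes "locally_integrable g"
  shows "g \<in> borel_measurable borel" "integrable lborel (\<lambda>x. indicator (cbox a b) x * g x)"
proof -
  show "g \<in> borel_measurable borel" using assms by (simp add: locally_integrable_def)
  have "set_integrable lborel (cbox a b) g" using assms compact_cbox by (auto simp: locally_integrable_def)
  then show "integrable lborel (\<lambda>x. indicator (cbox a b) x * g x)" by (simp add: set_integrable_def)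
qed

text \<open>
  The representing function is picked by \<open>SOME\<close>, but its integrals over boxes are limits of values of
  the distribution on bumps.
\<close>

lemma pixel_integral_fun_of_dist:
  assumes "locally_integrable g" "T = dist_of_fun g"
  shows "set_lebesgue_integral lborel (cbox a b) (fun_of_dist T) = (\<integral>x. indicator (cbox a b) x * g x \<partial>lborel)"
proof -
  let ?g = "fun_of_dist T"
  have "\<exists>g. locally_integrable g \<and> T = dist_of_fun g" using assms by blast
  then have g': "locally_integrable ?g" "T = dist_of_fun ?g"
    unfolding fun_of_dist_def by (metis (mono_tags, lifting) someI_ex)+
  have "(\<lambda>j. T (bump a b j)) \<longlonglongrightarrow> (\<integral>x. indicator (cbox a b) x * g x \<partial>lborel)"
    if "locally_integrable g" "T = dist_of_fun g" for g
  proof -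
    have "T (bump a b j) = (\<integral>x. g x * bump a b j x \<partial>lborel)" for j
      using that(2) bump_test[of a b UNIV] by (simp add: dist_of_fun_def)
    then show ?thesis
      using bump_lborel_tendsto[OF locally_integrable_box[OF that(1)]] by simp
  qed
  from LIMSEQ_unique[OF this[OF assms] this[OF g']]
  show ?thesis by (simp add: set_lebesgue_integral_def)
qed

lemma cdf2_locally_integrable:
  assumes "fin_borel \<alpha>" "fin_borel \<beta>"
  shows "locally_integrable (\<lambda>x. cdf2 \<alpha> x - cdf2 \<beta> x)"
  unfolding locally_integrable_def
proof (intro conjI allI impI)
  show m: "(\<lambda>x. cdf2 \<alpha> x - cdf2 \<beta> x) \<in> borel_measurable borel"
    using cdf2_measurable[OF assms(1)] cdf2_measurable[OF assms(2)] by simp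
  fix C :: "plane set" assume "compact C"
  then have i: "integrable lborel (indicator C :: plane \<Rightarrow> real)"
    using emeasure_compact_finite[OF \<open>compact C\<close>] by (intro integrable_real_indicator) (auto simp: borel_compact)
  have "integrable lborel (\<lambda>x. (cdf2 \<alpha> x - cdf2 \<beta> x) * indicator C x)"
  proof (rule integrable_mult_bounded[OF i])
    fix x show "\<bar>cdf2 \<alpha> x - cdf2 \<beta> x\<bar> \<le> measure \<alpha> UNIV + measure \<beta> UNIV"
      using cdf2_bound[OF assms(1), of x] cdf2_bound[OF assms(2), of x] by linarith
  qed (use m in simp)
  then show "set_integrable lborel C (\<lambda>x. cdf2 \<alpha> x - cdf2 \<beta> x)"
    by (simp add: set_integrable_def mult.commute)
qed

definition dint :: "plane measure \<Rightarrow> plane measure \<Rightarrow> (plane \<Rightarrow> real) \<Rightarrow> real" where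
  "dint \<alpha> \<beta> u = (\<integral>t. u t \<partial>\<alpha>) - (\<integral>t. u t \<partial>\<beta>)"

lemma ramp_measurable [measurable]:
  assumes [measurable]: "f \<in> borel_measurable M"
  shows "(\<lambda>x. ramp a b (f x)) \<in> borel_measurable M"
  unfolding ramp_def by measurable

lemma ramp_bound: "a \<le> b \<Longrightarrow> 0 \<le> ramp a b t" "a \<le> b \<Longrightarrow> ramp a b t \<le> b - a" "a \<le> b \<Longrightarrow> \<bar>ramp a b t\<bar> \<le> b - a"
  by (auto simp: ramp_def)

lemma AE_integral_cong:
  assumes "fin_borel \<alpha>" "AE t in \<alpha>. t \<in> K" "u \<in> borel_measurable borel" "v \<in> borel_measurable borel"
    and "\<And>t. t \<in> K \<Longrightarrow> u t = (v t :: real)"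
  shows "(\<integral>t. u t \<partial>\<alpha>) = (\<integral>t. v t \<partial>\<alpha>)"
proof (rule integral_cong_AE)
  show "u \<in> borel_measurable \<alpha>" "v \<in> borel_measurable \<alpha>"
    using assms measurable_cong_sets[OF fin_borelD(2)[OF assms(1)] refl] by blast+
  show "AE t in \<alpha>. u t = v t" using assms(2) by eventually_elim (rule assms(5))
qed

lemma dint_box:
  assumes fin: "fin_borel \<alpha>" "fin_borel \<beta>" and ab: "a \<le> b" "c \<le> d"
  shows "(\<integral>x. indicator (cbox (a, c) (b, d)) x * (cdf2 \<alpha> x - cdf2 \<beta> x) \<partial>lborel)
    = dint \<alpha> \<beta> (\<lambda>t. ramp a b (fst t) * ramp c d (snd t))"
proof -
  have i: "integrable lborel (indicator (cbox (a, c) (b, d)) :: plane \<Rightarrow> real)"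
    by (intro integrable_real_indicator) (use emeasure_lborel_cbox_finite in auto)
  have "(\<integral>x. indicator (cbox (a, c) (b, d)) x * (cdf2 \<alpha> x - cdf2 \<beta> x) \<partial>lborel)
    = (\<integral>x. cdf2 \<alpha> x * indicator (cbox (a, c) (b, d)) x - cdf2 \<beta> x * indicator (cbox (a, c) (b, d)) x \<partial>lborel)"
    by (intro Bochner_Integration.integral_cong) (auto simp: algebra_simps)
  also have "\<dots> = (\<integral>x. cdf2 \<alpha> x * indicator (cbox (a, c) (b, d)) x \<partial>lborel) - (\<integral>x. cdf2 \<beta> x * indicator (cbox (a, c) (b, d)) x \<partial>lborel)"
    by (intro Bochner_Integration.integral_diff test_mult_cdf2_integrable fin i)
  finally show ?thesis by (simp add: dint_def cdf2_box fin ab)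
qed

lemma ramp_indicator_tendsto:
  "(\<lambda>n. ramp a (a + 1 / real (Suc n)) t * real (Suc n)) \<longlonglongrightarrow> (if t \<le> a then 1 else 0)"
proof (cases "t \<le> a")
  case True
  then have "ramp a (a + 1 / real (Suc n)) t * real (Suc n) = 1" for n
    by (simp add: ramp_def max_def)
  then show ?thesis using True by simp
next
  case False
  obtain N where N: "inverse (real (Suc N)) < t - a" using False reals_Archimedean[of "t - a"] by auto
  have "ramp a (a + 1 / real (Suc n)) t * real (Suc n) = 0" if "N \<le> n" for n
  proof -
    have "inverse (real (Suc n)) \<le> inverse (real (Suc N))" using that by (intro le_imp_inverse_le) auto
    then have "a + 1 / real (Suc n) \<le> t" using N by (simp add: inverse_eq_divide)
    then show ?thesis using False by (simp add: ramp_def)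
  qed
  then have "eventually (\<lambda>n. ramp a (a + 1 / real (Suc n)) t * real (Suc n) = 0) sequentially"
    by (auto simp: eventually_sequentially)
  then show ?thesis using False by (simp add: tendsto_eventually)
qed

lemma ramp_indicator_integral_tendsto:
  assumes "fin_borel m" and p: "p \<in> borel_measurable borel"
  shows "(\<lambda>n. (\<integral>t. ramp a (a + 1 / real (Suc n)) (p t) \<partial>m) * real (Suc n)) \<longlonglongrightarrow> (\<integral>t. (if p t \<le> a then 1 else 0) \<partial>m)"
proof -
  note fin_borelD(2)[OF assms(1), measurable_cong]
  interpret finite_measure m using fin_borelD(1)[OF assms(1)] .
  have [measurable]: "p \<in> borel_measurable m" using p by measurable
  have "(\<lambda>n. \<integral>t. ramp a (a + 1 / real (Suc n)) (p t) * real (Suc n) \<partial>m) \<longlonglongrightarrow> (\<integral>t. (if p t \<le> a then 1 else 0) \<partial>m)"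
  proof (rule integral_dominated_convergence[where w="\<lambda>_. 1"])
    show "AE t in m. norm (ramp a (a + 1 / real (Suc n)) (p t) * real (Suc n)) \<le> 1" for n
    proof (rule AE_I2)
      fix t
      have "ramp a (a + 1 / real (Suc n)) (p t) * real (Suc n) \<le> (1 / real (Suc n)) * real (Suc n)"
        using ramp_bound(2)[of a "a + 1 / real (Suc n)" "p t"] by (intro mult_right_mono) auto
      then show "norm (ramp a (a + 1 / real (Suc n)) (p t) * real (Suc n)) \<le> 1"
        using ramp_bound(1)[of a "a + 1 / real (Suc n)" "p t"] by (simp add: abs_mult del: of_nat_Suc)
    qed
    show "AE t in m. (\<lambda>n. ramp a (a + 1 / real (Suc n)) (p t) * real (Suc n)) \<longlonglongrightarrow> (if p t \<le> a then 1 else 0)"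
      by (intro AE_I2 ramp_indicator_tendsto)
  qed auto
  then show ?thesis by simp
qed

text \<open>
  Two positive measures on K whose difference has vanishing marginals. The marginals are tested on
  ramps only, which is the form in which they are first obtained and later used. Vanishing marginals
  are what makes the distribution function of the difference vanish also to the right of K and
  above it.
\<close>

locale marginal_free =
  fixes \<alpha> \<beta> :: "plane measure"
  assumes fin: "fin_borel \<alpha>" "fin_borel \<beta>"
    and supp: "AE t in \<alpha>. t \<in> K" "AE t in \<beta>. t \<in> K"
    and dint_ramp: "\<And>a b. a \<le> b \<Longrightarrow> dint \<alpha> \<beta> (\<lambda>t. ramp a b (fst t)) = 0"
      "\<And>a b. a \<le> b \<Longrightarrow> dint \<alpha> \<beta> (\<lambda>t. ramp a b (snd t)) = 0"
begin

lemma dint_cong: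
  assumes "u \<in> borel_measurable borel" "v \<in> borel_measurable borel" "\<And>t. t \<in> K \<Longrightarrow> u t = v t"
  shows "dint \<alpha> \<beta> u = dint \<alpha> \<beta> v"
  using AE_integral_cong[OF fin(1) supp(1) assms] AE_integral_cong[OF fin(2) supp(2) assms]
  by (simp add: dint_def)

text \<open>
  To the right of K the distribution function depends on the second marginal only, above K on the
  first only. Ramps over shrinking intervals \<open>[a, a + 1/(n+1)]\<close>, divided by the length, converge to the
  indicator of the half line up to a.
\<close>

lemma cdf2_eq_outside:
  assumes "x \<notin> K" shows "cdf2 \<alpha> x = cdf2 \<beta> x"
proof -
  have half: "(\<integral>t. (if p t \<le> a then 1 else 0) \<partial>\<alpha>) = (\<integral>t. (if p t \<le> a then 1 else (0::real)) \<partial>\<beta>)"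
    if p: "p = fst \<or> p = snd" for p a
  proof -
    have m: "p \<in> borel_measurable borel" using p by (auto intro!: plane_fst_measurable plane_snd_measurable)
    have "(\<integral>t. ramp a (a + 1 / real (Suc n)) (p t) \<partial>\<alpha>) = (\<integral>t. ramp a (a + 1 / real (Suc n)) (p t) \<partial>\<beta>)" for n
      using dint_ramp[of a "a + 1 / real (Suc n)"] p by (auto simp: dint_def)
    then show ?thesis
      using LIMSEQ_unique[OF ramp_indicator_integral_tendsto[OF fin(1) m, of a]]
        ramp_indicator_integral_tendsto[OF fin(2) m, of a] by simp
  qed
  show ?thesis
  proof -
    have e: "cdf2 m x = (\<integral>t. u t \<partial>m)"
      if "fin_borel m" "AE t in m. t \<in> K" "u \<in> borel_measurable borel" "\<And>t. t \<in> K \<Longrightarrow> up t x = u t" for m u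
      unfolding cdf2_def by (rule AE_integral_cong) (use that in auto)
    consider "fst x < 0 \<or> snd x < 0" | "1 < fst x" | "1 < snd x"
      using \<open>x \<notin> K\<close> by (auto simp: K_def mem_Times_iff not_le)
    then show ?thesis
    proof cases
      case 1
      have "cdf2 m x = (\<integral>t. 0 \<partial>m)" if "fin_borel m" "AE t in m. t \<in> K" for m
        by (rule e[OF that]) (use 1 in \<open>auto simp: up_def K_def\<close>)
      then show ?thesis using fin supp by simp
    next
      case 2
      have "cdf2 m x = (\<integral>t. (if snd t \<le> snd x then 1 else 0) \<partial>m)" if "fin_borel m" "AE t in m. t \<in> K" for m
        by (rule e[OF that]) (use 2 in \<open>auto simp: up_def K_def\<close>)
      then show ?thesis using fin supp half[of snd "snd x"] by simp
    next
      case 3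
      have "cdf2 m x = (\<integral>t. (if fst t \<le> fst x then 1 else 0) \<partial>m)" if "fin_borel m" "AE t in m. t \<in> K" for m
        by (rule e[OF that]) (use 3 in \<open>auto simp: up_def K_def\<close>)
      then show ?thesis using fin supp half[of fst "fst x"] by simp
    qed
  qed
qed

end

text \<open>
  As f vanishes off K, its integral over every box off K is zero. For a box \<open>[a, b] \<times> [2, 3]\<close> this
  says that the first marginal annihilates the ramp of \<open>[a, b]\<close>.
\<close>

lemma M_DD0_marginal_free:
  assumes f: "f \<in> M_DD0" and rep: "represented_by (D_D f) \<alpha> \<beta>"
    and supp: "AE t in \<alpha>. t \<in> K" "AE t in \<beta>. t \<in> K"
  shows "marginal_free \<alpha> \<beta>"
proof
  show fin: "fin_borel \<alpha>" "fin_borel \<beta>" using rep by (auto simp: represented_by_def)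
  note loc = locally_integrable_box[OF cdf2_locally_integrable[OF fin]]
  have box0: "dint \<alpha> \<beta> (\<lambda>t. ramp a b (fst t) * ramp c d (snd t)) = 0"
    if ab: "a \<le> b" "c \<le> d" and sub: "cbox (a, c) (b, d) \<subseteq> - K" for a b c d
  proof -
    have "0 = (\<integral>x. (cdf2 \<alpha> x - cdf2 \<beta> x) * bump (a, c) (b, d) j x \<partial>lborel)" for j
      using M_DD0_cdf2[OF f rep supp test_functions_UNIV[OF bump_test[OF sub]]] bump_test[OF sub] f
      by (simp add: M_DD0_def)
    then have "(\<lambda>j. 0) \<longlonglongrightarrow> (\<integral>x. indicator (cbox (a, c) (b, d)) x * (cdf2 \<alpha> x - cdf2 \<beta> x) \<partial>lborel)"
      using bump_lborel_tendsto[OF loc(1) loc(2), of "(a, c)" "(b, d)"] by simp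
    then have "(\<integral>x. indicator (cbox (a, c) (b, d)) x * (cdf2 \<alpha> x - cdf2 \<beta> x) \<partial>lborel) = 0"
      using LIMSEQ_unique tendsto_const by blast
    then show ?thesis by (simp add: dint_box fin ab)
  qed
  have cong: "dint \<alpha> \<beta> u = dint \<alpha> \<beta> v"
    if "u \<in> borel_measurable borel" "v \<in> borel_measurable borel" "\<And>t. t \<in> K \<Longrightarrow> u t = v t" for u v
    using AE_integral_cong[OF fin(1) supp(1) that] AE_integral_cong[OF fin(2) supp(2) that]
    by (simp add: dint_def)
  fix a b :: real assume "a \<le> b"
  \<comment> \<open>On \<open>K\<close> the ramp of \<open>[2, 3]\<close> is constantly \<open>1\<close>.\<close>
  have "dint \<alpha> \<beta> (\<lambda>t. ramp a b (fst t)) = dint \<alpha> \<beta> (\<lambda>t. ramp a b (fst t) * ramp 2 3 (snd t))"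
    by (rule cong) (auto simp: K_def ramp_def[of 2])
  also have "\<dots> = 0" using \<open>a \<le> b\<close> by (intro box0) (auto simp: K_def)
  finally show "dint \<alpha> \<beta> (\<lambda>t. ramp a b (fst t)) = 0" .
  have "dint \<alpha> \<beta> (\<lambda>t. ramp a b (snd t)) = dint \<alpha> \<beta> (\<lambda>t. ramp 2 3 (fst t) * ramp a b (snd t))"
    by (rule cong) (auto simp: K_def ramp_def[of 2])
  also have "\<dots> = 0" using \<open>a \<le> b\<close> by (intro box0) (auto simp: K_def)
  finally show "dint \<alpha> \<beta> (\<lambda>t. ramp a b (snd t)) = 0" .
qed (fact supp)+

section \<open>First derivatives as swept measures\<close>

text \<open>
  Each point mass of \<alpha> is spread uniformly, with density 1, along the segment that runs from it to the
  right side of the unit square (\<open>p = id\<close>) or to its upper side (\<open>p = prod.swap\<close>). The first case occurs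
  for the derivative in the second variable, the second case for the one in the first. The parameter p treats both at once.
\<close>

definition sweep :: "(plane \<Rightarrow> plane) \<Rightarrow> plane measure \<Rightarrow> plane measure" where
  "sweep p \<alpha> = distr (density (\<alpha> \<Otimes>\<^sub>M lborel)
     (\<lambda>z. ennreal (if fst (p (fst z)) \<le> snd z then indicator {0..1} (snd z) else 0)))
     borel (\<lambda>z. p (snd z, snd (p (fst z))))"

lemma pair_measurable_plane [measurable (raw)]:
  "f \<in> borel_measurable M \<Longrightarrow> g \<in> borel_measurable M \<Longrightarrow> (\<lambda>x. (f x, g x) :: plane) \<in> borel_measurable M"
  unfolding borel_prod[symmetric] by measurable

lemma strip_integrable:
  assumes "fin_borel \<alpha>" and F: "F \<in> borel_measurable (borel \<Otimes>\<^sub>M borel)"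
    and B: "\<And>z. \<bar>F z\<bar> \<le> B" "\<And>z. snd z \<notin> {0..1} \<Longrightarrow> F z = 0"
  shows "integrable (\<alpha> \<Otimes>\<^sub>M (lborel :: real measure)) (F :: plane \<times> real \<Rightarrow> real)"
proof -
  note fin_borelD(2)[OF assms(1), measurable_cong]
  interpret finite_measure \<alpha> using fin_borelD(1)[OF assms(1)] .
  have sp: "space \<alpha> = UNIV" by (rule fin_borelD[OF assms(1)])
  show ?thesis
  proof (rule integrableI_bounded_set[where A="UNIV \<times> {0..1}" and B=B])
    show "UNIV \<times> {0..1::real} \<in> sets (\<alpha> \<Otimes>\<^sub>M lborel)" using sp by (metis pair_measureI sets.top sets_lborel atLeastAtMost_borel)
    have "emeasure (\<alpha> \<Otimes>\<^sub>M lborel) (UNIV \<times> {0..1::real}) = emeasure \<alpha> UNIV * emeasure lborel {0..1::real}"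
      using sp by (intro lborel.emeasure_pair_measure_Times) (metis sets.top, simp)
    then show "emeasure (\<alpha> \<Otimes>\<^sub>M lborel) (UNIV \<times> {0..1::real}) < \<infinity>"
      using emeasure_finite[of UNIV] by (simp add: less_top[symmetric])
    show "F \<in> borel_measurable (\<alpha> \<Otimes>\<^sub>M lborel)" using F by measurable
    have "x \<notin> UNIV \<times> {0..1} \<Longrightarrow> F x = 0" for x
      using B(2)[of x] by (cases x) auto
    then show "AE x in \<alpha> \<Otimes>\<^sub>M lborel. x \<notin> UNIV \<times> {0..1} \<longrightarrow> F x = 0" by blast
  qed (use B in auto)
qed

lemma sweep_fin_borel:
  assumes \<alpha>: "fin_borel \<alpha>" and p[measurable]: "p \<in> measurable borel borel"
  shows "fin_borel (sweep p \<alpha>)"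
proof -
  note fin_borelD(2)[OF \<alpha>, measurable_cong]
  interpret finite_measure \<alpha> using fin_borelD(1)[OF \<alpha>] .
  have sp: "space \<alpha> = UNIV" by (rule fin_borelD[OF \<alpha>])
  let ?w = "\<lambda>z :: plane \<times> real. if fst (p (fst z)) \<le> snd z then indicator {0..1} (snd z) else (0::real)"
  let ?D = "density (\<alpha> \<Otimes>\<^sub>M lborel) (\<lambda>z. ennreal (?w z))"
  have "emeasure (sweep p \<alpha>) UNIV = emeasure ?D (space ?D)"
    unfolding sweep_def by (subst emeasure_distr) auto
  also have "\<dots> = (\<integral>\<^sup>+z. ennreal (?w z) * indicator (space ?D) z \<partial>(\<alpha> \<Otimes>\<^sub>M lborel))"
  proof (rule emeasure_density)
    show "space ?D \<in> sets (\<alpha> \<Otimes>\<^sub>M lborel)"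
      using sets.top[of "\<alpha> \<Otimes>\<^sub>M lborel"] by (simp only: space_density)
  qed measurable
  also have "\<dots> = (\<integral>\<^sup>+z. ennreal (?w z) \<partial>(\<alpha> \<Otimes>\<^sub>M lborel))"
    by (intro nn_integral_cong) simp
  also have "\<dots> = (\<integral>\<^sup>+t. (\<integral>\<^sup>+s. ennreal (?w (t, s)) \<partial>lborel) \<partial>\<alpha>)"
    by (rule lborel.nn_integral_fst[symmetric]) measurable
  also have "\<dots> \<le> (\<integral>\<^sup>+t. 1 \<partial>\<alpha>)"
  proof (rule nn_integral_mono)
    fix t
    have "(\<integral>\<^sup>+s. ennreal (?w (t, s)) \<partial>lborel) \<le> (\<integral>\<^sup>+s. indicator {0..1} s \<partial>(lborel :: real measure))"
      by (intro nn_integral_mono) (auto simp: indicator_def)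
    then show "(\<integral>\<^sup>+s. ennreal (?w (t, s)) \<partial>lborel) \<le> 1" by simp
  qed
  also have "\<dots> < \<infinity>" using emeasure_finite[of UNIV] sp by (simp add: less_top[symmetric])
  finally show ?thesis
    unfolding fin_borel_def by (auto intro!: finite_measureI simp: sweep_def)
qed

lemma sweep_integral:
  assumes \<alpha>: "fin_borel \<alpha>" and p[measurable]: "p \<in> measurable borel borel"
    and u[measurable]: "u \<in> borel_measurable borel" and B: "\<And>x. \<bar>u x\<bar> \<le> (B::real)"
  shows "(\<integral>x. u x \<partial>sweep p \<alpha>) =
    (\<integral>t. (\<integral>s. (if fst (p t) \<le> s then indicator {0..1} s else 0) * u (p (s, snd (p t))) \<partial>lborel) \<partial>\<alpha>)"
proof -
  note fin_borelD(2)[OF \<alpha>, measurable_cong]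
  interpret finite_measure \<alpha> using fin_borelD(1)[OF \<alpha>] .
  interpret pair_sigma_finite \<alpha> "lborel :: real measure" ..
  let ?w = "\<lambda>z :: plane \<times> real. if fst (p (fst z)) \<le> snd z then indicator {0..1} (snd z) else (0::real)"
  have B0: "0 \<le> B" using B[of undefined] by linarith
  have i: "integrable (\<alpha> \<Otimes>\<^sub>M lborel) (\<lambda>z. ?w z * u (p (snd z, snd (p (fst z)))))"
    by (rule strip_integrable[OF \<alpha>, where B=B]) (use B B0 in \<open>auto simp: indicator_def\<close>)
  have "(\<integral>x. u x \<partial>sweep p \<alpha>) = (\<integral>z. ?w z * u (p (snd z, snd (p (fst z)))) \<partial>(\<alpha> \<Otimes>\<^sub>M lborel))"
    unfolding sweep_def by (subst integral_distr) (auto simp: integral_density)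
  also have "\<dots> = (\<integral>t. (\<integral>s. ?w (t, s) * u (p (snd (t, s), snd (p (fst (t, s))))) \<partial>lborel) \<partial>\<alpha>)"
    by (rule integral_fst'[OF i, symmetric])
  finally show ?thesis by (simp cong: if_cong)
qed

text \<open>
  Fubini and the fundamental theorem in the variable of the derivative: the quadrant integral of
  \<open>\<partial>\<^sub>2\<phi>\<close> is minus the integral of \<phi> along the lower side of the quadrant. In the other variable the integrand
  may first be cut off at the sides of K because the distribution function vanishes off K, and this keeps the
  swept measures finite.
\<close>

lemma gradient_represented:
  assumes f: "f \<in> M_DD0" and rep: "represented_by (D_D f) \<alpha> \<beta>" "AE t in \<alpha>. t \<in> K" "AE t in \<beta>. t \<in> K"
  shows "represented_by (I_D f) (sweep id \<alpha>) (sweep id \<beta>)"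
    and "represented_by (D_I f) (sweep prod.swap \<alpha>) (sweep prod.swap \<beta>)"
proof -
  interpret marginal_free \<alpha> \<beta> by (rule M_DD0_marginal_free[OF f rep])
  have swap[measurable]: "(prod.swap :: plane \<Rightarrow> plane) \<in> borel_measurable borel"
    by (intro borel_measurable_continuous_onI) (auto simp: prod.swap_def intro!: continuous_intros)
  have idm: "(id :: plane \<Rightarrow> plane) \<in> borel_measurable borel" by (simp add: id_def)
  have dens: "x \<notin> K \<Longrightarrow> cdf2 \<alpha> x - cdf2 \<beta> x = 0" for x using cdf2_eq_outside by simp
  have fub: "(\<integral>x. (cdf2 \<alpha> x - cdf2 \<beta> x) * \<psi> x \<partial>lborel)
      = (\<integral>t. (\<integral>x. up t x * \<psi> x \<partial>lborel) \<partial>\<alpha>) - (\<integral>t. (\<integral>x. up t x * \<psi> x \<partial>lborel) \<partial>\<beta>)"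
    if i: "integrable lborel \<psi>" for \<psi>
  proof -
    have "(\<integral>x. (cdf2 \<alpha> x - cdf2 \<beta> x) * \<psi> x \<partial>lborel) = (\<integral>x. cdf2 \<alpha> x * \<psi> x - cdf2 \<beta> x * \<psi> x \<partial>lborel)"
      by (simp add: left_diff_distrib)
    also have "\<dots> = (\<integral>x. cdf2 \<alpha> x * \<psi> x \<partial>lborel) - (\<integral>x. cdf2 \<beta> x * \<psi> x \<partial>lborel)"
      by (intro Bochner_Integration.integral_diff test_mult_cdf2_integrable fin i)
    finally show ?thesis by (simp add: cdf2_fubini fin i)
  qed
  have derivative: "f D = - ((\<integral>x. \<phi> x \<partial>sweep p \<alpha>) - (\<integral>x. \<phi> x \<partial>sweep p \<beta>))"
    if \<phi>: "\<phi> \<in> test_functions UNIV" and D: "D \<in> test_functions UNIV"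
      and p[measurable]: "p \<in> borel_measurable borel" and pp: "\<And>x. p (p x) = x"
      and pK: "\<And>x. x \<in> K \<Longrightarrow> fst (p x) \<in> {0..1}"
      and up: "\<And>t s u. up t (p (s, u)) = (if fst (p t) \<le> s \<and> snd (p t) \<le> u then 1 else 0)"
      and fubini: "\<And>g :: plane \<Rightarrow> real. integrable lborel g \<Longrightarrow> (\<integral>x. g x \<partial>lborel) = (\<integral>s. (\<integral>u. g (p (s, u)) \<partial>lborel) \<partial>lborel)"
      and ftc: "\<And>s a. (\<integral>u. (if a \<le> u then D (p (s, u)) else 0) \<partial>lborel) = - \<phi> (p (s, a))"
    for \<phi> D p
  proof -
    obtain B where B: "\<And>x. \<bar>\<phi> x\<bar> \<le> B" using test_function_bounded[OF \<phi>] by blast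
    let ?\<psi> = "\<lambda>x. indicator {0..1} (fst (p x)) * D x"
    have i: "integrable lborel ?\<psi>"
      by (rule integrable_mult_bounded[OF test_function_integrable[OF D], of _ 1]) auto
    have "(cdf2 \<alpha> x - cdf2 \<beta> x) * D x = (cdf2 \<alpha> x - cdf2 \<beta> x) * ?\<psi> x" for x
      using dens[of x] pK[of x] by (cases "x \<in> K") auto
    then have "f D = (\<integral>x. (cdf2 \<alpha> x - cdf2 \<beta> x) * ?\<psi> x \<partial>lborel)"
      unfolding M_DD0_cdf2[OF f rep D] by (simp only:)
    moreover have "(\<integral>x. up t x * ?\<psi> x \<partial>lborel)
        = - (\<integral>s. (if fst (p t) \<le> s then indicator {0..1} s else 0) * \<phi> (p (s, snd (p t))) \<partial>lborel)" for t
    proof -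
      have i': "integrable lborel (\<lambda>x. up t x * ?\<psi> x)"
        by (rule integrable_mult_bounded[OF i, of _ 1]) (auto simp: up_bound)
      have "up t (p (s, u)) * ?\<psi> (p (s, u))
          = (if fst (p t) \<le> s then indicator {0..1} s else 0) * (if snd (p t) \<le> u then D (p (s, u)) else 0)" for s u
        by (simp add: up pp)
      then show ?thesis unfolding fubini[OF i'] by (simp add: ftc)
    qed
    ultimately show ?thesis
      by (simp add: fub[OF i] fin sweep_integral[OF _ p smooth_measurable[OF test_functionsD(1)[OF \<phi>]] B])
  qed
  have main: "f (partial2 \<phi>) = - ((\<integral>x. \<phi> x \<partial>sweep id \<alpha>) - (\<integral>x. \<phi> x \<partial>sweep id \<beta>))"
      "f (partial1 \<phi>) = - ((\<integral>x. \<phi> x \<partial>sweep prod.swap \<alpha>) - (\<integral>x. \<phi> x \<partial>sweep prod.swap \<beta>))"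
    if \<phi>: "\<phi> \<in> test_functions UNIV" for \<phi>
  proof -
    show "f (partial2 \<phi>) = - ((\<integral>x. \<phi> x \<partial>sweep id \<alpha>) - (\<integral>x. \<phi> x \<partial>sweep id \<beta>))"
      by (rule derivative[OF \<phi> test_function_partial(2)[OF \<phi>] idm])
        (simp_all add: K_def mem_Times_iff up_def ftc_lines(2)[OF \<phi>] plane_fubini(1) cong: if_cong)
    show "f (partial1 \<phi>) = - ((\<integral>x. \<phi> x \<partial>sweep prod.swap \<alpha>) - (\<integral>x. \<phi> x \<partial>sweep prod.swap \<beta>))"
      by (rule derivative[OF \<phi> test_function_partial(1)[OF \<phi>] swap])
        (simp_all add: K_def mem_Times_iff up_def ftc_lines(1)[OF \<phi>] plane_fubini(2) conj_commute cong: if_cong)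
  qed
  show "represented_by (I_D f) (sweep id \<alpha>) (sweep id \<beta>)"
    using main sweep_fin_borel[OF _ idm] fin by (auto simp: represented_by_def I_D_def)
  show "represented_by (D_I f) (sweep prod.swap \<alpha>) (sweep prod.swap \<beta>)"
    using main sweep_fin_borel[OF _ swap] fin by (auto simp: represented_by_def D_I_def)
qed

section \<open>Averaging does not increase the norm\<close>

text \<open>
  The map \<open>\<alpha> \<mapsto> \<Sum>\<^sub>j (\<integral>w\<^sub>j d\<alpha>) L\<^sub>j\<close> is positive and does not increase mass. Its effect on T does not
  depend on the representation, so that it may be computed from a convenient one, while the norm
  is estimated from an optimal one.
\<close>

lemma averaging_contraction:
  assumes T: "represented_by T \<alpha> \<beta>" and J: "finite J"
    and w: "\<And>j. j \<in> J \<Longrightarrow> w j \<in> borel_measurable borel" "\<And>j t. j \<in> J \<Longrightarrow> 0 \<le> w j t" "\<And>t. (\<Sum>j\<in>J. w j t) \<le> 1"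
    and L: "\<And>j. j \<in> J \<Longrightarrow> fin_borel (L j)" "\<And>j. j \<in> J \<Longrightarrow> measure (L j) UNIV \<le> 1"
    and T': "T' \<in> extensional (test_functions UNIV)"
      "\<And>\<phi>. \<phi> \<in> test_functions UNIV \<Longrightarrow> T' \<phi> = (\<Sum>j\<in>J. dint \<alpha> \<beta> (w j) * (\<integral>x. \<phi> x \<partial>L j))"
  shows "represented_by T' (mixture J (\<lambda>j. \<integral>t. w j t \<partial>\<alpha>) L) (mixture J (\<lambda>j. \<integral>t. w j t \<partial>\<beta>) L)"
    and "M_norm T' \<le> M_norm T"
proof -
  have w1: "\<bar>w j t\<bar> \<le> 1" if "j \<in> J" for j t
  proof -
    have "w j t \<le> (\<Sum>j\<in>J. w j t)" using that w(2) J by (intro member_le_sum) auto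
    then show ?thesis using w(2)[OF that, of t] w(3)[of t] by linarith
  qed
  have nn: "0 \<le> (\<integral>t. w j t \<partial>m)" if "j \<in> J" for j m
    using that w(2) by (intro integral_nonneg_AE) auto
  have rep: "represented_by T' (mixture J (\<lambda>j. \<integral>t. w j t \<partial>\<gamma>) L) (mixture J (\<lambda>j. \<integral>t. w j t \<partial>\<delta>) L)"
    if T2: "represented_by T \<gamma> \<delta>" for \<gamma> \<delta>
  proof -
    have fin: "fin_borel \<alpha>" "fin_borel \<beta>" "fin_borel \<gamma>" "fin_borel \<delta>"
      using T T2 by (auto simp: represented_by_def)
    have d: "dint \<alpha> \<beta> (w j) = dint \<gamma> \<delta> (w j)" if "j \<in> J" for j
      unfolding dint_def
      using integral_eq_of_measure_diff_eq[OF fin represented_by_unique[OF T T2] w(1)[OF that] w1[OF that]] .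
    have "T' \<phi> = (\<integral>x. \<phi> x \<partial>mixture J (\<lambda>j. \<integral>t. w j t \<partial>\<gamma>) L) - (\<integral>x. \<phi> x \<partial>mixture J (\<lambda>j. \<integral>t. w j t \<partial>\<delta>) L)"
      if \<phi>: "\<phi> \<in> test_functions UNIV" for \<phi>
    proof -
      obtain B where B: "\<And>x. \<bar>\<phi> x\<bar> \<le> B" using test_function_bounded[OF \<phi>] by blast
      note m = smooth_measurable[OF test_functionsD(1)[OF \<phi>]]
      show ?thesis
        by (simp add: T'(2)[OF \<phi>] integral_mixture[OF J nn L(1) m B] d)
          (simp add: dint_def left_diff_distrib sum_subtractf)
    qed
    then show ?thesis
      using T'(1) fin_borel_mixture[OF J L(1)] by (simp add: represented_by_def)
  qed
  show "represented_by T' (mixture J (\<lambda>j. \<integral>t. w j t \<partial>\<alpha>) L) (mixture J (\<lambda>j. \<integral>t. w j t \<partial>\<beta>) L)"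
    by (rule rep[OF T])
  obtain \<gamma> \<delta> where \<gamma>\<delta>: "represented_by T \<gamma> \<delta>" "M_norm T = measure \<gamma> UNIV + measure \<delta> UNIV"
    using M_norm_attained[OF T] by blast
  have le: "measure (mixture J (\<lambda>j. \<integral>t. w j t \<partial>m) L) UNIV \<le> measure m UNIV" if m: "fin_borel m" for m
  proof -
    interpret finite_measure m using fin_borelD(1)[OF m] .
    have iw: "integrable m (w j)" if "j \<in> J" for j
      by (rule fin_borel_integral(1)[OF m w(1)[OF that] w1[OF that]])
    have "measure (mixture J (\<lambda>j. \<integral>t. w j t \<partial>m) L) UNIV = (\<Sum>j\<in>J. (\<integral>t. w j t \<partial>m) * measure (L j) UNIV)"
      by (rule measure_mixture[OF J nn L(1)]) auto
    also have "\<dots> \<le> (\<Sum>j\<in>J. (\<integral>t. w j t \<partial>m) * 1)"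
      using nn L(2) by (intro sum_mono mult_left_mono) auto
    also have "\<dots> = (\<integral>t. (\<Sum>j\<in>J. w j t) \<partial>m)"
      using iw by simp
    also have "\<dots> \<le> (\<integral>t. 1 \<partial>m)"
      using iw w(3) by (intro integral_mono) auto
    finally show ?thesis using fin_borelD(3)[OF m] by simp
  qed
  show "M_norm T' \<le> M_norm T"
    using M_norm_le[OF rep[OF \<gamma>\<delta>(1)]] le[of \<gamma>] le[of \<delta>] \<gamma>\<delta> by (simp add: represented_by_def)
qed

section \<open>Dyadic cells and hat functions\<close>

text \<open>
  The fraction of the cell \<open>[(l - 1)/2\<^sup>n, l/2\<^sup>n]\<close> to the right of t, that is, the mean over this cell of
  the unit step at t.
\<close>

definition cell_right :: "nat \<Rightarrow> nat \<Rightarrow> real \<Rightarrow> real" where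
  "cell_right n l t = max 0 (min 1 (real l - 2 ^ n * t))"

text \<open>
  The piecewise linear function with value 1 at \<open>l/2\<^sup>n\<close> and 0 at the other multiples of \<open>2\<^sup>-\<^sup>n\<close>. Written
  as a difference, it is nonnegative by monotonicity, the hats sum up by telescoping, and
  they arise from summation by parts.
\<close>

definition hat :: "nat \<Rightarrow> nat \<Rightarrow> real \<Rightarrow> real" where
  "hat n l t = cell_right n (Suc l) t - cell_right n l t"

abbreviation cell :: "nat \<Rightarrow> nat \<Rightarrow> real set" where
  "cell n k \<equiv> {(real k - 1) / 2 ^ n..real k / 2 ^ n}"

lemma cell_right_bounds: "0 \<le> cell_right n l t" "cell_right n l t \<le> 1" "\<bar>cell_right n l t\<bar> \<le> 1"
  by (auto simp: cell_right_def)

lemma hat_bounds: "0 \<le> hat n l t" "hat n l t \<le> 1" "\<bar>hat n l t\<bar> \<le> 1"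
  by (auto simp: hat_def cell_right_def)

lemma cell_right_measurable [measurable]:
  assumes [measurable]: "f \<in> borel_measurable M"
  shows "(\<lambda>x. cell_right n l (f x)) \<in> borel_measurable M"
  unfolding cell_right_def by measurable

lemma hat_measurable [measurable]:
  assumes [measurable]: "f \<in> borel_measurable M"
  shows "(\<lambda>x. hat n l (f x)) \<in> borel_measurable M"
  unfolding hat_def by measurable

lemma sum_hat: "(\<Sum>l\<le>m. hat n l t) = cell_right n (Suc m) t - cell_right n 0 t"
  by (induction m) (simp_all add: hat_def)

lemma sum_hat_le_1: "(\<Sum>l\<le>m. hat n l t) \<le> 1"
  using cell_right_bounds[of n 0 t] cell_right_bounds[of n "Suc m" t] by (simp add: sum_hat)

lemma cell_right_ramp: "cell_right n l t = 2 ^ n * ramp ((real l - 1) / 2 ^ n) (real l / 2 ^ n) t"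
proof -
  have "2 ^ n * ramp ((real l - 1) / 2 ^ n) (real l / 2 ^ n) t
      = max (2 ^ n * 0) (2 ^ n * (real l / 2 ^ n) - 2 ^ n * max ((real l - 1) / 2 ^ n) t)"
    unfolding ramp_def by (subst max_mult_distrib_left) (simp add: right_diff_distrib)
  also have "2 ^ n * max ((real l - 1) / 2 ^ n) t = max (2 ^ n * ((real l - 1) / 2 ^ n)) (2 ^ n * t)"
    by (simp only: max_mult_distrib_left) simp
  also have "2 ^ n * ((real l - 1) / 2 ^ n) = real l - 1" by simp
  finally show ?thesis by (auto simp: cell_right_def)
qed

lemma abel_summation:
  fixes s v :: "nat \<Rightarrow> real"
  shows "(\<Sum>l\<le>m. (s (Suc l) - s l) * v l) = s (Suc m) * v m - s 0 * v 0 - (\<Sum>l=1..m. s l * (v l - v (l - 1)))"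
  by (induction m) (simp_all add: algebra_simps)

lemma abel_summation_0:
  fixes s v :: "nat \<Rightarrow> real"
  assumes "s 0 = 0" "s (Suc m) = 0"
  shows "(\<Sum>l=1..m. s l * (v l - v (l - 1))) = - (\<Sum>l\<le>m. (s (Suc l) - s l) * v l)"
  using abel_summation[of s v m] assms by simp

text \<open>
  The mean over the pixel \<open>(k, l)\<close> of the distribution function of \<open>\<alpha> - \<beta>\<close> (\<open>moment_pixel\<close>).
\<close>

definition moment :: "plane measure \<Rightarrow> plane measure \<Rightarrow> nat \<Rightarrow> nat \<Rightarrow> nat \<Rightarrow> real" where
  "moment \<alpha> \<beta> n k l = dint \<alpha> \<beta> (\<lambda>t. cell_right n k (fst t) * cell_right n l (snd t))"

context marginal_free
begin

lemma dint_diff: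
  assumes "u \<in> borel_measurable borel" "\<And>x. \<bar>u x\<bar> \<le> (B::real)" "v \<in> borel_measurable borel" "\<And>x. \<bar>v x\<bar> \<le> (C::real)"
  shows "dint \<alpha> \<beta> (\<lambda>t. u t - v t) = dint \<alpha> \<beta> u - dint \<alpha> \<beta> v"
  using fin_borel_integral(1)[OF fin(1) assms(1,2)] fin_borel_integral(1)[OF fin(2) assms(1,2)]
    fin_borel_integral(1)[OF fin(1) assms(3,4)] fin_borel_integral(1)[OF fin(2) assms(3,4)]
  by (simp add: dint_def)

lemma dint_cmult: "dint \<alpha> \<beta> (\<lambda>t. c * u t) = c * dint \<alpha> \<beta> u"
  by (simp add: dint_def right_diff_distrib)

text \<open>
  The fictitious pixels next to the unit square lie where the distribution function vanishes; these
  are the boundary conditions for summation by parts.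
\<close>

lemma moment_boundary:
  "moment \<alpha> \<beta> n 0 l = 0" "moment \<alpha> \<beta> n k 0 = 0"
  "moment \<alpha> \<beta> n (Suc (2 ^ n)) l = 0" "moment \<alpha> \<beta> n k (Suc (2 ^ n)) = 0"
proof -
  have z: "cell_right n 0 s = 0" "cell_right n (Suc (2 ^ n)) s = 1" if "0 \<le> s" "s \<le> 1" for s
  proof -
    define y where "y = 2 ^ n * s"
    have "0 \<le> y" "y \<le> 2 ^ n" using that mult_left_le[of s "2 ^ n"] by (simp_all add: y_def)
    then show "cell_right n 0 s = 0" "cell_right n (Suc (2 ^ n)) s = 1"
      unfolding cell_right_def y_def[symmetric] by (auto simp: max_def min_def)
  qed
  have d: "dint \<alpha> \<beta> (\<lambda>t. cell_right n l (fst t)) = 0" "dint \<alpha> \<beta> (\<lambda>t. cell_right n l (snd t)) = 0" for l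
    by (simp_all add: cell_right_ramp dint_cmult dint_ramp divide_right_mono)
  have 0: "dint \<alpha> \<beta> (\<lambda>t. 0) = 0" by (simp add: dint_def)
  have "moment \<alpha> \<beta> n 0 l = dint \<alpha> \<beta> (\<lambda>t. 0)" "moment \<alpha> \<beta> n k 0 = dint \<alpha> \<beta> (\<lambda>t. 0)"
    unfolding moment_def by (rule dint_cong; auto simp: K_def z)+
  then show "moment \<alpha> \<beta> n 0 l = 0" "moment \<alpha> \<beta> n k 0 = 0" by (simp_all add: 0)
  have "moment \<alpha> \<beta> n (Suc (2 ^ n)) l = dint \<alpha> \<beta> (\<lambda>t. cell_right n l (snd t))"
    "moment \<alpha> \<beta> n k (Suc (2 ^ n)) = dint \<alpha> \<beta> (\<lambda>t. cell_right n k (fst t))"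
    unfolding moment_def by (rule dint_cong; auto simp: K_def z simp del: of_nat_Suc power_Suc)+
  then show "moment \<alpha> \<beta> n (Suc (2 ^ n)) l = 0" "moment \<alpha> \<beta> n k (Suc (2 ^ n)) = 0"
    by (simp_all add: d)
qed

lemma dint_cell_hat:
  "dint \<alpha> \<beta> (\<lambda>t. cell_right n k (fst t) * hat n l (snd t)) = moment \<alpha> \<beta> n k (Suc l) - moment \<alpha> \<beta> n k l"
  "dint \<alpha> \<beta> (\<lambda>t. hat n k (fst t) * cell_right n l (snd t)) = moment \<alpha> \<beta> n (Suc k) l - moment \<alpha> \<beta> n k l"
  "dint \<alpha> \<beta> (\<lambda>t. hat n k (fst t) * hat n l (snd t))
    = (moment \<alpha> \<beta> n (Suc k) (Suc l) - moment \<alpha> \<beta> n k (Suc l)) - (moment \<alpha> \<beta> n (Suc k) l - moment \<alpha> \<beta> n k l)"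
proof -
  have m: "(\<lambda>t::plane. cell_right n k (fst t) * cell_right n l (snd t)) \<in> borel_measurable borel"
    "(\<lambda>t::plane. hat n k (fst t) * cell_right n l (snd t)) \<in> borel_measurable borel" for k l
    by measurable
  have b: "\<bar>cell_right n k s * cell_right n l t\<bar> \<le> 1" "\<bar>hat n k s * cell_right n l t\<bar> \<le> 1" for k l s t
    by (auto simp: abs_mult intro!: mult_le_one cell_right_bounds hat_bounds)
  show 1: "dint \<alpha> \<beta> (\<lambda>t. cell_right n k (fst t) * hat n l (snd t)) = moment \<alpha> \<beta> n k (Suc l) - moment \<alpha> \<beta> n k l" for k l
    unfolding moment_def by (subst dint_diff[symmetric, OF m(1) b(1) m(1) b(1)]) (simp add: hat_def right_diff_distrib)
  show 2: "dint \<alpha> \<beta> (\<lambda>t. hat n k (fst t) * cell_right n l (snd t)) = moment \<alpha> \<beta> n (Suc k) l - moment \<alpha> \<beta> n k l" for k l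
    unfolding moment_def by (subst dint_diff[symmetric, OF m(1) b(1) m(1) b(1)]) (simp add: hat_def left_diff_distrib)
  show "dint \<alpha> \<beta> (\<lambda>t. hat n k (fst t) * hat n l (snd t))
    = (moment \<alpha> \<beta> n (Suc k) (Suc l) - moment \<alpha> \<beta> n k (Suc l)) - (moment \<alpha> \<beta> n (Suc k) l - moment \<alpha> \<beta> n k l)"
    unfolding 2[symmetric]
    by (subst dint_diff[symmetric, OF m(2) b(2) m(2) b(2)]) (simp add: hat_def right_diff_distrib)
qed

lemma moment_pixel:
  "moment \<alpha> \<beta> n k l = 4 ^ n * (\<integral>x. indicator (pixel n (k, l)) x * (cdf2 \<alpha> x - cdf2 \<beta> x) \<partial>lborel)"
proof -
  have "pixel n (k, l) = cbox ((real k - 1) / 2 ^ n, (real l - 1) / 2 ^ n) (real k / 2 ^ n, real l / 2 ^ n)"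
    by (simp add: pixel_def cbox_Pair_eq)
  moreover have "moment \<alpha> \<beta> n k l = dint \<alpha> \<beta> (\<lambda>t. (2 ^ n * 2 ^ n) * (ramp ((real k - 1) / 2 ^ n) (real k / 2 ^ n) (fst t)
      * ramp ((real l - 1) / 2 ^ n) (real l / 2 ^ n) (snd t)))"
    unfolding moment_def cell_right_ramp by (simp add: mult_ac)
  moreover have "2 ^ n * 2 ^ n = (4 ^ n :: real)" by (simp add: power_mult_distrib[symmetric])
  ultimately show ?thesis by (simp add: dint_cmult dint_box fin divide_right_mono)
qed

end

section \<open>Functions that are constant on pixels\<close>

definition pixel_fun :: "nat \<Rightarrow> (nat \<Rightarrow> nat \<Rightarrow> real) \<Rightarrow> plane \<Rightarrow> real" where
  "pixel_fun n c x = (\<Sum>k=1..2 ^ n. \<Sum>l=1..2 ^ n. c k l * indicator (pixel n (k, l)) x)"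

lemma pixel_cbox: "pixel n (k, l) = cbox ((real k - 1) / 2 ^ n, (real l - 1) / 2 ^ n) (real k / 2 ^ n, real l / 2 ^ n)"
  by (simp add: pixel_def cbox_Pair_eq)

lemma pixel_subset_K: "k \<in> {1..2 ^ n} \<Longrightarrow> l \<in> {1..2 ^ n} \<Longrightarrow> pixel n (k, l) \<subseteq> K"
proof -
  have *: "real k / 2 ^ n \<le> 1 \<and> 0 \<le> (real k - 1) / 2 ^ n" if "k \<in> {1..2 ^ n}" for k
  proof -
    have "real k \<le> real (2 ^ n)" using that by (simp only: of_nat_le_iff) simp
    then show ?thesis using that by simp
  qed
  assume "k \<in> {1..2 ^ n}" "l \<in> {1..2 ^ n}"
  from this[THEN *] show ?thesis
    unfolding pixel_def K_def prod.case by (intro Sigma_mono) (simp_all add: atLeastatMost_subset_iff)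
qed

lemma pixel_fun_measurable: "pixel_fun n c \<in> borel_measurable borel"
  unfolding pixel_fun_def[abs_def] pixel_cbox by measurable

lemma pixel_fun_outside: "x \<notin> K \<Longrightarrow> pixel_fun n c x = 0"
  unfolding pixel_fun_def using pixel_subset_K[of _ n]
  by (intro sum.neutral ballI) (auto simp: indicator_def)

lemma indicator_pixel_integrable: "integrable lborel (indicator (pixel n (k, l)) :: plane \<Rightarrow> real)"
  unfolding pixel_cbox by (intro integrable_real_indicator) (use emeasure_lborel_cbox_finite in auto)

lemma pixel_fun_integral:
  assumes g: "g \<in> borel_measurable borel" "\<And>x. \<bar>g x\<bar> \<le> B"
  shows "integrable lborel (\<lambda>x. pixel_fun n c x * g x)"
    and "(\<integral>x. pixel_fun n c x * g x \<partial>lborel) = (\<Sum>k=1..2 ^ n. \<Sum>l=1..2 ^ n. c k l * (\<integral>x. indicator (pixel n (k, l)) x * g x \<partial>lborel))"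
proof -
  have i: "integrable lborel (\<lambda>x. indicator (pixel n (k, l)) x * g x)" for k l
    using integrable_mult_bounded[OF indicator_pixel_integrable, of g B] g by (simp add: mult.commute)
  show "integrable lborel (\<lambda>x. pixel_fun n c x * g x)"
    unfolding pixel_fun_def sum_distrib_right mult.assoc
    by (intro Bochner_Integration.integrable_sum integrable_mult_right i)
  show "(\<integral>x. pixel_fun n c x * g x \<partial>lborel) = (\<Sum>k=1..2 ^ n. \<Sum>l=1..2 ^ n. c k l * (\<integral>x. indicator (pixel n (k, l)) x * g x \<partial>lborel))"
    unfolding pixel_fun_def sum_distrib_right mult.assoc
    using i by (simp add: Bochner_Integration.integral_sum)
qed

lemma pixel_fun_locally_integrable: "locally_integrable (pixel_fun n c)"
  unfolding locally_integrable_def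
proof (intro conjI allI impI pixel_fun_measurable)
  fix C :: "plane set" assume "compact C"
  then have "indicator C \<in> borel_measurable (borel :: plane measure)"
    by (intro borel_measurable_indicator) (simp add: borel_compact)
  then have "integrable lborel (\<lambda>x. pixel_fun n c x * indicator C x)"
    by (rule pixel_fun_integral(1)[where B=1]) auto
  then show "set_integrable lborel C (pixel_fun n c)" by (simp add: set_integrable_def mult.commute)
qed

lemma pixel_dist_apply:
  assumes "\<phi> \<in> test_functions UNIV"
  shows "dist_of_fun (pixel_fun n c) \<phi> = (\<Sum>k=1..2 ^ n. \<Sum>l=1..2 ^ n. c k l * (\<integral>x. indicator (pixel n (k, l)) x * \<phi> x \<partial>lborel))"
proof -
  obtain B where B: "\<And>x. \<bar>\<phi> x\<bar> \<le> B" using test_function_bounded[OF assms] by blast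
  show ?thesis
    using pixel_fun_integral(2)[OF smooth_measurable[OF test_functionsD(1)[OF assms]] B] assms
    by (simp add: dist_of_fun_def)
qed

lemma pixel_dist_distribution: "dist_of_fun (pixel_fun n c) \<in> distributions"
proof -
  let ?T = "dist_of_fun (pixel_fun n c)"
  have i: "integrable lborel (\<lambda>x. pixel_fun n c x * \<phi> x)" if \<phi>: "\<phi> \<in> test_functions UNIV" for \<phi>
  proof -
    obtain B where B: "\<And>x. \<bar>\<phi> x\<bar> \<le> B" using test_function_bounded[OF \<phi>] by blast
    show ?thesis by (rule pixel_fun_integral(1)[OF smooth_measurable[OF test_functionsD(1)[OF \<phi>]] B])
  qed
  have add: "?T (\<lambda>x. \<phi> x + \<psi> x) = ?T \<phi> + ?T \<psi>" if "\<phi> \<in> test_functions UNIV" "\<psi> \<in> test_functions UNIV" for \<phi> \<psi>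
    using that i by (simp add: dist_of_fun_def test_function_add distrib_left)
  have cmult: "?T (\<lambda>x. a * \<phi> x) = a * ?T \<phi>" if "\<phi> \<in> test_functions UNIV" for \<phi> a
    using that by (simp add: dist_of_fun_def test_function_cmult mult.left_commute)
  have pi: "integrable lborel (\<lambda>x. \<bar>pixel_fun n c x\<bar>)"
    using pixel_fun_integral(1)[of "\<lambda>_. 1" 1 n c] by (intro integrable_abs) simp
  have cont: "\<bar>?T \<phi>\<bar> \<le> (\<integral>x. \<bar>pixel_fun n c x\<bar> \<partial>lborel) * (\<Sum>i\<le>0. \<Sum>j\<le>0. SUP x. \<bar>(partial1 ^^ i) ((partial2 ^^ j) \<phi>) x\<bar>)"
    if \<phi>: "\<phi> \<in> test_functions UNIV" for \<phi>
  proof -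
    obtain B where B: "\<And>x. \<bar>\<phi> x\<bar> \<le> B" using test_function_bounded[OF \<phi>] by blast
    have le: "\<bar>\<phi> x\<bar> \<le> (SUP x. \<bar>\<phi> x\<bar>)" for x
      using B by (intro cSUP_upper) (auto simp: bdd_above_def)
    have "\<bar>?T \<phi>\<bar> \<le> (\<integral>x. \<bar>pixel_fun n c x * \<phi> x\<bar> \<partial>lborel)"
      using \<phi> by (simp add: dist_of_fun_def integral_abs_bound)
    also have "\<dots> \<le> (\<integral>x. \<bar>pixel_fun n c x\<bar> * (SUP x. \<bar>\<phi> x\<bar>) \<partial>lborel)"
      using le integrable_abs[OF i[OF \<phi>]] pi by (intro integral_mono) (auto simp: abs_mult intro!: mult_left_mono)
    finally show ?thesis using pi by simp
  qed
  have "?T \<in> extensional (test_functions UNIV)" by (simp add: dist_of_fun_def)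
  then show ?thesis
    unfolding distributions_def using add cmult cont by blast
qed

lemma pixel_dist_off_K:
  assumes "\<phi> \<in> test_functions (- K)"
  shows "dist_of_fun (pixel_fun n c) \<phi> = 0"
proof -
  have "(\<lambda>x. pixel_fun n c x * \<phi> x) = (\<lambda>_. 0)"
  proof
    fix x show "pixel_fun n c x * \<phi> x = 0"
    using pixel_fun_outside[of x n c] test_functionsD(3)[OF assms] test_functionsD(4)[OF assms, of x] by auto
  qed
  then show ?thesis using test_functions_UNIV[OF assms] by (simp add: dist_of_fun_def)
qed

lemma box_integral_partials:
  assumes \<phi>: "\<phi> \<in> test_functions UNIV" and ab: "a \<le> b" "c \<le> d"
  shows "(\<integral>x. indicator (cbox (a, c) (b, d)) x * partial2 \<phi> x \<partial>lborel)
      = (\<integral>s. indicator {a..b} s * (\<phi> (s, d) - \<phi> (s, c)) \<partial>lborel)"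
    and "(\<integral>x. indicator (cbox (a, c) (b, d)) x * partial1 \<phi> x \<partial>lborel)
      = (\<integral>s. indicator {c..d} s * (\<phi> (b, s) - \<phi> (a, s)) \<partial>lborel)"
    and "(\<integral>x. indicator (cbox (a, c) (b, d)) x * partial2 (partial1 \<phi>) x \<partial>lborel)
      = (\<phi> (b, d) - \<phi> (b, c)) - (\<phi> (a, d) - \<phi> (a, c))"
proof -
  have i: "integrable lborel (\<lambda>x. indicator (cbox (a, c) (b, d)) x * \<psi> x)" if "\<psi> \<in> test_functions UNIV" for \<psi>
    by (rule integrable_mult_bounded[OF test_function_integrable[OF that], of _ 1]) auto
  have ind: "indicator (cbox (a, c) (b, d)) (s, u) * r = indicator {a..b} s * (indicator {c..d} u * r)"
    "indicator (cbox (a, c) (b, d)) (s, u) * r = indicator {c..d} u * (indicator {a..b} s * r)" for s u and r :: real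
    by (auto simp: indicator_def)
  have s: "smooth \<psi>" "smooth (partial1 \<psi>)" "smooth (partial2 \<psi>)" if "\<psi> \<in> test_functions UNIV" for \<psi>
    using test_functionsD(1)[OF that] smooth_partial by auto
  have f1: "(\<integral>u. indicator {a..b} u * partial1 \<psi> (u, y) \<partial>lborel) = \<psi> (b, y) - \<psi> (a, y)"
    if "\<psi> \<in> test_functions UNIV" for \<psi> y
    using s[OF that] ab by (intro ftc_interval partial_lines smooth_continuous_lines)
  have f2: "(\<integral>u. indicator {c..d} u * partial2 \<psi> (y, u) \<partial>lborel) = \<psi> (y, d) - \<psi> (y, c)"
    if "\<psi> \<in> test_functions UNIV" for \<psi> y
    using s[OF that] ab by (intro ftc_interval partial_lines smooth_continuous_lines)
  note p = test_function_partial[OF \<phi>]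
  have 2: "(\<integral>x. indicator (cbox (a, c) (b, d)) x * partial2 \<psi> x \<partial>lborel)
      = (\<integral>s. indicator {a..b} s * (\<psi> (s, d) - \<psi> (s, c)) \<partial>lborel)" if \<psi>: "\<psi> \<in> test_functions UNIV" for \<psi>
    unfolding plane_fubini(1)[OF i[OF test_function_partial(2)[OF \<psi>]]] ind(1) by (simp add: f2[OF \<psi>])
  from 2[OF \<phi>] show "(\<integral>x. indicator (cbox (a, c) (b, d)) x * partial2 \<phi> x \<partial>lborel)
      = (\<integral>s. indicator {a..b} s * (\<phi> (s, d) - \<phi> (s, c)) \<partial>lborel)" .
  show "(\<integral>x. indicator (cbox (a, c) (b, d)) x * partial1 \<phi> x \<partial>lborel)
      = (\<integral>s. indicator {c..d} s * (\<phi> (b, s) - \<phi> (a, s)) \<partial>lborel)"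
    unfolding plane_fubini(2)[OF i[OF p(1)]] ind(2) by (simp add: f1[OF \<phi>])
  have "(\<integral>x. indicator (cbox (a, c) (b, d)) x * partial2 (partial1 \<phi>) x \<partial>lborel)
      = (\<integral>s. indicator {a..b} s * (partial1 \<phi> (s, d) - partial1 \<phi> (s, c)) \<partial>lborel)"
    by (rule 2[OF p(1)])
  also have "\<dots> = (\<phi> (b, d) - \<phi> (b, c)) - (\<phi> (a, d) - \<phi> (a, c))"
    using s[OF \<phi>] ab
    by (intro ftc_interval[where g="\<lambda>s. \<phi> (s, d) - \<phi> (s, c)"] DERIV_diff partial_lines continuous_on_diff smooth_continuous_lines)
  finally show "(\<integral>x. indicator (cbox (a, c) (b, d)) x * partial2 (partial1 \<phi>) x \<partial>lborel)
      = (\<phi> (b, d) - \<phi> (b, c)) - (\<phi> (a, d) - \<phi> (a, c))" .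
qed

section \<open>The pixel averages and their derivatives\<close>

lemma double_abel_summation_0:
  fixes M v :: "nat \<Rightarrow> nat \<Rightarrow> real"
  assumes "\<And>l. M 0 l = 0" "\<And>l. M (Suc m) l = 0" "\<And>k. M k 0 = 0" "\<And>k. M k (Suc m) = 0"
  shows "(\<Sum>k=1..m. \<Sum>l=1..m. M k l * ((v k l - v k (l - 1)) - (v (k - 1) l - v (k - 1) (l - 1))))
    = (\<Sum>k\<le>m. \<Sum>l\<le>m. ((M (Suc k) (Suc l) - M k (Suc l)) - (M (Suc k) l - M k l)) * v k l)"
proof -
  have "(\<Sum>k=1..m. \<Sum>l=1..m. M k l * ((v k l - v k (l - 1)) - (v (k - 1) l - v (k - 1) (l - 1))))
      = (\<Sum>k=1..m. \<Sum>l=1..m. M k l * ((v k l - v (k - 1) l) - (v k (l - 1) - v (k - 1) (l - 1))))"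
    by (simp add: algebra_simps)
  also have "\<dots> = (\<Sum>k=1..m. - (\<Sum>l\<le>m. (M k (Suc l) - M k l) * (v k l - v (k - 1) l)))"
    using assms by (intro sum.cong refl abel_summation_0) auto
  also have "\<dots> = - (\<Sum>l\<le>m. \<Sum>k=1..m. (M k (Suc l) - M k l) * (v k l - v (k - 1) l))"
    unfolding sum_negf by (intro arg_cong[of _ _ uminus] sum.swap)
  also have "\<dots> = - (\<Sum>l\<le>m. - (\<Sum>k\<le>m. ((M (Suc k) (Suc l) - M (Suc k) l) - (M k (Suc l) - M k l)) * v k l))"
    using assms by (intro arg_cong[of _ _ uminus] sum.cong refl abel_summation_0) auto
  also have "\<dots> = (\<Sum>k\<le>m. \<Sum>l\<le>m. ((M (Suc k) (Suc l) - M (Suc k) l) - (M k (Suc l) - M k l)) * v k l)"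
    unfolding sum_negf minus_minus by (rule sum.swap)
  finally show ?thesis by (simp add: algebra_simps)
qed

lemma pixel_sides: "(real k - 1) / 2 ^ n \<le> real k / 2 ^ n"
  by (simp add: divide_right_mono)

lemma fin_borel_return: "fin_borel (return borel x)"
  using prob_space.axioms(1)[OF prob_space_return[of x borel]]
  by (simp add: fin_borel_def)

context marginal_free
begin

abbreviation discretized :: "nat \<Rightarrow> functional" where
  "discretized n \<equiv> dist_of_fun (pixel_fun n (moment \<alpha> \<beta> n))"

text \<open>
  On a pixel function, the mixed derivative yields second differences of \<phi> over the corners of each
  pixel. Summation by parts moves the differences to the pixel values, where they turn products of
  \<open>cell_right\<close> into products of hats.
\<close>

lemma D_D_discretized:
  assumes \<phi>: "\<phi> \<in> test_functions UNIV"
  shows "D_D (discretized n) \<phi> = (\<Sum>k\<le>2 ^ n. \<Sum>l\<le>2 ^ n.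
    dint \<alpha> \<beta> (\<lambda>t. hat n k (fst t) * hat n l (snd t)) * \<phi> (real k / 2 ^ n, real l / 2 ^ n))"
proof -
  let ?v = "\<lambda>k l. \<phi> (real k / 2 ^ n, real l / 2 ^ n)" and ?M = "moment \<alpha> \<beta> n"
  have "D_D (discretized n) \<phi> = (\<Sum>k=1..2 ^ n. \<Sum>l=1..2 ^ n. ?M k l *
     (\<integral>x. indicator (pixel n (k, l)) x * partial2 (partial1 \<phi>) x \<partial>lborel))"
    using pixel_dist_apply[OF test_function_partial(2)[OF test_function_partial(1)[OF \<phi>]]]
    by (simp add: D_D_apply[OF \<phi>])
  also have "\<dots> = (\<Sum>k=1..2 ^ n. \<Sum>l=1..2 ^ n. ?M k l *
     ((?v k l - ?v k (l - 1)) - (?v (k - 1) l - ?v (k - 1) (l - 1))))"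
    by (intro sum.cong refl) (simp add: pixel_cbox box_integral_partials(3)[OF \<phi> pixel_sides pixel_sides] of_nat_diff)
  also have "\<dots> = (\<Sum>k\<le>2 ^ n. \<Sum>l\<le>2 ^ n.
     ((?M (Suc k) (Suc l) - ?M k (Suc l)) - (?M (Suc k) l - ?M k l)) * ?v k l)"
    by (rule double_abel_summation_0) (rule moment_boundary)+
  finally show ?thesis by (simp add: dint_cell_hat)
qed

text \<open>
  The weights are the products of hats, the measures are Dirac masses at the grid points.
\<close>

lemma D_D_discretized_contraction:
  assumes rep: "represented_by T \<alpha> \<beta>"
  shows "D_D (discretized n) \<in> M_space (grid n)" and "M_norm (D_D (discretized n)) \<le> M_norm T"
proof -
  let ?J = "{..2 ^ n} \<times> {..2 ^ n} :: (nat \<times> nat) set"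
  let ?w = "\<lambda>(k, l) t. hat n k (fst t) * hat n l (snd t)"
  let ?L = "\<lambda>(k, l). return borel (real k / 2 ^ n, real l / 2 ^ n) :: plane measure"
  have w1: "?w j \<in> borel_measurable borel" "0 \<le> ?w j t" for j t
    by (auto simp: case_prod_beta hat_bounds)
  have w2: "(\<Sum>j\<in>?J. ?w j t) \<le> 1" for t
  proof -
    have "(\<Sum>j\<in>?J. ?w j t) = (\<Sum>k\<le>2 ^ n. hat n k (fst t)) * (\<Sum>l\<le>2 ^ n. hat n l (snd t))"
      by (simp add: sum_product sum.cartesian_product case_prod_beta)
    also have "\<dots> \<le> 1" by (intro mult_le_one sum_hat_le_1 sum_nonneg hat_bounds)
    finally show ?thesis .
  qed
  have L: "fin_borel (?L j)" for j by (simp add: case_prod_beta fin_borel_return)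
  have L1: "measure (?L j) UNIV \<le> 1" for j
    by (simp add: case_prod_beta measure_return)
  have ext: "D_D (discretized n) \<in> extensional (test_functions UNIV)" by (simp add: D_D_def D_I_def)
  have T': "D_D (discretized n) \<phi> = (\<Sum>j\<in>?J. dint \<alpha> \<beta> (?w j) * (\<integral>x. \<phi> x \<partial>?L j))"
    if "\<phi> \<in> test_functions UNIV" for \<phi>
  proof -
    have "(\<integral>x. \<phi> x \<partial>return borel y) = \<phi> y" for y
      using smooth_measurable[OF test_functionsD(1)[OF that]] by (intro integral_return) auto
    then show ?thesis
      unfolding D_D_discretized[OF that] sum.cartesian_product by (intro sum.cong) auto
  qed
  have "finite ?J" by simp
  note C = averaging_contraction[OF rep this w1 w2 L L1 ext T']
  show "M_norm (D_D (discretized n)) \<le> M_norm T" by (rule C(2))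
  let ?A = "\<lambda>m. mixture ?J (\<lambda>j. \<integral>t. ?w j t \<partial>m) ?L"
  have z: "measure (?A m) S = 0" if "S \<in> sets borel" "S \<inter> grid n = {}" for S m
  proof -
    have "measure (?A m) S = (\<Sum>j\<in>?J. (\<integral>t. ?w j t \<partial>m) * measure (?L j) S)"
      by (rule measure_mixture[OF _ _ L that(1)]) (auto intro!: integral_nonneg_AE simp: hat_bounds)
    also have "\<dots> = 0"
    proof (rule sum.neutral, rule ballI)
      fix j assume "j \<in> ?J"
      then have "(real (fst j) / 2 ^ n, real (snd j) / 2 ^ n) \<in> grid n"
        unfolding grid_def by (intro SigmaI imageI) auto
      then have "(real (fst j) / 2 ^ n, real (snd j) / 2 ^ n) \<notin> S" using that(2) by blast
      then show "(\<integral>t. ?w j t \<partial>m) * measure (?L j) S = 0"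
        using that(1) by (simp add: case_prod_beta measure_return)
    qed
    finally show ?thesis .
  qed
  have "D_D (discretized n) = dist_of_measure (measure_diff (?A \<alpha>) (?A \<beta>))"
    and "measure_diff (?A \<alpha>) (?A \<beta>) \<in> signed_measures"
    using C(1) by (auto simp: represented_by_iff intro: measure_diff_signed)
  moreover have "\<forall>S\<in>sets borel. S \<inter> grid n = {} \<longrightarrow> measure_diff (?A \<alpha>) (?A \<beta>) S = 0"
    using z by (auto simp: measure_diff_def)
  ultimately show "D_D (discretized n) \<in> M_space (grid n)" unfolding M_space_def by blast
qed

end

text \<open>
  The uniform distribution on the horizontal grid segment over the k-th cell at height \<open>l/2\<^sup>n\<close>,
  reflected at the diagonal for \<open>p = prod.swap\<close>.
\<close>

definition segment_mean :: "nat \<Rightarrow> (plane \<Rightarrow> plane) \<Rightarrow> nat \<Rightarrow> nat \<Rightarrow> plane measure" where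
  "segment_mean n p k l = distr (density lborel
     (\<lambda>s. ennreal (2 ^ n * indicator (cell n k) s))) borel (\<lambda>s. p (s, real l / 2 ^ n))"

lemma segment_mean:
  assumes p[measurable]: "p \<in> measurable borel borel"
  shows "fin_borel (segment_mean n p k l)" "measure (segment_mean n p k l) UNIV = 1"
    and "\<phi> \<in> borel_measurable borel \<Longrightarrow> (\<integral>x. \<phi> x \<partial>segment_mean n p k l)
      = 2 ^ n * (\<integral>s. indicator (cell n k) s * (\<phi> (p (s, real l / 2 ^ n)) :: real) \<partial>lborel)"
proof -
  let ?I = "(cell n k)"
  let ?D = "density lborel (\<lambda>s. ennreal (2 ^ n * indicator ?I s))"
  have [measurable]: "(\<lambda>s. p (s, real l / 2 ^ n)) \<in> borel_measurable borel" by measurable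
  have "emeasure (segment_mean n p k l) UNIV = emeasure ?D UNIV"
    unfolding segment_mean_def by (subst emeasure_distr) auto
  also have "\<dots> = (\<integral>\<^sup>+s. ennreal (2 ^ n) * indicator ?I s \<partial>lborel)"
    by (subst emeasure_density) (auto intro!: nn_integral_cong simp: indicator_def)
  also have "\<dots> = ennreal (2 ^ n) * ennreal (1 / 2 ^ n)"
    using pixel_sides[of k n] by (subst nn_integral_cmult_indicator) (auto simp: diff_divide_distrib[symmetric])
  also have "\<dots> = 1" by (simp add: ennreal_mult[symmetric])
  finally have 1: "emeasure (segment_mean n p k l) UNIV = 1" .
  then show "fin_borel (segment_mean n p k l)" "measure (segment_mean n p k l) UNIV = 1"
    by (auto simp: fin_borel_def measure_def segment_mean_def intro!: finite_measureI)
  show "\<phi> \<in> borel_measurable borel \<Longrightarrow> (\<integral>x. \<phi> x \<partial>segment_mean n p k l)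
      = 2 ^ n * (\<integral>s. indicator ?I s * (\<phi> (p (s, real l / 2 ^ n)) :: real) \<partial>lborel)"
    unfolding segment_mean_def
    by (subst integral_distr) (auto simp: integral_density mult.assoc)
qed

lemma ramp_integral_Ioc:
  assumes "a \<le> b"
  shows "(\<integral>s. (if t \<le> s then indicator {a<..b} s else 0) \<partial>lborel) = ramp a b t"
proof (cases "t \<le> a")
  case True
  then have "(\<lambda>s. if t \<le> s then indicator {a<..b} s else 0) = (indicator {a<..b} :: real \<Rightarrow> real)"
    by (auto simp: indicator_def)
  then show ?thesis using True assms by (simp add: ramp_def)
next
  case False
  then have *: "(\<lambda>s. if t \<le> s then indicator {a<..b} s else 0) = (indicator {t..b} :: real \<Rightarrow> real)"
    by (auto simp: indicator_def)
  show ?thesis using False assms unfolding * by (cases "t \<le> b") (auto simp: ramp_def)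
qed

lemma sum_cells_le_1:
  "(\<Sum>k=1..m. indicator {(real k - 1) / 2 ^ n<..real k / 2 ^ n} s) \<le> (1 :: real)"
proof -
  have "(\<Sum>k=1..m. indicator {(real k - 1) / 2 ^ n<..real k / 2 ^ n} s) = (indicator {0<..real m / 2 ^ n} s :: real)"
  proof (induction m)
    case (Suc m)
    have "0 \<le> a \<Longrightarrow> a \<le> b \<Longrightarrow> indicator {0<..a} s + indicator {a<..b} s = (indicator {0<..b} s :: real)" for a b
      by (auto simp: indicator_def)
    from this[of "real m / 2 ^ n" "real (Suc m) / 2 ^ n"]
    have "indicator {0<..real m / 2 ^ n} s + indicator {real m / 2 ^ n<..real (Suc m) / 2 ^ n} s
        = (indicator {0<..real (Suc m) / 2 ^ n} s :: real)"
      by (simp add: divide_right_mono)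
    then show ?case using Suc by simp
  qed simp
  then show ?thesis by (simp add: indicator_def)
qed

context marginal_free
begin

text \<open>
  The weights are products of a hat in the direction of the derivative with the indicator of a cell
  in the other direction; the measures are uniform on grid segments. The integral of such a weight
  against a swept measure is a moment of the original one: sweeping integrates the indicator
  of the cell to \<open>cell_right\<close>.
\<close>

lemma gradient_contraction:
  assumes p: "p = id \<or> p = prod.swap"
    and T: "represented_by T (sweep p \<alpha>) (sweep p \<beta>)"
    and T': "T' \<in> extensional (test_functions UNIV)"
      "\<And>\<phi>. \<phi> \<in> test_functions UNIV \<Longrightarrow> T' \<phi> = - (\<Sum>k=1..2 ^ n. \<Sum>l=1..2 ^ n.
         dint \<alpha> \<beta> (\<lambda>t. cell_right n k (fst (p t)) * cell_right n l (snd (p t))) *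
         (\<integral>s. indicator (cell n k) s *
            (\<phi> (p (s, real l / 2 ^ n)) - \<phi> (p (s, (real l - 1) / 2 ^ n))) \<partial>lborel))"
  shows "M_norm T' \<le> M_norm T"
proof -
  define M where "M k l = dint \<alpha> \<beta> (\<lambda>t. cell_right n k (fst (p t)) * cell_right n l (snd (p t)))" for k l
  have pm[measurable]: "p \<in> borel_measurable borel"
    using p by (auto intro!: borel_measurable_continuous_onI continuous_intros simp: prod.swap_def)
  have pp: "p (p x) = x" for x using p by auto
  have Mb: "M k 0 = 0" "M k (Suc (2 ^ n)) = 0" for k
    using p moment_boundary(2,4)[of n k, unfolded moment_def] moment_boundary(1,3)[of n k, unfolded moment_def]
    by (auto simp: M_def mult.commute)
  have Mh: "dint \<alpha> \<beta> (\<lambda>t. cell_right n k (fst (p t)) * hat n l (snd (p t))) = M k (Suc l) - M k l" for k l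
    using p dint_cell_hat(1)[of n k l, unfolded moment_def] dint_cell_hat(2)[of n l k, unfolded moment_def]
    by (auto simp: M_def mult.commute)
  let ?J = "{1..2 ^ n} \<times> {..2 ^ n} :: (nat \<times> nat) set"
  \<comment> \<open>Half-open cells are disjoint, so the weights sum to at most \<open>1\<close> also on the grid lines.\<close>
  let ?c = "\<lambda>k. {(real k - 1) / 2 ^ n<..real k / 2 ^ n}"
  let ?w = "\<lambda>(k, l) x. indicator (?c k) (fst (p x)) * hat n l (snd (p x))"
  let ?L = "\<lambda>(k, l). segment_mean n p k l"
  have w1: "?w j \<in> borel_measurable borel" "0 \<le> ?w j t" "\<bar>?w j t\<bar> \<le> 1" for j t
    by (auto simp: case_prod_beta hat_bounds abs_mult indicator_def)
  have w2: "(\<Sum>j\<in>?J. ?w j t) \<le> 1" for t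
  proof -
    have "(\<Sum>j\<in>?J. ?w j t) = (\<Sum>k=1..2 ^ n. indicator (?c k) (fst (p t))) * (\<Sum>l\<le>2 ^ n. hat n l (snd (p t)))"
      unfolding sum_product sum.cartesian_product by (intro sum.cong refl) (simp add: case_prod_beta)
    also have "\<dots> \<le> 1" by (intro mult_le_one sum_hat_le_1 sum_cells_le_1 sum_nonneg hat_bounds)
    finally show ?thesis .
  qed
  have L: "fin_borel (?L j)" "measure (?L j) UNIV \<le> 1" for j
    by (simp_all add: case_prod_beta segment_mean pm)
  have dw: "2 ^ n * dint (sweep p \<alpha>) (sweep p \<beta>) (?w (k, l)) = M k (Suc l) - M k l"
    if k: "k \<in> {1..2 ^ n}" for k l
  proof -
    have cell: "s \<in> ?c k \<Longrightarrow> s \<in> {0..1}" for s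
    proof -
      have "real k \<le> real (2 ^ n)" using k by (simp only: of_nat_le_iff) simp
      then have "real k / 2 ^ n \<le> 1" "0 \<le> (real k - 1) / 2 ^ n" using k by simp_all
      then show "s \<in> ?c k \<Longrightarrow> s \<in> {0..1}" unfolding greaterThanAtMost_iff atLeastAtMost_iff by linarith
    qed
    have sw: "(\<integral>x. ?w (k, l) x \<partial>sweep p m) = (\<integral>t. cell_right n k (fst (p t)) * hat n l (snd (p t)) \<partial>m) / 2 ^ n"
      if m: "fin_borel m" for m
    proof -
      have "(\<integral>s. (if fst (p t) \<le> s then indicator {0..1} s else 0) * ?w (k, l) (p (s, snd (p t))) \<partial>lborel)
          = cell_right n k (fst (p t)) * hat n l (snd (p t)) / 2 ^ n" for t
      proof -
        have "(if fst (p t) \<le> s then indicator {0..1} s else 0) * ?w (k, l) (p (s, snd (p t)))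
          = (if fst (p t) \<le> s then indicator (?c k) s else 0) * hat n l (snd (p t))" for s
          using cell[of s] by (auto simp: pp indicator_def)
        then show ?thesis
          by (simp add: ramp_integral_Ioc pixel_sides cell_right_ramp)
      qed
      then show ?thesis
        unfolding sweep_integral[OF m pm w1(1)[of "(k, l)"] w1(3)[of "(k, l)"]] by (simp only:) simp
    qed
    have "dint (sweep p \<alpha>) (sweep p \<beta>) (?w (k, l))
      = dint \<alpha> \<beta> (\<lambda>t. cell_right n k (fst (p t)) * hat n l (snd (p t))) / 2 ^ n"
      unfolding dint_def sw[OF fin(1)] sw[OF fin(2)] by (simp add: diff_divide_distrib)
    then show ?thesis by (simp add: Mh)
  qed
  have "T' \<phi> = (\<Sum>j\<in>?J. dint (sweep p \<alpha>) (sweep p \<beta>) (?w j) * (\<integral>x. \<phi> x \<partial>?L j))"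
    if \<phi>: "\<phi> \<in> test_functions UNIV" for \<phi>
  proof -
    define u where "u k l = (\<integral>s. indicator (cell n k) s * \<phi> (p (s, real l / 2 ^ n)) \<partial>lborel)" for k l :: nat
    note m[measurable] = smooth_measurable[OF test_functionsD(1)[OF \<phi>]]
    obtain B where B: "\<And>x. \<bar>\<phi> x\<bar> \<le> B" using test_function_bounded[OF \<phi>] by blast
    have i: "integrable lborel (\<lambda>s. indicator (cell n k) s * \<phi> (p (s, z)))" for k :: nat and z
    proof -
      have "integrable lborel (\<lambda>s. \<phi> (p (s, z)) * indicator (cell n k) s)"
        by (rule integrable_mult_bounded[OF _ _ B])
          (use emeasure_lborel_cbox_finite[of "(real k - 1) / 2 ^ n" "real k / 2 ^ n"] in auto)
      then show ?thesis by (simp add: mult.commute)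
    qed
    have d: "(\<integral>s. indicator (cell n k) s *
            (\<phi> (p (s, real l / 2 ^ n)) - \<phi> (p (s, (real l - 1) / 2 ^ n))) \<partial>lborel) = u k l - u k (l - 1)"
      if "l \<in> {1..2 ^ n}" for k l
      using that i by (simp add: u_def right_diff_distrib of_nat_diff)
    have "T' \<phi> = - (\<Sum>k=1..2 ^ n. \<Sum>l=1..2 ^ n. M k l * (u k l - u k (l - 1)))"
      unfolding T'(2)[OF \<phi>] M_def[symmetric] by (simp add: d)
    also have "\<dots> = (\<Sum>k=1..2 ^ n. \<Sum>l\<le>2 ^ n. (M k (Suc l) - M k l) * u k l)"
    proof -
      have "(\<Sum>l=1..2 ^ n. M k l * (u k l - u k (l - 1))) = - (\<Sum>l\<le>2 ^ n. (M k (Suc l) - M k l) * u k l)" for k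
        by (rule abel_summation_0) (rule Mb)+
      then show ?thesis by (simp add: sum_negf)
    qed
    also have "\<dots> = (\<Sum>k=1..2 ^ n. \<Sum>l\<le>2 ^ n. dint (sweep p \<alpha>) (sweep p \<beta>) (?w (k, l)) * (\<integral>x. \<phi> x \<partial>segment_mean n p k l))"
      by (intro sum.cong refl) (simp add: dw[symmetric] segment_mean(3)[OF pm m] u_def mult_ac)
    finally show ?thesis by (simp add: sum.cartesian_product case_prod_beta)
  qed
  note T'' = this
  have "finite ?J" by simp
  from averaging_contraction(2)[OF T this w1(1,2) w2 L T'(1) T''] show ?thesis .
qed

lemma discretized_gradient:
  assumes "represented_by (I_D f) (sweep id \<alpha>) (sweep id \<beta>)"
    and "represented_by (D_I f) (sweep prod.swap \<alpha>) (sweep prod.swap \<beta>)"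
  shows "grad_norm (discretized n) \<le> grad_norm f"
proof -
  have "M_norm (I_D (discretized n)) \<le> M_norm (I_D f)"
  proof (rule gradient_contraction[OF _ assms(1)])
    fix \<phi> assume \<phi>: "\<phi> \<in> test_functions UNIV"
    show "I_D (discretized n) \<phi> = - (\<Sum>k=1..2 ^ n. \<Sum>l=1..2 ^ n.
         dint \<alpha> \<beta> (\<lambda>t. cell_right n k (fst (id t)) * cell_right n l (snd (id t))) *
         (\<integral>s. indicator (cell n k) s *
            (\<phi> (id (s, real l / 2 ^ n)) - \<phi> (id (s, (real l - 1) / 2 ^ n))) \<partial>lborel))"
      using \<phi> by (simp add: I_D_def moment_def[symmetric] pixel_dist_apply[OF test_function_partial(2)[OF \<phi>]] pixel_cbox
          box_integral_partials(1)[OF \<phi> pixel_sides pixel_sides])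
  qed (simp_all add: I_D_def)
  moreover have "M_norm (D_I (discretized n)) \<le> M_norm (D_I f)"
  proof (rule gradient_contraction[OF _ assms(2)])
    fix \<phi> assume \<phi>: "\<phi> \<in> test_functions UNIV"
    have "D_I (discretized n) \<phi> = - (\<Sum>l=1..2 ^ n. \<Sum>k=1..2 ^ n. moment \<alpha> \<beta> n l k *
         (\<integral>s. indicator (cell n k) s *
            (\<phi> (prod.swap (s, real l / 2 ^ n)) - \<phi> (prod.swap (s, (real l - 1) / 2 ^ n))) \<partial>lborel))"
      using \<phi> by (simp add: D_I_def pixel_dist_apply[OF test_function_partial(1)[OF \<phi>]] pixel_cbox
          box_integral_partials(2)[OF \<phi> pixel_sides pixel_sides])
    then show "D_I (discretized n) \<phi> = - (\<Sum>k=1..2 ^ n. \<Sum>l=1..2 ^ n.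
         dint \<alpha> \<beta> (\<lambda>t. cell_right n k (fst (prod.swap t)) * cell_right n l (snd (prod.swap t))) *
         (\<integral>s. indicator (cell n k) s *
            (\<phi> (prod.swap (s, real l / 2 ^ n)) - \<phi> (prod.swap (s, (real l - 1) / 2 ^ n))) \<partial>lborel))"
      by (subst sum.swap) (simp add: moment_def mult.commute)
  qed (simp_all add: D_I_def)
  ultimately show ?thesis by (simp add: grad_norm_def)
qed

end

section \<open>Integrals over coarser pixels\<close>

text \<open>
  A cell of level N consists of \<open>2\<^bsup>n-N\<^esup>\<close> cells of level n, and the fraction to the right of t is the
  mean of the fractions in the parts.
\<close>

lemma cell_right_refine:
  assumes "N \<le> n" "1 \<le> i"
  shows "cell_right N i t = (\<Sum>k\<in>{(i - 1) * 2 ^ (n - N)<..i * 2 ^ (n - N)}. cell_right n k t) / 2 ^ (n - N)"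
proof -
  define r :: nat where "r = 2 ^ (n - N)"
  define p where "p = (i - 1) * r"
  define x where "x = 2 ^ n * t"
  have r: "0 < r" "real r = 2 ^ (n - N)" by (simp_all add: r_def)
  have ir: "i * r = p + r" using assms(2) by (cases i) (simp_all add: p_def)
  have n: "(2::real) ^ n = 2 ^ N * real r" using assms(1) by (simp add: r(2) power_add[symmetric])
  have sum: "(\<Sum>k\<in>{p<..p + q}. max 0 (min 1 (real k - x))) = max 0 (min (real q) (real (p + q) - x))" for q
  proof (induction q)
    case (Suc q)
    have "{p<..p + Suc q} = insert (p + Suc q) {p<..p + q}" by auto
    then have "(\<Sum>k\<in>{p<..p + Suc q}. max 0 (min 1 (real k - x)))
      = max 0 (min 1 (real (p + Suc q) - x)) + max 0 (min (real q) (real (p + q) - x))"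
      using Suc by simp
    also have "\<dots> = max 0 (min (real (Suc q)) (real (p + Suc q) - x))"
      by (auto simp: max_def min_def)
    finally show ?case .
  qed simp
  have "real r * cell_right N i t = max (real r * 0) (min (real r * 1) (real r * (real i - 2 ^ N * t)))"
    unfolding cell_right_def using r(1) by (simp add: max_mult_distrib_left min_mult_distrib_left)
  also have "real r * (real i - 2 ^ N * t) = real (p + r) - x"
    unfolding ir[symmetric] x_def n by (simp add: algebra_simps)
  finally have "real r * cell_right N i t = (\<Sum>k\<in>{p<..p + r}. cell_right n k t)"
    using sum[of r] by (simp add: cell_right_def x_def)
  then show ?thesis
    unfolding r(2)[symmetric] r_def[symmetric] p_def[symmetric] ir using r(1) by (simp add: field_simps)
qed

text \<open>
  Dyadic cells of different levels are nested or meet in at most one point.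
\<close>

lemma cell_overlap:
  assumes "N \<le> n" "1 \<le> i" "1 \<le> k"
  shows "(\<integral>s. indicator (cell n k) s * indicator {(real i - 1) / 2 ^ N..real i / 2 ^ N} s \<partial>lborel)
    = (if k \<in> {(i - 1) * 2 ^ (n - N)<..i * 2 ^ (n - N)} then 1 / 2 ^ n else (0::real))"
proof -
  define r :: nat where "r = 2 ^ (n - N)"
  have n: "(2::real) ^ n = 2 ^ N * real r" using assms(1) by (simp add: r_def power_add[symmetric])
  have r: "0 < r" by (simp add: r_def)
  have e: "(real i - 1) / 2 ^ N = real ((i - 1) * r) / 2 ^ n" "real i / 2 ^ N = real (i * r) / 2 ^ n"
    using r assms(2) unfolding n by (simp_all add: of_nat_diff)
  have I: "(\<integral>s. indicator {a / 2 ^ n..b / 2 ^ n} s * indicator {c / 2 ^ n..d / 2 ^ n} s \<partial>lborel)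
      = max 0 (min b d - max a c) / 2 ^ n" for a b c d :: real
  proof -
    have "(\<lambda>s. indicator {a / 2 ^ n..b / 2 ^ n} s * indicator {c / 2 ^ n..d / 2 ^ n} s)
        = (indicator {max a c / 2 ^ n..min b d / 2 ^ n} :: real \<Rightarrow> real)"
      by (rule ext) (auto simp: indicator_def max_def min_def divide_le_eq le_divide_eq)
    moreover have "measure lborel {max a c / 2 ^ n..min b d / 2 ^ n} = max 0 (min b d - max a c) / 2 ^ n"
      by (cases "max a c \<le> min b d") (auto simp: divide_right_mono diff_divide_distrib divide_le_cancel)
    ultimately show ?thesis by simp
  qed
  have "max 0 (min (real k) (real (i * r)) - max (real k - 1) (real ((i - 1) * r)))
      = (if k \<in> {(i - 1) * r<..i * r} then 1 else 0)"
  proof -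
    consider "k \<le> (i - 1) * r" | "i * r < k" | "(i - 1) * r < k" "k \<le> i * r" by linarith
    then show ?thesis
    proof cases
      case 1
      then have "real k \<le> real ((i - 1) * r)" by (simp only: of_nat_le_iff)
      then show ?thesis using 1 by (simp del: of_nat_mult)
    next
      case 2
      then have "real (i * r) + 1 \<le> real k" by (metis Suc_leI add.commute of_nat_Suc of_nat_le_iff)
      then show ?thesis using 2 by (simp del: of_nat_mult)
    next
      case 3
      then have "real ((i - 1) * r) + 1 \<le> real k" "real k \<le> real (i * r)"
        by (metis Suc_leI add.commute of_nat_Suc of_nat_le_iff, simp only: of_nat_le_iff)
      then show ?thesis using 3 by (simp del: of_nat_mult)
    qed
  qed
  then show ?thesis unfolding e I r_def[symmetric] by simp
qed

context marginal_free
begin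

lemma moment_refine:
  assumes "N \<le> n" "1 \<le> i" "1 \<le> j"
  shows "moment \<alpha> \<beta> N i j = (\<Sum>k\<in>{(i - 1) * 2 ^ (n - N)<..i * 2 ^ (n - N)}.
     \<Sum>l\<in>{(j - 1) * 2 ^ (n - N)<..j * 2 ^ (n - N)}. moment \<alpha> \<beta> n k l) / 4 ^ (n - N)"
proof -
  let ?A = "\<lambda>i. {(i - 1) * 2 ^ (n - N)<..i * 2 ^ (n - N)}"
  let ?u = "\<lambda>k l t. cell_right n k (fst t) * cell_right n l (snd t)"
  have i: "integrable m (?u k l)" if "fin_borel m" for m k l
    by (rule fin_borel_integral(1)[OF that, of _ 1]) (auto simp: abs_mult intro!: mult_le_one cell_right_bounds)
  have "2 ^ (n - N) * 2 ^ (n - N) = (4 ^ (n - N) :: real)" by (simp add: power_mult_distrib[symmetric])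
  then have "cell_right N i (fst t) * cell_right N j (snd t) = (1 / 4 ^ (n - N)) * (\<Sum>k\<in>?A i. \<Sum>l\<in>?A j. ?u k l t)" for t
    unfolding cell_right_refine[OF assms(1,2)] cell_right_refine[OF assms(1,3)] by (simp add: sum_product)
  then have "moment \<alpha> \<beta> N i j = (1 / 4 ^ (n - N)) * dint \<alpha> \<beta> (\<lambda>t. \<Sum>k\<in>?A i. \<Sum>l\<in>?A j. ?u k l t)"
    by (simp only: moment_def dint_cmult)
  also have "dint \<alpha> \<beta> (\<lambda>t. \<Sum>k\<in>?A i. \<Sum>l\<in>?A j. ?u k l t) = (\<Sum>k\<in>?A i. \<Sum>l\<in>?A j. moment \<alpha> \<beta> n k l)"
    using i[OF fin(1)] i[OF fin(2)] by (simp add: moment_def dint_def sum_subtractf)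
  finally show ?thesis by simp
qed

text \<open>
  Both sides are the mean of the moments of the level-n pixels inside the pixel \<open>(i, j)\<close> of level
  N, up to the area of the latter: averaging over small pixels does not change integrals over
  unions of them.
\<close>

lemma discretized_pixel_integral:
  assumes "N \<le> n" and ij: "i \<in> {1..2 ^ N}" "j \<in> {1..2 ^ N}"
  shows "(\<integral>x. indicator (pixel N (i, j)) x * pixel_fun n (moment \<alpha> \<beta> n) x \<partial>lborel)
    = (\<integral>x. indicator (pixel N (i, j)) x * (cdf2 \<alpha> x - cdf2 \<beta> x) \<partial>lborel)"
proof -
  let ?A = "\<lambda>i. {(i - 1) * 2 ^ (n - N)<..i * 2 ^ (n - N)} :: nat set"
  have g: "(indicator (pixel N (i, j)) :: plane \<Rightarrow> real) \<in> borel_measurable borel"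
    unfolding pixel_cbox by simp
  have A: "?A i \<subseteq> {1..2 ^ n}" if "i \<in> {1..2 ^ N}" for i
  proof
    fix k assume k: "k \<in> ?A i"
    have "i * 2 ^ (n - N) \<le> 2 ^ N * 2 ^ (n - N)" using that by (intro mult_right_mono) auto
    also have "\<dots> = (2 ^ n :: nat)" using assms(1) by (simp add: power_add[symmetric])
    finally show "k \<in> {1..2 ^ n}" using k by auto
  qed
  let ?d = "\<lambda>k i. (\<integral>s. indicator (cell n k) s * indicator {(real i - 1) / 2 ^ N..real i / 2 ^ N} s \<partial>lborel) :: real"
  have ov: "(\<integral>x. indicator (pixel n (k, l)) x * indicator (pixel N (i, j)) x \<partial>lborel) = ?d k i * ?d l j" for k l
  proof -
    have int: "integrable lborel (\<lambda>x. indicator (pixel n (k, l)) x * indicator (pixel N (i, j)) x :: real)"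
      by (rule integrable_mult_bounded[OF indicator_pixel_integrable, of _ 1]) (auto simp: pixel_cbox)
    have "indicator (pixel n (k, l)) (s, u) * indicator (pixel N (i, j)) (s, u)
      = (indicator (cell n k) s * indicator {(real i - 1) / 2 ^ N..real i / 2 ^ N} s)
        * (indicator {(real l - 1) / 2 ^ n..real l / 2 ^ n} u * indicator {(real j - 1) / 2 ^ N..real j / 2 ^ N} u :: real)" for s u
      by (auto simp: pixel_def indicator_def)
    then show ?thesis unfolding plane_fubini(1)[OF int] by simp
  qed
  have "(\<integral>x. indicator (pixel N (i, j)) x * pixel_fun n (moment \<alpha> \<beta> n) x \<partial>lborel)
    = (\<integral>x. pixel_fun n (moment \<alpha> \<beta> n) x * indicator (pixel N (i, j)) x \<partial>lborel)"
    by (intro Bochner_Integration.integral_cong refl mult.commute)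
  also have "\<dots> = (\<Sum>k=1..2 ^ n. \<Sum>l=1..2 ^ n. moment \<alpha> \<beta> n k l * (?d k i * ?d l j))"
    unfolding ov[symmetric] by (rule pixel_fun_integral(2)[OF g, of 1]) simp
  also have "\<dots> = (\<Sum>k=1..2 ^ n. \<Sum>l=1..2 ^ n. if k \<in> ?A i then if l \<in> ?A j then moment \<alpha> \<beta> n k l / 4 ^ n else 0 else 0)"
  proof (intro sum.cong refl)
    fix k l :: nat assume "k \<in> {1..2 ^ n}" "l \<in> {1..2 ^ n}"
    then have "?d k i = (if k \<in> ?A i then 1 / 2 ^ n else 0)" "?d l j = (if l \<in> ?A j then 1 / 2 ^ n else 0)"
      using ij assms(1) by (intro cell_overlap; simp)+
    moreover have "2 ^ n * 2 ^ n = (4 ^ n :: real)" by (simp add: power_mult_distrib[symmetric])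
    ultimately show "moment \<alpha> \<beta> n k l * (?d k i * ?d l j)
      = (if k \<in> ?A i then if l \<in> ?A j then moment \<alpha> \<beta> n k l / 4 ^ n else 0 else 0)" by simp
  qed
  also have "\<dots> = (\<Sum>k\<in>?A i. \<Sum>l\<in>?A j. moment \<alpha> \<beta> n k l / 4 ^ n)"
  proof -
    have restrict: "(\<Sum>x\<in>S. if x \<in> B then g x else 0) = sum g B"
      if "B \<subseteq> S" "finite S" for B S :: "nat set" and g :: "nat \<Rightarrow> real"
      using that by (simp add: sum.inter_restrict[symmetric] Int_absorb1)
    have "(\<Sum>l=1..2 ^ n. if k \<in> ?A i then if l \<in> ?A j then moment \<alpha> \<beta> n k l / 4 ^ n else 0 else 0)
       = (if k \<in> ?A i then \<Sum>l\<in>?A j. moment \<alpha> \<beta> n k l / 4 ^ n else 0)" for k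
      by (cases "k \<in> ?A i") (simp_all only: restrict[OF A[OF ij(2)] finite_atLeastAtMost] if_True if_False sum.neutral_const)
    then show ?thesis
      by (simp only: restrict[OF A[OF ij(1)] finite_atLeastAtMost])
  qed
  also have "\<dots> = moment \<alpha> \<beta> N i j / 4 ^ N"
  proof -
    have "(4::real) ^ n = 4 ^ (n - N) * 4 ^ N" using assms(1) by (simp add: power_add[symmetric])
    then show ?thesis using ij by (simp add: moment_refine[OF assms(1)] sum_divide_distrib)
  qed
  finally show ?thesis by (simp add: moment_pixel)
qed

end

section \<open>Comparison of the minimisers\<close>

lemma M_space_mono:
  assumes "S \<subseteq> S'" shows "M_space S \<subseteq> M_space S'"
proof
  fix T assume "T \<in> M_space S"
  then obtain \<mu> where \<mu>: "T = dist_of_measure \<mu>" "\<mu> \<in> signed_measures"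
    "\<forall>A\<in>sets borel. A \<inter> S = {} \<longrightarrow> \<mu> A = 0" by (auto simp: M_space_def)
  have "\<mu> A = 0" if "A \<in> sets borel" "A \<inter> S' = {}" for A
    using \<mu>(3) that assms by (metis Int_mono subset_empty order_refl)
  then show "T \<in> M_space S'" using \<mu>(1,2) by (auto simp: M_space_def)
qed

lemma grid_mono: "m \<le> n \<Longrightarrow> grid m \<subseteq> grid n"
proof -
  assume mn: "m \<le> n"
  have "(\<lambda>k. real k / 2 ^ m) ` {0..2 ^ m} \<subseteq> (\<lambda>k. real k / 2 ^ n) ` {0..2 ^ n}"
  proof (rule image_subsetI)
    fix k :: nat assume k: "k \<in> {0..2 ^ m}"
    have e: "2 ^ m * 2 ^ (n - m) = (2 ^ n :: nat)" using mn by (simp add: power_add[symmetric])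
    have "k * 2 ^ (n - m) \<le> 2 ^ m * 2 ^ (n - m)" using k by (intro mult_right_mono) auto
    then have "k * 2 ^ (n - m) \<in> {0..2 ^ n}" unfolding e by simp
    moreover have "real k / 2 ^ m = real (k * 2 ^ (n - m)) / 2 ^ n"
    proof -
      have "(2::real) ^ n = 2 ^ m * 2 ^ (n - m)" using mn by (simp add: power_add[symmetric])
      then show ?thesis by simp
    qed
    ultimately show "real k / 2 ^ m \<in> (\<lambda>k. real k / 2 ^ n) ` {0..2 ^ n}" by blast
  qed
  then show "grid m \<subseteq> grid n" unfolding grid_def by (intro Sigma_mono)
qed

lemma grid_subset_K: "grid n \<subseteq> K"
proof -
  have "real k / 2 ^ n \<in> {0..1}" if "k \<in> {0..2 ^ n}" for k
  proof -
    have "real k \<le> real (2 ^ n)" using that by (simp only: of_nat_le_iff) simp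
    then show ?thesis by simp
  qed
  then show ?thesis unfolding grid_def K_def by (intro Sigma_mono image_subsetI)
qed

text \<open>
  The competitor is the function of pixel averages of f: the data term is unchanged because
  \<open>N \<le> n\<close>, and none of the three norms increases. Positivity of the averages is seen by testing f with
  bumps.
\<close>

lemma discretization_exists:
  assumes f: "f \<in> M_DD0_pos" and n: "N \<le> n" and par: "0 < \<theta>" "\<theta> \<le> 1" "0 < lam"
  obtains g where "g \<in> M_DD0_pos_grid n" "objective N y \<theta> lam g \<le> objective N y \<theta> lam f"
proof -
  have f0: "f \<in> M_DD0" and fp: "\<And>\<phi>. \<phi> \<in> test_functions UNIV \<Longrightarrow> (\<And>x. 0 \<le> \<phi> x) \<Longrightarrow> 0 \<le> f \<phi>"
    using f by (auto simp: M_DD0_pos_def)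
  obtain \<alpha> \<beta> where rep: "represented_by (D_D f) \<alpha> \<beta>" "AE t in \<alpha>. t \<in> K" "AE t in \<beta>. t \<in> K"
    using M_DD0_represented[OF f0] by blast
  interpret marginal_free \<alpha> \<beta> by (rule M_DD0_marginal_free[OF f0 rep])
  let ?g = "discretized n"
  note loc = cdf2_locally_integrable[OF fin]
  note f_eq = M_DD0_cdf2[OF f0 rep]
  have f_fun: "f = dist_of_fun (\<lambda>x. cdf2 \<alpha> x - cdf2 \<beta> x)"
  proof
    fix \<phi>
    have "f \<in> extensional (test_functions UNIV)" using f0 by (auto simp: M_DD0_def distributions_def)
    then show "f \<phi> = dist_of_fun (\<lambda>x. cdf2 \<alpha> x - cdf2 \<beta> x) \<phi>"
      by (cases "\<phi> \<in> test_functions UNIV") (auto simp: f_eq dist_of_fun_def extensional_def)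
  qed
  have moment_nonneg: "0 \<le> moment \<alpha> \<beta> n k l" for k l
  proof -
    let ?b = "bump ((real k - 1) / 2 ^ n, (real l - 1) / 2 ^ n) (real k / 2 ^ n, real l / 2 ^ n)"
    have "0 \<le> (\<integral>x. (cdf2 \<alpha> x - cdf2 \<beta> x) * ?b j x \<partial>lborel)" for j
      using fp[OF bump_test[OF subset_UNIV]] bump_bounds by (simp add: f_eq[OF bump_test[OF subset_UNIV]])
    then have "0 \<le> (\<integral>x. indicator (pixel n (k, l)) x * (cdf2 \<alpha> x - cdf2 \<beta> x) \<partial>lborel)"
      unfolding pixel_cbox
      by (intro LIMSEQ_le_const[OF bump_lborel_tendsto[OF locally_integrable_box[OF loc]]]) auto
    then show ?thesis by (simp add: moment_pixel)
  qed
  have DD: "D_D ?g \<in> M_space (grid n)" "M_norm (D_D ?g) \<le> M_norm (D_D f)"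
    using D_D_discretized_contraction[OF rep(1)] by auto
  have "0 \<le> ?g \<phi>" if "\<phi> \<in> test_functions UNIV" "\<And>x. 0 \<le> \<phi> x" for \<phi>
    using that moment_nonneg
    by (auto simp: pixel_dist_apply intro!: sum_nonneg mult_nonneg_nonneg integral_nonneg_AE)
  then have "?g \<in> M_DD0_pos_grid n"
    using DD(1) M_space_mono[OF grid_subset_K[of n]] pixel_dist_distribution pixel_dist_off_K
    by (auto simp: M_DD0_pos_grid_def M_DD0_pos_def M_DD0_def)
  moreover have "objective N y \<theta> lam ?g \<le> objective N y \<theta> lam f"
  proof -
    have "\<nu> N ?g idx = \<nu> N f idx" if idx: "idx \<in> {1..2 ^ N} \<times> {1..2 ^ N}" for idx
    proof -
      obtain i j where ij: "idx = (i, j)" "i \<in> {1..2 ^ N}" "j \<in> {1..2 ^ N}" using idx by auto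
      show ?thesis
        unfolding \<nu>_def ij(1) pixel_cbox
          pixel_integral_fun_of_dist[OF pixel_fun_locally_integrable refl] pixel_integral_fun_of_dist[OF loc f_fun]
        using discretized_pixel_integral[OF n ij(2,3)] by (simp add: pixel_cbox)
    qed
    then have "L2_set (\<lambda>i. y i - \<nu> N ?g i) ({1..2 ^ N} \<times> {1..2 ^ N})
        = L2_set (\<lambda>i. y i - \<nu> N f i) ({1..2 ^ N} \<times> {1..2 ^ N})"
      by (intro L2_set_cong) auto
    moreover have "theta_norm \<theta> ?g \<le> theta_norm \<theta> f"
      unfolding theta_norm_def
      using DD(2) discretized_gradient[OF gradient_represented[OF f0 rep]] par
      by (intro add_mono mult_left_mono) auto
    ultimately show ?thesis
      unfolding objective_def using par(3) by (simp add: mult_left_mono)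
  qed
  ultimately show ?thesis by (rule that)
qed

theorem theorem5:
  fixes N :: nat and y :: "nat \<times> nat \<Rightarrow> real" and \<theta> lam :: real
  assumes "0 < \<theta>" and "\<theta> \<le> 1" and "0 < lam"
  shows "\<forall>N1 N2. N \<le> N1 \<and> N1 \<le> N2 \<longrightarrow>
    V_grid N y \<theta> lam N1 \<subseteq> V_grid N y \<theta> lam N2 \<and>
    V_grid N y \<theta> lam N2 \<subseteq> V_cont N y \<theta> lam"
proof -
  let ?J = "objective N y \<theta> lam"
  have sub: "M_DD0_pos_grid n \<subseteq> M_DD0_pos" for n by (auto simp: M_DD0_pos_grid_def)
  have mono: "M_DD0_pos_grid m \<subseteq> M_DD0_pos_grid n" if "m \<le> n" for m n
    using M_space_mono[OF grid_mono[OF that]] by (auto simp: M_DD0_pos_grid_def)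
  have extend: "argmin_on (M_DD0_pos_grid n) ?J \<subseteq> argmin_on S ?J"
    if "N \<le> n" "M_DD0_pos_grid n \<subseteq> S" "S \<subseteq> M_DD0_pos" for n S
  proof
    fix f assume f: "f \<in> argmin_on (M_DD0_pos_grid n) ?J"
    have "\<not> ?J g < ?J f" if g: "g \<in> S" for g
    proof -
      obtain h where "h \<in> M_DD0_pos_grid n" "?J h \<le> ?J g"
        using discretization_exists[OF _ \<open>N \<le> n\<close> assms, of g y] g \<open>S \<subseteq> _\<close> by blast
      then show ?thesis using f by (fastforce simp: argmin_on_def is_arg_min_def)
    qed
    then show "f \<in> argmin_on S ?J"
      using f \<open>_ \<subseteq> S\<close> by (auto simp: argmin_on_def is_arg_min_def)
  qed
  show ?thesis
    unfolding V_grid_def V_cont_def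
  proof (intro allI impI conjI)
    fix N1 N2 assume "N \<le> N1 \<and> N1 \<le> N2"
    then show "argmin_on (M_DD0_pos_grid N1) ?J \<subseteq> argmin_on (M_DD0_pos_grid N2) ?J"
      "argmin_on (M_DD0_pos_grid N2) ?J \<subseteq> argmin_on M_DD0_pos ?J"
      using extend mono sub by auto
  qed
qed

end
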